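(* Fix integers $d_3 \ge d_2 \ge d_1 \ge 3$ and $k \ge 1$ such that $(d_1+1)(d_2+1)(d_3+1) = 4(k+1)$. Assume that $$k+1 \le (d_3-2)\left[\frac{(d_1+1)(d_2+1)}{3}\right],$$ where $[\,\cdot\,]$ denotes the integral part. Then a general $(d_1,d_2,d_3)$ partially symmetric tensor in $\mathbb{P}^{2^{d_1+d_2+d_3}-1}$ can be expressed in $\nu \ge 2$ ways as a sum of $k+1$ decomposable tensors.
   Context: We work over an algebraically closed field of characteristic zero. Let $\Sigma \subset \mathbb{P}^N$, $N = (d_1+1)(d_2+1)(d_3+1)-1$, be the image of $\mathbb{P}^1\times\mathbb{P}^1\times\mathbb{P}^1$ under the embedding given by the complete linear system $|\mathcal{O}(d_1,d_2,d_3)|$ (Segre-Veronese variety). The space $\mathbb{P}^N$ is viewed inside $\mathbb{P}^{2^{d_1+d_2+d_3}-1}$ (the projective space of tensors of order $d_1+d_2+d_3$ on a $2$-dimensional vector space) as the space of tensors invariant under the natural actions of the symmetric groups $S_{d_1}, S_{d_2}, S_{d_3}$ permuting the tensor factors in the three corresponding blocks. The points of $\mathbb{P}^N$ are called $(d_1,d_2,d_3)$ partially symmetric tensors, and the points of $\Sigma$ are the decomposable ones. "General" means: in a dense Zariski open subset of $\mathbb{P}^N$. Ways of expressing a general tensor as a sum of $k+1$ decomposable tensors are counted up to the order of the summands; $\nu$ is the number of $k$-dimensional linear spaces spanned by $k+1$ points of $\Sigma$ passing through a general point of $\mathbb{P}^N$. *)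

theory Defs
  imports
    "HOL-Analysis.Abstract_Topology"
    "HOL-Combinatorics.Permutations"
    "HOL-Computational_Algebra.Polynomial"
    "HOL-Library.Function_Algebras"
    "HOL-Library.Multiset"
begin

section \<open>Tensors on a two-dimensional space\<close>

text \<open>
  The two-dimensional vector space is the space of functions \<open>bool \<Rightarrow> 'a\<close>. A tensor
  of order \<open>n\<close> is given by its \<open>2 ^ n\<close> coordinates, indexed by the lists of length \<open>n\<close>;
  by convention all other entries vanish.
\<close>

type_synonym 'a vec2 = "bool \<Rightarrow> 'a"
type_synonym 'a tensor = "bool list \<Rightarrow> 'a"

definition tscale :: "'a::field \<Rightarrow> 'a tensor \<Rightarrow> 'a tensor"
  where "tscale c T = (\<lambda>is. c * T is)"

global_interpretation tensor: vector_space tscale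
  by unfold_locales (auto simp: tscale_def fun_eq_iff algebra_simps)

definition tensors :: "nat \<Rightarrow> 'a::field tensor set"
  where "tensors n = {T. \<forall>is. length is \<noteq> n \<longrightarrow> T is = 0}"

definition invariant_on_block :: "nat set \<Rightarrow> 'a::field tensor \<Rightarrow> bool"
  where "invariant_on_block B T \<longleftrightarrow>
    (\<forall>\<pi>. \<pi> permutes B \<longrightarrow> (\<forall>is. B \<subseteq> {..<length is} \<longrightarrow> T (permute_list \<pi> is) = T is))"

definition partially_symmetric :: "nat \<Rightarrow> nat \<Rightarrow> nat \<Rightarrow> 'a::field tensor set"
  where "partially_symmetric d1 d2 d3 =
    {T \<in> tensors (d1 + d2 + d3).
       invariant_on_block {..<d1} T \<and>
       invariant_on_block {d1..<d1 + d2} T \<and>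
       invariant_on_block {d1 + d2..<d1 + d2 + d3} T}"

text \<open>\<open>tensor_prod m S T\<close> is the tensor product of a tensor \<open>S\<close> of order \<open>m\<close> with \<open>T\<close>.\<close>

definition tensor_prod :: "nat \<Rightarrow> 'a::field tensor \<Rightarrow> 'a tensor \<Rightarrow> 'a tensor"
  where "tensor_prod m S T = (\<lambda>is. S (take m is) * T (drop m is))"

definition tensor_power :: "nat \<Rightarrow> 'a::field vec2 \<Rightarrow> 'a tensor"
  where "tensor_power n a = (\<lambda>is. if length is = n then prod_list (map a is) else 0)"

section \<open>Projective spaces of tensors\<close>

text \<open>A point of a projective space is a one-dimensional linear subspace.\<close>

definition proj_point :: "'a::field tensor \<Rightarrow> 'a tensor set"
  where "proj_point T = tensor.span {T}"

definition proj_space :: "'a::field tensor set \<Rightarrow> 'a tensor set set"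
  where "proj_space V = {proj_point T | T. T \<in> V \<and> T \<noteq> 0}"

inductive homogeneous_polynomial :: "nat \<Rightarrow> ('a::field tensor \<Rightarrow> 'a) \<Rightarrow> bool" where
  zero: "homogeneous_polynomial n (\<lambda>T. 0)"
| const: "homogeneous_polynomial 0 (\<lambda>T. c)"
| coord: "homogeneous_polynomial 1 (\<lambda>T. T is)"
| add: "homogeneous_polynomial n f \<Longrightarrow> homogeneous_polynomial n g \<Longrightarrow>
    homogeneous_polynomial n (\<lambda>T. f T + g T)"
| mult: "homogeneous_polynomial m f \<Longrightarrow> homogeneous_polynomial n g \<Longrightarrow>
    homogeneous_polynomial (m + n) (\<lambda>T. f T * g T)"

definition zero_locus :: "'a::field tensor set \<Rightarrow> ('a tensor \<Rightarrow> 'a) set \<Rightarrow> 'a tensor set set"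
  where "zero_locus V F = {p \<in> proj_space V. \<forall>f\<in>F. \<forall>T\<in>p. f T = 0}"

definition zariski :: "'a::field tensor set \<Rightarrow> 'a tensor set topology"
  where "zariski V = topology (\<lambda>U. \<exists>F. (\<forall>f\<in>F. \<exists>n. homogeneous_polynomial n f) \<and>
    U = proj_space V - zero_locus V F)"

lemma homogeneous_polynomial_tscale:
  "homogeneous_polynomial n f \<Longrightarrow> f (tscale c T) = c ^ n * f T"
  by (induction rule: homogeneous_polynomial.induct)
     (auto simp: tscale_def algebra_simps power_add)

lemma zero_locus_proj_point_mult:
  assumes f: "homogeneous_polynomial m f" and g: "homogeneous_polynomial n g"
    and fg: "\<And>S. S \<in> proj_point T \<Longrightarrow> f S * g S = 0"
  shows "(\<forall>S\<in>proj_point T. f S = 0) \<or> (\<forall>S\<in>proj_point T. g S = 0)"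
proof -
  have "T \<in> proj_point T"
    by (simp add: proj_point_def tensor.span_base)
  then have "f T = 0 \<or> g T = 0"
    using fg by fastforce
  moreover have "\<exists>c. S = tscale c T" if "S \<in> proj_point T" for S
    using that by (auto simp: proj_point_def tensor.span_singleton)
  ultimately show ?thesis
    using homogeneous_polynomial_tscale[OF f, of _ T] homogeneous_polynomial_tscale[OF g, of _ T]
    by fastforce
qed

lemma zero_locus_Un:
  assumes F: "\<forall>f\<in>F. \<exists>n. homogeneous_polynomial n f"
    and G: "\<forall>g\<in>G. \<exists>n. homogeneous_polynomial n g"
  shows "zero_locus V F \<union> zero_locus V G =
    zero_locus V {\<lambda>T. f T * g T | f g. f \<in> F \<and> g \<in> G}"
proof (rule set_eqI)
  fix p
  have "(\<forall>h\<in>{\<lambda>T. f T * g T | f g. f \<in> F \<and> g \<in> G}. \<forall>S\<in>p. h S = 0) \<longleftrightarrow>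
      (\<forall>f\<in>F. \<forall>S\<in>p. f S = 0) \<or> (\<forall>g\<in>G. \<forall>S\<in>p. g S = 0)" (is "?P \<longleftrightarrow> ?Q")
    if "p \<in> proj_space V"
  proof
    from that obtain T where T: "p = proj_point T"
      unfolding proj_space_def by blast
    assume ?P
    have "(\<forall>S\<in>p. f S = 0) \<or> (\<forall>S\<in>p. g S = 0)" if f: "f \<in> F" and g: "g \<in> G" for f g
    proof -
      have "(\<lambda>T. f T * g T) \<in> {\<lambda>T. f T * g T | f g. f \<in> F \<and> g \<in> G}"
        using f g by blast
      with \<open>?P\<close> have "\<forall>S\<in>p. f S * g S = 0"
        by (rule bspec)
      moreover obtain m n where "homogeneous_polynomial m f" "homogeneous_polynomial n g"
        using bspec[OF F f] bspec[OF G g] by (elim exE)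
      ultimately show ?thesis
        unfolding T by (intro zero_locus_proj_point_mult) simp_all
    qed
    then show ?Q
      by meson
  next
    assume ?Q
    then show ?P
    proof (elim disjE; intro ballI)
      fix h S
      assume "h \<in> {\<lambda>T. f T * g T | f g. f \<in> F \<and> g \<in> G}" and S: "S \<in> p"
      then obtain f g where h: "h = (\<lambda>T. f T * g T)" "f \<in> F" "g \<in> G"
        by blast
      show "h S = 0" if "\<forall>f\<in>F. \<forall>S\<in>p. f S = 0"
        using that h S by simp
      show "h S = 0" if "\<forall>g\<in>G. \<forall>S\<in>p. g S = 0"
        using that h S by simp
    qed
  qed
  then show "p \<in> zero_locus V F \<union> zero_locus V G \<longleftrightarrow>
      p \<in> zero_locus V {\<lambda>T. f T * g T | f g. f \<in> F \<and> g \<in> G}"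
    unfolding zero_locus_def Un_iff mem_Collect_eq by argo
qed

lemma istopology_zariski:
  "istopology (\<lambda>U. \<exists>F. (\<forall>f\<in>F. \<exists>n. homogeneous_polynomial n f) \<and>
     U = proj_space V - zero_locus V F)"
  unfolding istopology_def
proof (intro conjI allI impI)
  fix S T
  assume "\<exists>F. (\<forall>f\<in>F. \<exists>n. homogeneous_polynomial n f) \<and> S = proj_space V - zero_locus V F"
    and "\<exists>F. (\<forall>f\<in>F. \<exists>n. homogeneous_polynomial n f) \<and> T = proj_space V - zero_locus V F"
  then obtain F G
    where F: "\<forall>f\<in>F. \<exists>n. homogeneous_polynomial n f" "S = proj_space V - zero_locus V F"
      and G: "\<forall>f\<in>G. \<exists>n. homogeneous_polynomial n f" "T = proj_space V - zero_locus V G"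
    by blast
  let ?H = "{\<lambda>T. f T * g T | f g. f \<in> F \<and> g \<in> G}"
  have "\<forall>h\<in>?H. \<exists>n. homogeneous_polynomial n h"
    using F(1) G(1) homogeneous_polynomial.mult by blast
  moreover have "S \<inter> T = proj_space V - zero_locus V ?H"
    using zero_locus_Un[OF F(1) G(1), of V] F(2) G(2) by blast
  ultimately show "\<exists>F. (\<forall>f\<in>F. \<exists>n. homogeneous_polynomial n f) \<and>
      S \<inter> T = proj_space V - zero_locus V F"
    by blast
next
  fix K
  assume "\<forall>U\<in>K. \<exists>F. (\<forall>f\<in>F. \<exists>n. homogeneous_polynomial n f) \<and>
    U = proj_space V - zero_locus V F"
  then obtain H where H: "\<forall>U\<in>K. (\<forall>f\<in>H U. \<exists>n. homogeneous_polynomial n f) \<and>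
      U = proj_space V - zero_locus V (H U)"
    unfolding bchoice_iff by (elim exE)
  have "(\<lambda>U. U) ` K = (\<lambda>U. proj_space V - zero_locus V (H U)) ` K"
  proof (rule image_cong[OF refl])
    fix U assume "U \<in> K"
    with H show "U = proj_space V - zero_locus V (H U)"
      by (drule_tac bspec) (assumption, erule conjunct2)
  qed
  then have "\<Union>K = (\<Union>U\<in>K. proj_space V - zero_locus V (H U))"
    by simp
  also have "\<dots> = proj_space V - zero_locus V (\<Union>U\<in>K. H U)"
    by (auto simp: zero_locus_def)
  finally have "\<Union>K = proj_space V - zero_locus V (\<Union>U\<in>K. H U)" .
  moreover have "\<forall>f\<in>(\<Union>U\<in>K. H U). \<exists>n. homogeneous_polynomial n f"
    using H by blast
  ultimately show "\<exists>F. (\<forall>f\<in>F. \<exists>n. homogeneous_polynomial n f) \<and>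
      \<Union>K = proj_space V - zero_locus V F"
    by blast
qed

lemma openin_zariski:
  "openin (zariski V) U \<longleftrightarrow>
    (\<exists>F. (\<forall>f\<in>F. \<exists>n. homogeneous_polynomial n f) \<and> U = proj_space V - zero_locus V F)"
  unfolding zariski_def by (simp add: istopology_zariski)

lemma topspace_zariski: "topspace (zariski V) = proj_space V"
proof
  show "topspace (zariski V) \<subseteq> proj_space V"
    by (auto simp: topspace_def openin_zariski)
  have "zero_locus V {\<lambda>T. 1} = {}"
    by (auto simp: zero_locus_def proj_space_def proj_point_def intro: tensor.span_zero)
  then have "openin (zariski V) (proj_space V)"
    unfolding openin_zariski
    by (intro exI[of _ "{\<lambda>T. 1}"]) (auto intro: homogeneous_polynomial.const)
  then show "proj_space V \<subseteq> topspace (zariski V)"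
    by (rule openin_subset)
qed

definition holds_generally :: "'a::field tensor set \<Rightarrow> ('a tensor set \<Rightarrow> bool) \<Rightarrow> bool"
  where "holds_generally V P \<longleftrightarrow>
    (\<exists>U. openin (zariski V) U \<and> zariski V closure_of U = topspace (zariski V) \<and> (\<forall>p\<in>U. P p))"

section \<open>The Segre-Veronese variety, its secant spaces, and decompositions\<close>

definition segre_veronese :: "nat \<Rightarrow> nat \<Rightarrow> nat \<Rightarrow> 'a::field tensor set set"
  where "segre_veronese d1 d2 d3 =
    {proj_point (tensor_prod d1 (tensor_power d1 a)
        (tensor_prod d2 (tensor_power d2 b) (tensor_power d3 c))) | a b c.
      a \<noteq> 0 \<and> b \<noteq> 0 \<and> c \<noteq> 0}"

text \<open>
  The linear spaces of projective dimension \<open>k\<close> that are spanned by \<open>k + 1\<close> points of \<open>X\<close>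
  and pass through the point \<open>p\<close>.
\<close>

definition secant_spaces_through ::
    "'a::field tensor set set \<Rightarrow> nat \<Rightarrow> 'a tensor set \<Rightarrow> 'a tensor set set set"
  where "secant_spaces_through X k p =
    {proj_space (tensor.span (\<Union>S)) | S.
       S \<subseteq> X \<and> card S = k + 1 \<and> tensor.dim (tensor.span (\<Union>S)) = k + 1 \<and>
       p \<in> proj_space (tensor.span (\<Union>S))}"

text \<open>
  The ways of writing \<open>T\<close> as a sum of \<open>n\<close> tensors representing points of \<open>X\<close>. Using
  multisets, expressions that differ only in the order of the summands are identified.
\<close>

definition decompositions ::
    "'a::field tensor set set \<Rightarrow> nat \<Rightarrow> 'a tensor \<Rightarrow> 'a tensor multiset set"
  where "decompositions X n T =
    {M. size M = n \<and> (\<forall>v\<in>#M. v \<noteq> 0 \<and> proj_point v \<in> X) \<and> sum_mset M = T}"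

end

(*
Write a tensor through its coordinates on the box of exponents {0..d1} x {0..d2} x {0..d3}; a sum
of k + 1 decomposable tensors becomes a sum of k + 1 monomial vectors w * x^a * y^b * z^c, and the
parameters (w, x, y, z) of the summands and the coordinates are equally many.

Giving the parameters weights that are affine functions of the exponents, on either side of a plane
that cuts the box, only one part of the summands survives in the lowest order. Cutting repeatedly
until every cell consists of four affinely independent exponents shows that the coordinates are
algebraically independent functions of the parameters. If instead one cell is kept that has eight
exponents, six of them on a plane and one on each side of it, then two summands on this cell have a
non-trivial birational involution that preserves the coordinates. Hence the symmetric function
"sum of the squares of the e-th coordinates of the summands" is not a rational function of the
coordinates: a relation A * s = B would survive the degeneration.

So the minimal polynomial of s over the function field of the target has degree at least two. The
set of values of s on a fibre is definable, and a definable set contains all roots of an irreducible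
polynomial over a general point as soon as it contains one; since the characteristic is zero, the
general fibre has at least two points up to order. The number of points is generically constant
by quantifier elimination.

Finally, k + 1 general points impose independent conditions on forms of degree
(d1 - 1, d2 - 1, d3 - 1). Multiplying such forms with 1, x, y, z shows that the span of the points
meets the variety in no further point, so that decompositions and secant spaces correspond.
*)
theory Submission
  imports Defs
begin

section \<open>Polynomial functions\<close>

text \<open>Exhibiting two decompositions of a special vector would not suffice, since a special
  vector may have several where a general one has a single one. What can be carried from the small
  cell to the whole box is that \<open>s\<close> is not a rational function of the coordinates. The
  involution comes from an affine function with value 1 at \<open>e\<close>, -1 at \<open>f\<close>
  and 0 at the other six exponents. Multiplying the parameters of one summand by a number raised to
  its coefficients changes only the coordinates at \<open>e\<close> and \<open>f\<close>, by that
  number and its inverse, so their product c is kept. For two summands the sums v0 + v1 and c0/v0 +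
  c1/v1 are then to be preserved. This is a quadratic condition on the ratio v0/v1; one root is
  known, so the other one is rational. Four is the number of parameters of a summand and hence the
  size of a simplex cell. If the volume of a box is divisible by 4, then two sides are even, or the
  only even side is divisible by 4. In both cases a box with sides at least 4 is stacked from a few
  small boxes, whose cuts are checked by evaluation.\<close>

inductive polyfun :: "'i set \<Rightarrow> (('i \<Rightarrow> 'a::comm_ring_1) \<Rightarrow> 'a) \<Rightarrow> bool" for V where
  const: "polyfun V (\<lambda>e. c)"
| var: "i \<in> V \<Longrightarrow> polyfun V (\<lambda>e. e i)"
| add: "polyfun V f \<Longrightarrow> polyfun V g \<Longrightarrow> polyfun V (\<lambda>e. f e + g e)"
| mult: "polyfun V f \<Longrightarrow> polyfun V g \<Longrightarrow> polyfun V (\<lambda>e. f e * g e)"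

lemma polyfun_uminus: "polyfun V f \<Longrightarrow> polyfun V (\<lambda>e. - f e)"
  using polyfun.mult[OF polyfun.const[of V "- 1"]] by fastforce

lemma polyfun_diff: "polyfun V f \<Longrightarrow> polyfun V g \<Longrightarrow> polyfun V (\<lambda>e. f e - g e)"
  using polyfun.add[OF _ polyfun_uminus] by fastforce

lemma polyfun_sum: "(\<And>a. a \<in> A \<Longrightarrow> polyfun V (f a)) \<Longrightarrow> polyfun V (\<lambda>e. \<Sum>a\<in>A. f a e)"
  by (induction A rule: infinite_finite_induct) (auto intro: polyfun.intros)

lemma polyfun_prod: "(\<And>a. a \<in> A \<Longrightarrow> polyfun V (f a)) \<Longrightarrow> polyfun V (\<lambda>e. \<Prod>a\<in>A. f a e)"
  by (induction A rule: infinite_finite_induct) (auto intro: polyfun.intros)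

lemma polyfun_power: "polyfun V f \<Longrightarrow> polyfun V (\<lambda>e. f e ^ n)"
  by (induction n) (auto intro: polyfun.intros)

lemmas polyfun_intros = polyfun.intros polyfun_uminus polyfun_diff polyfun_sum polyfun_prod
  polyfun_power

lemma polyfun_subst:
  "polyfun V f \<Longrightarrow> (\<And>i. i \<in> V \<Longrightarrow> polyfun W (g i)) \<Longrightarrow> polyfun W (\<lambda>e. f (\<lambda>i. g i e))"
  by (induction rule: polyfun.induct) (auto intro: polyfun.intros)

lemma polyfun_cong: "polyfun V f \<Longrightarrow> (\<And>i. i \<in> V \<Longrightarrow> e i = e' i) \<Longrightarrow> f e = f e'"
  by (induction rule: polyfun.induct) auto

text \<open>The tool that reduces questions in many variables to one variable: straight lines serve
  for density arguments, general curves for degenerations.\<close>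

lemma polyfun_curve:
  fixes c :: "'i \<Rightarrow> 'a::comm_ring_1 poly"
  shows "polyfun V f \<Longrightarrow> \<exists>p. \<forall>t. poly p t = f (\<lambda>i. poly (c i) t)"
proof (induction rule: polyfun.induct)
  case (const x)
  show ?case by (rule exI[of _ "[:x:]"]) simp
next
  case (var i)
  show ?case by (rule exI[of _ "c i"]) simp
next
  case (add f g)
  then obtain p q where "\<forall>t. poly p t = f (\<lambda>i. poly (c i) t)"
    "\<forall>t. poly q t = g (\<lambda>i. poly (c i) t)" by blast
  then show ?case by (intro exI[of _ "p + q"]) simp
next
  case (mult f g)
  then obtain p q where "\<forall>t. poly p t = f (\<lambda>i. poly (c i) t)"
    "\<forall>t. poly q t = g (\<lambda>i. poly (c i) t)" by blast
  then show ?case by (intro exI[of _ "p * q"]) simp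
qed

text \<open>Restricting to the line through two points reduces to one variable; the common
  non-zero stays on that line.\<close>

lemma polyfun_nonzero_line:
  fixes f g :: "('i \<Rightarrow> 'a::field_char_0) \<Rightarrow> 'a"
  assumes "polyfun V f" "polyfun W g" "f x \<noteq> 0" "g y \<noteq> 0"
  obtains t where "f (\<lambda>i. (1 - t) * x i + t * y i) \<noteq> 0" "g (\<lambda>i. (1 - t) * x i + t * y i) \<noteq> 0"
proof -
  define c where "c = (\<lambda>i. [:x i, y i - x i:])"
  obtain p where p: "\<forall>t. poly p t = f (\<lambda>i. poly (c i) t)"
    using polyfun_curve[OF assms(1)] by blast
  obtain q where q: "\<forall>t. poly q t = g (\<lambda>i. poly (c i) t)"
    using polyfun_curve[OF assms(2)] by blast
  have "poly p 0 \<noteq> 0" "poly q 1 \<noteq> 0"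
    using p q assms(3,4) by (simp_all add: c_def)
  then have "p * q \<noteq> 0" by auto
  then obtain t where "poly (p * q) t \<noteq> 0"
    using poly_all_0_iff_0 by blast
  moreover have "(\<lambda>i. poly (c i) t) = (\<lambda>i. (1 - t) * x i + t * y i)"
    by (auto simp: c_def algebra_simps)
  ultimately show ?thesis
    using p q that[of t] by simp
qed

text \<open>Polynomials in several variables occur only as functions, so being nonzero means having
  a nonzero value. They form an integral domain: nonempty Zariski open subsets of affine space
  meet.\<close>

lemma polyfun_nonzero_mult:
  fixes f g :: "('i \<Rightarrow> 'a::field_char_0) \<Rightarrow> 'a"
  assumes "polyfun V f" "polyfun W g" "f x \<noteq> 0" "g y \<noteq> 0"
  shows "\<exists>z. f z * g z \<noteq> 0"
proof -
  obtain t where t: "f (\<lambda>i. (1 - t) * x i + t * y i) \<noteq> 0" "g (\<lambda>i. (1 - t) * x i + t * y i) \<noteq> 0"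
    by (rule polyfun_nonzero_line[of V f W g x y, OF assms])
  show ?thesis
    using t by (intro exI[of _ "\<lambda>i. (1 - t) * x i + t * y i"] no_zero_divisors)
qed

lemma polyfun_mult_eq_0:
  fixes f g :: "('i \<Rightarrow> 'a::field_char_0) \<Rightarrow> 'a"
  assumes "polyfun V f" "polyfun W g" "\<And>z. f z * g z = 0"
  shows "(\<forall>z. f z = 0) \<or> (\<forall>z. g z = 0)"
  using polyfun_nonzero_mult[OF assms(1,2)] assms(3) by blast

lemma polyfun_nonzero_prod:
  fixes f :: "'b \<Rightarrow> ('i \<Rightarrow> 'a::field_char_0) \<Rightarrow> 'a"
  assumes "finite A" "\<And>a. a \<in> A \<Longrightarrow> polyfun V (f a)" "\<And>a. a \<in> A \<Longrightarrow> \<exists>z. f a z \<noteq> 0"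
  shows "\<exists>z. (\<Prod>a\<in>A. f a z) \<noteq> 0"
  using assms
proof (induction A)
  case (insert a A)
  then obtain y z where "f a y \<noteq> 0" "(\<Prod>a\<in>A. f a z) \<noteq> 0" by blast
  with insert show ?case
    using polyfun_nonzero_mult[of V "f a" V "\<lambda>z. \<Prod>a\<in>A. f a z"] by (simp add: polyfun_prod)
qed auto

text \<open>The torus is dense: the product of the coordinates in \<open>V\<close> is itself a
  nonzero polynomial function.\<close>

lemma polyfun_eq_0_if_torus:
  fixes f :: "('i \<Rightarrow> 'a::field_char_0) \<Rightarrow> 'a"
  assumes f: "polyfun V f" and V: "finite V" and 0: "\<And>e. (\<forall>i. e i \<noteq> 0) \<Longrightarrow> f e = 0"
  shows "f e = 0"
proof (rule ccontr)
  assume "f e \<noteq> 0"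
  moreover have "\<exists>e. (\<Prod>i\<in>V. e i) \<noteq> (0::'a)"
    by (rule exI[of _ "\<lambda>_. 1"]) simp
  ultimately obtain z where z: "f z * (\<Prod>i\<in>V. z i) \<noteq> 0"
    using polyfun_nonzero_mult[of V f V "\<lambda>e. \<Prod>i\<in>V. e i", OF f polyfun_prod]
    by (auto intro: polyfun.var)
  \<comment> \<open>The torus condition concerns all coordinates; those outside \<open>V\<close> are
    invisible to \<open>f\<close> and are set to 1.\<close>
  let ?z = "\<lambda>i. if i \<in> V then z i else 1"
  have "f ?z = f z"
    by (rule polyfun_cong[OF f]) simp
  moreover have "f ?z = 0"
    using z V by (intro 0) (auto simp: prod_zero_iff)
  ultimately show False using z by simp
qed

subsection \<open>Families of univariate polynomials\<close>

text \<open>The formal degree is less than \<open>n\<close>; the formal leading coefficient may vanish for some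
  values of the parameters.\<close>

definition polyfam :: "'i set \<Rightarrow> nat \<Rightarrow> (('i \<Rightarrow> 'a::comm_ring_1) \<Rightarrow> 'a poly) \<Rightarrow> bool" where
  "polyfam V n p \<longleftrightarrow> (\<forall>k. polyfun V (\<lambda>e. coeff (p e) k)) \<and> (\<forall>e. \<forall>k\<ge>n. coeff (p e) k = 0)"

lemma polyfam_coeff: "polyfam V n p \<Longrightarrow> polyfun V (\<lambda>e. coeff (p e) k)"
  by (simp add: polyfam_def)

lemma polyfam_coeff_0: "polyfam V n p \<Longrightarrow> n \<le> k \<Longrightarrow> coeff (p e) k = 0"
  by (simp add: polyfam_def)

lemma polyfam_mono: "polyfam V m p \<Longrightarrow> m \<le> n \<Longrightarrow> polyfam V n p"
  by (auto simp: polyfam_def)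

lemma polyfam_monom:
  assumes "polyfun V f"
  shows "polyfam V (Suc n) (\<lambda>e. monom (f e) n)"
proof -
  have "polyfun V (\<lambda>e. if n = k then f e else 0)" for k
    using assms by (cases "n = k") (simp_all add: polyfun.const)
  then show ?thesis by (auto simp: polyfam_def)
qed

lemma polyfam_const: "polyfun V f \<Longrightarrow> polyfam V 1 (\<lambda>e. [:f e:])"
  using polyfam_monom[of V f 0] by (simp add: monom_0)

lemma polyfam_0: "polyfam V n (\<lambda>e. 0)"
  by (simp add: polyfam_def polyfun.const)

lemma polyfam_add: "polyfam V m p \<Longrightarrow> polyfam V n q \<Longrightarrow> polyfam V (max m n) (\<lambda>e. p e + q e)"
  by (auto simp: polyfam_def intro: polyfun.intros)

lemma polyfam_diff: "polyfam V m p \<Longrightarrow> polyfam V n q \<Longrightarrow> polyfam V (max m n) (\<lambda>e. p e - q e)"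
  by (auto simp: polyfam_def intro: polyfun_diff)

lemma polyfam_smult: "polyfun V f \<Longrightarrow> polyfam V n p \<Longrightarrow> polyfam V n (\<lambda>e. smult (f e) (p e))"
  by (auto simp: polyfam_def intro: polyfun.intros)

lemma polyfam_mult:
  assumes "polyfam V m p" "polyfam V n q"
  shows "polyfam V (m + n) (\<lambda>e. p e * q e)"
  unfolding polyfam_def coeff_mult
proof (intro conjI allI impI polyfun_sum polyfun.mult)
  show "polyfun V (\<lambda>e. coeff (p e) i)" "polyfun V (\<lambda>e. coeff (q e) i)" for i
    using assms by (auto intro: polyfam_coeff)
  show "(\<Sum>i\<le>k. coeff (p e) i * coeff (q e) (k - i)) = 0" if "m + n \<le> k" for k e
  proof (rule sum.neutral, rule ballI)
    fix i
    have "m \<le> i \<or> n \<le> k - i" using that by linarith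
    then show "coeff (p e) i * coeff (q e) (k - i) = 0"
      using assms by (auto simp: polyfam_coeff_0)
  qed
qed

lemma polyfam_poly:
  assumes "polyfam V n p"
  shows "poly (p e) x = (\<Sum>k<n. coeff (p e) k * x ^ k)"
proof -
  have "poly (p e) x = (\<Sum>k<max n (Suc (degree (p e))). coeff (p e) k * x ^ k)"
    unfolding poly_altdef by (rule sum.mono_neutral_left) (auto simp: coeff_eq_0 not_le)
  also have "\<dots> = (\<Sum>k<n. coeff (p e) k * x ^ k)"
    using assms by (intro sum.mono_neutral_right) (auto simp: polyfam_coeff_0)
  finally show ?thesis .
qed

lemma polyfun_polyfam_poly:
  assumes p: "polyfam V n p" and "\<And>i. i \<in> V \<Longrightarrow> polyfun W (g i)" and "polyfun W s"
  shows "polyfun W (\<lambda>e. poly (p (\<lambda>i. g i e)) (s e))"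
  unfolding polyfam_poly[OF p] using assms
  by (intro polyfun_sum polyfun.mult polyfun_power polyfun_subst[OF polyfam_coeff[OF p]])

text \<open>One variable \<open>v\<close> is singled out and the others become parameters of the
  coefficients. In this way the elimination of a variable and algebraic relations turn into
  questions about univariate polynomials.\<close>

lemma polyfun_imp_polyfam:
  assumes "polyfun W f"
  shows "\<exists>n p. polyfam (W - {v}) n p \<and> (\<forall>e x. f (e(v := x)) = poly (p e) x)"
  using assms
proof (induction rule: polyfun.induct)
  case (const c)
  show ?case
    by (rule exI[of _ 1], rule exI[of _ "\<lambda>e. [:c:]"])
      (use polyfam_const[OF polyfun.const] in auto)
next
  case (var i)
  show ?case
  proof (cases "i = v")
    case True
    then show ?thesis
      using polyfam_monom[OF polyfun.const[of "W - {v}" 1], of 1]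
      by (intro exI[of _ 2] exI[of _ "\<lambda>e. monom 1 1"]) (simp add: numeral_2_eq_2 poly_monom)
  next
    case False
    with var have "polyfam (W - {v}) 1 (\<lambda>e. [:e i:])"
      by (intro polyfam_const polyfun.var) simp
    with False show ?thesis by (intro exI[of _ 1] exI[of _ "\<lambda>e. [:e i:]"]) simp
  qed
next
  case (add f g)
  then obtain n p m q where "polyfam (W - {v}) n p" "\<forall>e x. f (e(v := x)) = poly (p e) x"
    "polyfam (W - {v}) m q" "\<forall>e x. g (e(v := x)) = poly (q e) x" by metis
  then show ?case
    by (intro exI[of _ "max n m"] exI[of _ "\<lambda>e. p e + q e"]) (auto intro: polyfam_add simp del: fun_upd_apply)
next
  case (mult f g)
  then obtain n p m q where "polyfam (W - {v}) n p" "\<forall>e x. f (e(v := x)) = poly (p e) x"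
    "polyfam (W - {v}) m q" "\<forall>e x. g (e(v := x)) = poly (q e) x" by metis
  then show ?case
    by (intro exI[of _ "n + m"] exI[of _ "\<lambda>e. p e * q e"]) (auto intro: polyfam_mult simp del: fun_upd_apply)
qed

text \<open>Multiplying by powers of the formal leading coefficient \<open>c\<close> replaces
  division, so quotient and remainder depend polynomially on the parameters, with one exponent for
  all parameter values. The bound on the quotient is recorded for later comparisons of
  degrees.\<close>

lemma polyfam_pseudo_divmod:
  assumes p: "polyfam V (Suc d) p" and f: "polyfam V n f"
  defines "c \<equiv> \<lambda>e. coeff (p e) d"
  shows "\<exists>N x r. polyfam V (n - d) x \<and> polyfam V d r \<and>
    (\<forall>e. smult (c e ^ N) (f e) = x e * p e + r e)"
  using f
proof (induction n arbitrary: f)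
  case 0
  then have "polyfam V d f" by (rule polyfam_mono) simp
  then show ?case
    by (intro exI[of _ 0] exI[of _ "\<lambda>e. 0"] exI[of _ f]) (simp add: polyfam_0)
next
  case (Suc n)
  show ?case
  proof (cases "n < d")
    case True
    with Suc have "polyfam V d f" by (intro polyfam_mono[OF Suc.prems]) simp
    then show ?thesis
      by (intro exI[of _ 0] exI[of _ "\<lambda>e. 0"] exI[of _ f]) (simp add: polyfam_0)
  next
    case False
    let ?a = "\<lambda>e. coeff (f e) n"
    let ?m = "\<lambda>e. monom (?a e) (n - d)"
    let ?g = "\<lambda>e. smult (c e) (f e) - ?m e * p e"
    have c: "polyfun V c" unfolding c_def by (rule polyfam_coeff[OF p])
    have a: "polyfun V ?a" by (rule polyfam_coeff[OF Suc.prems])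
    have m: "polyfam V (Suc (n - d)) ?m" by (rule polyfam_monom[OF a])
    have g': "polyfam V (max (Suc n) (Suc (n - d) + Suc d)) ?g"
      by (intro polyfam_diff polyfam_smult c Suc.prems polyfam_mult m p)
    have "coeff (?g e) k = 0" if "n \<le> k" for e k
    proof (cases "k = n")
      case True
      then show ?thesis using False by (simp add: coeff_monom_mult c_def)
    next
      case False
      with that \<open>\<not> n < d\<close> show ?thesis
        by (auto simp: coeff_monom_mult polyfam_coeff_0[OF Suc.prems] polyfam_coeff_0[OF p])
    qed
    then have "polyfam V n ?g"
      using g' by (simp add: polyfam_def)
    from Suc.IH[OF this] obtain N x r where N: "polyfam V (n - d) x" "polyfam V d r"
      "\<And>e. smult (c e ^ N) (?g e) = x e * p e + r e" by blast
    let ?x = "\<lambda>e. x e + smult (c e ^ N) (?m e)"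
    have "smult (c e ^ Suc N) (f e) = ?x e * p e + r e" for e
    proof -
      have "smult (c e ^ Suc N) (f e) = smult (c e ^ N) (?g e) + smult (c e ^ N) (?m e) * p e"
        by (simp add: smult_diff_right mult.commute)
      also have "\<dots> = ?x e * p e + r e" unfolding N(3) by (simp add: algebra_simps)
      finally show ?thesis .
    qed
    moreover have "polyfam V (Suc n - d) ?x"
      using polyfam_add[OF N(1) polyfam_smult[OF polyfun_power[OF c, of N] m]] False
      by (simp add: Suc_diff_le max_def)
    ultimately show ?thesis using N(2) by blast
  qed
qed

section \<open>Quantifier elimination\<close>

text \<open>These are the Boolean combinations of polynomial equations.\<close>

definition definable :: "'i set \<Rightarrow> (('i \<Rightarrow> 'a::comm_ring_1) \<Rightarrow> bool) \<Rightarrow> bool" where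
  "definable V P \<longleftrightarrow> (\<exists>A. finite A \<and> (\<forall>a\<in>A. polyfun V a) \<and>
    (\<forall>e e'. (\<forall>a\<in>A. a e = 0 \<longleftrightarrow> a e' = 0) \<longrightarrow> P e = P e'))"

lemma definable_eq_0: "polyfun V f \<Longrightarrow> definable V (\<lambda>e. f e = 0)"
  unfolding definable_def by (intro exI[of _ "{f}"]) auto

lemma definable_eq: "polyfun V f \<Longrightarrow> polyfun V g \<Longrightarrow> definable V (\<lambda>e. f e = g e)"
  using definable_eq_0[OF polyfun_diff, of V f g] by simp

lemma definable_const: "definable V (\<lambda>e. b)"
  unfolding definable_def by (intro exI[of _ "{}"]) auto

lemma definable_not: "definable V P \<Longrightarrow> definable V (\<lambda>e. \<not> P e)"
  unfolding definable_def by blast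

lemma definable_conj:
  assumes "definable V P" "definable V Q"
  shows "definable V (\<lambda>e. P e \<and> Q e)"
proof -
  obtain A B where A: "finite A" "\<forall>a\<in>A. polyfun V a"
      "\<forall>e e'. (\<forall>a\<in>A. a e = 0 \<longleftrightarrow> a e' = 0) \<longrightarrow> P e = P e'"
    and B: "finite B" "\<forall>a\<in>B. polyfun V a"
      "\<forall>e e'. (\<forall>a\<in>B. a e = 0 \<longleftrightarrow> a e' = 0) \<longrightarrow> Q e = Q e'"
    using assms unfolding definable_def by blast
  show ?thesis
    unfolding definable_def
  proof (rule exI[of _ "A \<union> B"], intro conjI allI impI)
    fix e e' assume *: "\<forall>a\<in>A \<union> B. (a e = 0) = (a e' = 0)"
    have "P e = P e'" by (rule A(3)[rule_format]) (use * in blast)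
    moreover have "Q e = Q e'" by (rule B(3)[rule_format]) (use * in blast)
    ultimately show "(P e \<and> Q e) = (P e' \<and> Q e')" by simp
  qed (use A B in auto)
qed

lemma definable_disj: "definable V P \<Longrightarrow> definable V Q \<Longrightarrow> definable V (\<lambda>e. P e \<or> Q e)"
  using definable_not[OF definable_conj[OF definable_not definable_not], of V P Q] by simp

lemma definable_ball:
  "finite I \<Longrightarrow> (\<And>i. i \<in> I \<Longrightarrow> definable V (P i)) \<Longrightarrow> definable V (\<lambda>e. \<forall>i\<in>I. P i e)"
  by (induction I rule: finite_induct) (auto simp: definable_const intro: definable_conj)

lemma definable_bex:
  "finite I \<Longrightarrow> (\<And>i. i \<in> I \<Longrightarrow> definable V (P i)) \<Longrightarrow> definable V (\<lambda>e. \<exists>i\<in>I. P i e)"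
  using definable_not[OF definable_ball[of I V "\<lambda>i e. \<not> P i e"]] definable_not by fastforce

lemma definable_subst:
  assumes "definable V P" "\<And>i. i \<in> V \<Longrightarrow> polyfun W (g i)"
  shows "definable W (\<lambda>e. P (\<lambda>i. g i e))"
proof -
  obtain A where A: "finite A" "\<forall>a\<in>A. polyfun V a"
      "\<forall>e e'. (\<forall>a\<in>A. a e = 0 \<longleftrightarrow> a e' = 0) \<longrightarrow> P e = P e'"
    using assms(1) unfolding definable_def by blast
  show ?thesis
    unfolding definable_def
    by (rule exI[of _ "(\<lambda>a e. a (\<lambda>i. g i e)) ` A"])
      (use A in \<open>auto intro: polyfun_subst[OF _ assms(2)]\<close>)
qed

lemma definable_cong:
  assumes "definable V P" "\<And>i. i \<in> V \<Longrightarrow> e i = e' i"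
  shows "P e = P e'"
  using assms polyfun_cong[of V _ e e'] unfolding definable_def by metis

text \<open>Polynomials that vanish identically are discarded. Where none of the others vanishes,
  the pattern of zeros is constant, and so is the truth value of \<open>P\<close>.\<close>

lemma definable_generic:
  fixes P :: "('i \<Rightarrow> 'a::field_char_0) \<Rightarrow> bool"
  assumes "definable V P"
  obtains g where "polyfun V g" "\<exists>e. g e \<noteq> 0"
    "(\<forall>e. g e \<noteq> 0 \<longrightarrow> P e) \<or> (\<forall>e. g e \<noteq> 0 \<longrightarrow> \<not> P e)"
proof -
  obtain A where A: "finite A" "\<forall>a\<in>A. polyfun V a"
      "\<forall>e e'. (\<forall>a\<in>A. a e = 0 \<longleftrightarrow> a e' = 0) \<longrightarrow> P e = P e'"
    using assms unfolding definable_def by blast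
  let ?B = "{a \<in> A. \<exists>e. a e \<noteq> 0}"
  let ?g = "\<lambda>e. \<Prod>a\<in>?B. a e"
  have "P e = P e'" if "?g e \<noteq> 0" "?g e' \<noteq> 0" for e e'
    by (rule A(3)[rule_format]) (use that A(1) in auto)
  then have "(\<forall>e. ?g e \<noteq> 0 \<longrightarrow> P e) \<or> (\<forall>e. ?g e \<noteq> 0 \<longrightarrow> \<not> P e)" by blast
  moreover have "polyfun V ?g" using A(2) by (intro polyfun_prod) auto
  moreover have "\<exists>e. ?g e \<noteq> 0" using A(1,2) by (intro polyfun_nonzero_prod[where V = V]) auto
  ultimately show ?thesis using that by blast
qed

lemma polyfam_power:
  assumes "polyfam V n p"
  shows "\<exists>m. polyfam V m (\<lambda>e. p e ^ k)"
proof (induction k)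
  case 0
  show ?case using polyfam_const[OF polyfun.const[of V 1]] by (auto simp: one_pCons)
next
  case (Suc k)
  then show ?case using polyfam_mult[OF assms] by auto
qed

lemma definable_polyfam_eq_0:
  assumes "polyfam V n p"
  shows "definable V (\<lambda>e. p e = 0)"
proof -
  have "p e = 0 \<longleftrightarrow> (\<forall>k\<in>{..<n}. coeff (p e) k = 0)" for e
    using polyfam_coeff_0[OF assms, of _ e] by (auto simp: poly_eq_iff) (metis lessThan_iff not_le)
  then show ?thesis
    by (simp add: definable_ball definable_eq_0 polyfam_coeff[OF assms] del: lessThan_iff)
qed

lemma degree_polyfam: "polyfam V (Suc d) f \<Longrightarrow> coeff (f e) d \<noteq> 0 \<Longrightarrow> degree (f e) = d"
  by (intro antisym degree_le le_degree) (simp_all add: polyfam_coeff_0)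

lemma dvd_smult_power_cancel:
  fixes f :: "'a::field poly"
  assumes "c \<noteq> 0" "smult (c ^ N) p = x * f + r"
  shows "f dvd p \<longleftrightarrow> f dvd r"
proof -
  have "f dvd p \<longleftrightarrow> f dvd x * f + r"
    using assms by (metis dvd_smult_iff power_not_zero)
  then show ?thesis by (simp add: dvd_add_right_iff)
qed

text \<open>Pseudo-division decides divisibility as long as the leading coefficient does not vanish,
  and the remainder is zero exactly if finitely many polynomials in the parameters are.\<close>

lemma definable_dvd:
  fixes f p :: "('i \<Rightarrow> 'a::field) \<Rightarrow> 'a poly"
  assumes f: "polyfam V (Suc d) f" and p: "polyfam V n p"
  shows "definable V (\<lambda>e. coeff (f e) d \<noteq> 0 \<and> f e dvd p e)"
proof -
  obtain N x r where r: "polyfam V d r"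
    and eq: "\<And>e. smult (coeff (f e) d ^ N) (p e) = x e * f e + r e"
    using polyfam_pseudo_divmod[OF f p] by blast
  have "f e dvd p e \<longleftrightarrow> r e = 0" if "coeff (f e) d \<noteq> 0" for e
  proof -
    have "f e dvd p e \<longleftrightarrow> f e dvd r e" using dvd_smult_power_cancel[OF that eq] .
    also have "\<dots> \<longleftrightarrow> r e = 0"
    proof
      assume "f e dvd r e"
      show "r e = 0"
      proof (rule ccontr)
        assume 0: "r e \<noteq> 0"
        then have "degree (f e) \<le> degree (r e)" using \<open>f e dvd r e\<close> by (rule dvd_imp_degree_le[rotated])
        then have "d \<le> degree (r e)" using degree_polyfam[OF f that] by simp
        then have "coeff (r e) (degree (r e)) = 0" by (rule polyfam_coeff_0[OF r])
        then show False using 0 by simp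
      qed
    qed simp
    finally show ?thesis .
  qed
  then have "(\<lambda>e. coeff (f e) d \<noteq> 0 \<and> f e dvd p e) = (\<lambda>e. \<not> coeff (f e) d = 0 \<and> r e = 0)" by auto
  then show ?thesis
    by (simp only:) (intro definable_conj definable_not definable_eq_0 polyfam_coeff[OF f]
        definable_polyfam_eq_0[OF r])
qed

text \<open>If every root of \<open>f\<close> is a root of \<open>g\<close>, then each linear factor
  of \<open>f\<close> divides \<open>g\<close>; there are \<open>degree f\<close> factors, so this
  power of \<open>g\<close> takes care of all multiplicities. An existential statement becomes a
  divisibility.\<close>

lemma root_not_root_iff:
  fixes f g :: "'a::alg_closed_field poly"
  assumes "f \<noteq> 0"
  shows "(\<exists>x. poly f x = 0 \<and> poly g x \<noteq> 0) \<longleftrightarrow> \<not> f dvd g ^ degree f"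
proof
  assume "\<exists>x. poly f x = 0 \<and> poly g x \<noteq> 0"
  then obtain x where "poly f x = 0" "poly g x \<noteq> 0" by blast
  then show "\<not> f dvd g ^ degree f"
    by (metis dvd_trans poly_eq_0_iff_dvd poly_power power_not_zero)
next
  assume *: "\<not> f dvd g ^ degree f"
  show "\<exists>x. poly f x = 0 \<and> poly g x \<noteq> 0"
  proof (rule ccontr)
    assume no: "\<nexists>x. poly f x = 0 \<and> poly g x \<noteq> 0"
    obtain A where A: "size A = degree f" "f = smult (lead_coeff f) (\<Prod>x\<in>#A. [:-x, 1:])"
      using alg_closed_imp_factorization[OF assms] by blast
    have "[:-x, 1:] dvd g" if "x \<in># A" for x
    proof -
      have "poly (\<Prod>x\<in>#A. [:-x, 1:]) x = 0" using that by (auto simp: poly_prod_mset)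
      then have "poly f x = 0" by (subst A(2)) simp
      then show ?thesis using no poly_eq_0_iff_dvd by metis
    qed
    then have "(\<Prod>x\<in>#A. [:-x, 1:]) dvd g ^ size A"
      by (induction A) (auto intro!: mult_dvd_mono simp del: mult_pCons_left)
    then have "f dvd g ^ size A"
      by (subst A(2)) (use assms in \<open>simp add: smult_dvd_iff\<close>)
    then show False using * A(1) by simp
  qed
qed

text \<open>The Euclidean algorithm with parameters: it reduces the equations to at most one, and a
  single equation with one inequation is decided by \<open>root_not_root_iff\<close>. Each step
  branches on whether a leading coefficient vanishes.\<close>

lemma definable_ex_poly:
  fixes g :: "('i \<Rightarrow> 'a::{alg_closed_field, field_char_0}) \<Rightarrow> 'a poly"
  assumes "\<And>n f. (n, f) \<in> set fs \<Longrightarrow> polyfam V n f" "polyfam V m g"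
  shows "definable V (\<lambda>e. \<exists>x. (\<forall>(n, f)\<in>set fs. poly (f e) x = 0) \<and> poly (g e) x \<noteq> 0)"
    (is "definable V (?P fs)")
  using assms(1)
\<comment> \<open>Counting \<open>Suc n\<close> instead of \<open>n\<close> lets the measure drop
  also when an equation with degree bound 0, hence the zero polynomial, is removed.\<close>
proof (induction "\<Sum>(n, f)\<leftarrow>fs. Suc n" arbitrary: fs rule: less_induct)
  case less
  \<comment> \<open>Where the leading coefficient vanishes, the leading term is dropped and the
    degree bound decreases.\<close>
  have tail: "definable V (\<lambda>e. coeff (f e) n = 0 \<and> ?P ((Suc n, f) # rest) e)"
    if fs: "set fs = set ((Suc n, f) # rest)"
      "(\<Sum>(n, f)\<leftarrow>fs. Suc n) = (\<Sum>(n, f)\<leftarrow>(Suc n, f) # rest. Suc n)" for n f rest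
  proof -
    let ?f = "\<lambda>e. f e - monom (coeff (f e) n) n"
    have f: "polyfam V (Suc n) f" using less.prems fs by auto
    have "polyfam V (Suc n) ?f"
      using polyfam_diff[OF f polyfam_monom[OF polyfam_coeff[OF f], of n n]] by simp
    then have f': "polyfam V n ?f"
      using polyfam_coeff_0[OF f] unfolding polyfam_def by (simp add: Suc_le_eq)
    have "definable V (?P ((n, ?f) # rest))"
      by (rule less.hyps) (use fs less.prems f' in auto)
    then have "definable V (\<lambda>e. coeff (f e) n = 0 \<and> ?P ((n, ?f) # rest) e)"
      by (intro definable_conj definable_eq_0 polyfam_coeff[OF f])
    moreover have "(\<lambda>e. coeff (f e) n = 0 \<and> ?P ((n, ?f) # rest) e) =
        (\<lambda>e. coeff (f e) n = 0 \<and> ?P ((Suc n, f) # rest) e)"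
      by (intro ext conj_cong refl) simp
    ultimately show ?thesis by simp
  qed
  consider (nil) "fs = []" | (zero) f rest where "fs = (0, f) # rest"
    | (single) n f where "fs = [(Suc n, f)]"
    | (two) n f n' f' rest where "fs = (Suc n, f) # (n', f') # rest"
  proof (cases fs)
    case (Cons a rest)
    obtain n f where a: "a = (n, f)" by (cases a)
    show ?thesis
    proof (cases n)
      case 0
      then show ?thesis using Cons a zero by simp
    next
      case (Suc k)
      show ?thesis
      proof (cases rest)
        case Nil
        then show ?thesis using Cons a Suc single by simp
      next
        case (Cons b rest')
        then show ?thesis using \<open>fs = a # rest\<close> a Suc two by (cases b) simp
      qed
    qed
  qed
  then show ?case
  proof cases
    case nil
    have "?P fs e \<longleftrightarrow> \<not> g e = 0" for e
      by (simp add: nil) (metis poly_all_0_iff_0)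
    then have "?P fs = (\<lambda>e. \<not> g e = 0)" by (rule ext)
    then show ?thesis
      by (simp only:) (intro definable_not definable_polyfam_eq_0[OF assms(2)])
  next
    case zero
    have "polyfam V 0 f" using less.prems zero by auto
    then have "f e = 0" for e by (simp add: polyfam_def poly_eq_iff)
    then have "?P fs = ?P rest" by (auto simp: zero)
    moreover have "definable V (?P rest)"
      by (rule less.hyps) (use zero less.prems in auto)
    ultimately show ?thesis by simp
  next
    case single
    have f: "polyfam V (Suc n) f" using less.prems single by auto
    obtain k where k: "polyfam V k (\<lambda>e. g e ^ n)" using polyfam_power[OF assms(2)] by blast
    have "?P fs e \<longleftrightarrow> (coeff (f e) n = 0 \<and> ?P fs e) \<or>
        (\<not> coeff (f e) n = 0 \<and> \<not> (coeff (f e) n \<noteq> 0 \<and> f e dvd g e ^ n))" for e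
    proof (cases "coeff (f e) n = 0")
      case False
      then have "f e \<noteq> 0" by auto
      from root_not_root_iff[OF this, of "g e"] show ?thesis
        using False degree_polyfam[OF f False] by (simp add: single)
    qed simp
    then have eq: "?P fs = (\<lambda>e. (coeff (f e) n = 0 \<and> ?P fs e) \<or>
        (\<not> coeff (f e) n = 0 \<and> \<not> (coeff (f e) n \<noteq> 0 \<and> f e dvd g e ^ n)))" by (rule ext)
    have "definable V (\<lambda>e. coeff (f e) n = 0 \<and> ?P fs e)"
      using tail[of n f "[]"] by (simp add: single)
    then show ?thesis
      by (subst eq) (rule definable_disj[OF _ definable_conj[OF definable_not[OF definable_eq_0]
            definable_not[OF definable_dvd[OF f k]]]], assumption, rule polyfam_coeff[OF f])
  next
    case two
    have ex: "\<exists>n f n' f' rest. n \<le> n' \<and> set fs = set ((Suc n, f) # (Suc n', f') # rest) \<and>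
      (\<Sum>(n, f)\<leftarrow>fs. Suc n) = (\<Sum>(n, f)\<leftarrow>(Suc n, f) # (Suc n', f') # rest. Suc n)" if nz: "n' \<noteq> 0"
    proof -
      obtain k where k: "n' = Suc k" using nz by (cases n') auto
      show ?thesis
      proof (cases "n \<le> k")
        case True
        show ?thesis
          by (rule exI[of _ n], rule exI[of _ f], rule exI[of _ k], rule exI[of _ f'],
              rule exI[of _ rest]) (simp add: True two k)
      next
        case False
        have "set fs = set ((Suc k, f') # (Suc n, f) # rest)"
          by (simp add: two k insert_commute)
        then show ?thesis using False
          by (intro exI[of _ k] exI[of _ f'] exI[of _ n] exI[of _ f] exI[of _ rest] conjI)
            (simp_all add: two k)
      qed
    qed
    show ?thesis
    proof (cases "n' = 0")
      case True
      have "polyfam V 0 f'" using less.prems two True by auto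
      then have "f' e = 0" for e by (simp add: polyfam_def poly_eq_iff)
      then have "?P fs = ?P ((Suc n, f) # rest)" by (auto simp: two)
      moreover have "definable V (?P ((Suc n, f) # rest))"
        by (rule less.hyps) (use two less.prems in auto)
      ultimately show ?thesis by simp
    next
      case False
      then obtain n f n' f' rest where nn: "n \<le> n'"
        and fs: "set fs = set ((Suc n, f) # (Suc n', f') # rest)"
        and sum: "(\<Sum>(n, f)\<leftarrow>fs. Suc n) = (\<Sum>(n, f)\<leftarrow>(Suc n, f) # (Suc n', f') # rest. Suc n)"
        using ex by blast
      have f: "polyfam V (Suc n) f" and f': "polyfam V (Suc n') f'" using less.prems fs by auto
      \<comment> \<open>Elsewhere the equation with the larger bound is replaced by its remainder
        modulo the other one, which does not change the common roots.\<close>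
      obtain N x r where r: "polyfam V n r"
        and eq: "\<And>e. smult (coeff (f e) n ^ N) (f' e) = x e * f e + r e"
        using polyfam_pseudo_divmod[OF f f'] by blast
      have r0: "poly (f e) y = 0 \<Longrightarrow> coeff (f e) n \<noteq> 0 \<Longrightarrow> poly (r e) y = 0 \<longleftrightarrow> poly (f' e) y = 0" for e y
        using arg_cong[OF eq[of e], of "\<lambda>p. poly p y"] by (auto simp: )
      let ?gs = "(Suc n, f) # (n, r) # rest"
      have "definable V (?P ?gs)"
        by (rule less.hyps) (use sum nn fs less.prems r in auto)
      then have d: "definable V (\<lambda>e. \<not> coeff (f e) n = 0 \<and> ?P ?gs e)"
        by (intro definable_conj definable_not definable_eq_0 polyfam_coeff[OF f])
      have "?P ?gs e \<longleftrightarrow> ?P fs e" if "coeff (f e) n \<noteq> 0" for e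
      proof -
        have "(\<forall>(n, f)\<in>set ?gs. poly (f e) y = 0) \<longleftrightarrow> (\<forall>(n, f)\<in>set fs. poly (f e) y = 0)" for y
          using r0[OF _ that, of y] unfolding fs by auto
        then show ?thesis by simp
      qed
      then have eq: "?P fs = (\<lambda>e. (coeff (f e) n = 0 \<and> ?P fs e) \<or> (\<not> coeff (f e) n = 0 \<and> ?P ?gs e))"
        by (intro ext) blast
      have "definable V (\<lambda>e. coeff (f e) n = 0 \<and> ?P fs e)"
        using tail[of n f "(Suc n', f') # rest"] fs sum by simp
      then show ?thesis
        by (subst eq) (rule definable_disj[OF _ d])
    qed
  qed
qed

text \<open>\<open>P\<close> is a finite disjunction over patterns of zeros of the polynomials in
  \<open>A\<close>. A pattern consists of several equations and of one inequation, the product of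
  all polynomials that are not to vanish.\<close>

lemma definable_ex1:
  fixes P :: "('i \<Rightarrow> 'a::{alg_closed_field, field_char_0}) \<Rightarrow> bool"
  assumes "definable V P"
  shows "definable (V - {v}) (\<lambda>e. \<exists>x. P (e(v := x)))"
proof -
  obtain A where A: "finite A" "\<forall>a\<in>A. polyfun V a"
      "\<forall>e e'. (\<forall>a\<in>A. a e = 0 \<longleftrightarrow> a e' = 0) \<longrightarrow> P e = P e'"
    using assms unfolding definable_def by blast
  define pat where "pat e = {a \<in> A. a e = 0}" for e
  have P: "P e \<longleftrightarrow> pat e \<in> pat ` {e. P e}" for e
  proof
    assume "pat e \<in> pat ` {e. P e}"
    then obtain e' where e': "P e'" "pat e = pat e'" by blast
    have "P e = P e'"
      by (rule A(3)[rule_format]) (use e'(2) in \<open>auto simp: pat_def\<close>)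
    with e' show "P e" by simp
  qed blast
  have "\<forall>a\<in>A. \<exists>z. polyfam (V - {v}) (fst z) (snd z) \<and> (\<forall>e x. a (e(v := x)) = poly (snd z e) x)"
    using A(2) polyfun_imp_polyfam by fastforce
  from bchoice[OF this] obtain z where z: "\<forall>a\<in>A. polyfam (V - {v}) (fst (z a)) (snd (z a)) \<and>
    (\<forall>e x. a (e(v := x)) = poly (snd (z a) e) x)" ..
  define n where "n a = fst (z a)" for a
  define p where "p a = snd (z a)" for a
  have p: "\<And>a. a \<in> A \<Longrightarrow> polyfam (V - {v}) (n a) (p a)"
    "\<And>a e x. a \<in> A \<Longrightarrow> a (e(v := x)) = poly (p a e) x"
    using z by (simp_all add: n_def p_def del: fun_upd_apply)
  have pat: "pat (e(v := x)) = I \<longleftrightarrow>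
      (\<forall>a\<in>I. poly (p a e) x = 0) \<and> (\<forall>a\<in>A - I. poly (p a e) x \<noteq> 0)" if "I \<subseteq> A" for e x I
  proof -
    have "pat (e(v := x)) = {a \<in> A. poly (p a e) x = 0}"
      unfolding pat_def by (rule Collect_cong) (use p(2) in metis)
    then show ?thesis using that by auto
  qed
  have "definable (V - {v}) (\<lambda>e. \<exists>x. pat (e(v := x)) = I)" if I: "I \<subseteq> A" for I
  proof -
    obtain as where as: "set as = I" using I A(1) finite_list finite_subset by metis
    have "\<exists>m. polyfam (V - {v}) m (\<lambda>e. \<Prod>a\<in>B. p a e)" if "B \<subseteq> A" for B
    proof -
      have "finite B" using that A(1) finite_subset by blast
      then show ?thesis using that
      proof (induction B)
        case empty
        show ?case using polyfam_const[OF polyfun.const[of "V - {v}" 1]] by (auto simp: one_pCons)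
      next
        case (insert b B)
        then obtain m where "polyfam (V - {v}) m (\<lambda>e. \<Prod>a\<in>B. p a e)" by auto
        with insert show ?case using polyfam_mult[OF p(1)[of b]] by auto
      qed
    qed
    then obtain m where m: "polyfam (V - {v}) m (\<lambda>e. \<Prod>a\<in>A - I. p a e)" by blast
    have "definable (V - {v}) (\<lambda>e. \<exists>x. (\<forall>(n, f)\<in>set (map (\<lambda>a. (n a, p a)) as). poly (f e) x = 0) \<and>
        poly (\<Prod>a\<in>A - I. p a e) x \<noteq> 0)"
      by (rule definable_ex_poly[OF _ m]) (use as I p(1) in auto)
    then show ?thesis
      using pat[OF I] A(1) by (simp add: as poly_prod)
  qed
  then have "definable (V - {v}) (\<lambda>e. \<exists>I\<in>Pow A \<inter> pat ` {e. P e}. \<exists>x. pat (e(v := x)) = I)"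
    using A(1) by (intro definable_bex) auto
  moreover have "(\<lambda>e. \<exists>I\<in>Pow A \<inter> pat ` {e. P e}. \<exists>x. pat (e(v := x)) = I) =
      (\<lambda>e. \<exists>x. P (e(v := x)))"
  proof (rule ext)
    fix e
    have "pat (e(v := x)) \<in> Pow A" for x by (auto simp: pat_def)
    then show "(\<exists>I\<in>Pow A \<inter> pat ` {e. P e}. \<exists>x. pat (e(v := x)) = I) = (\<exists>x. P (e(v := x)))"
      unfolding P[of "e(v := _)"] by blast
  qed
  ultimately show ?thesis by simp
qed

lemma definable_ex_finite:
  fixes P :: "('i \<Rightarrow> 'a::{alg_closed_field, field_char_0}) \<Rightarrow> bool"
  assumes "finite W" "definable V P"
  shows "definable (V - W) (\<lambda>e. \<exists>x. P (\<lambda>i. if i \<in> W then x i else e i))"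
  using assms
proof (induction W)
  case (insert v W)
  have eq: "(\<exists>x. P (\<lambda>i. if i \<in> insert v W then x i else e i)) \<longleftrightarrow>
      (\<exists>y. \<exists>x. P (\<lambda>i. if i \<in> W then x i else (e(v := y)) i))" for e
  proof (intro iffI; elim exE)
    fix x assume *: "P (\<lambda>i. if i \<in> insert v W then x i else e i)"
    have "(\<lambda>i. if i \<in> W then x i else (e(v := x v)) i) = (\<lambda>i. if i \<in> insert v W then x i else e i)"
      by auto
    with * have "P (\<lambda>i. if i \<in> W then x i else (e(v := x v)) i)" by simp
    then show "\<exists>y x. P (\<lambda>i. if i \<in> W then x i else (e(v := y)) i)" by blast
  next
    fix x y assume *: "P (\<lambda>i. if i \<in> W then x i else (e(v := y)) i)"
    have "(\<lambda>i. if i \<in> W then x i else (e(v := y)) i) =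
        (\<lambda>i. if i \<in> insert v W then (x(v := y)) i else e i)"
      using insert.hyps by auto
    with * show "\<exists>x. P (\<lambda>i. if i \<in> insert v W then x i else e i)" by (intro exI[of _ "x(v := y)"]) simp
  qed
  have "definable (V - W - {v}) (\<lambda>e. \<exists>y x. P (\<lambda>i. if i \<in> W then x i else (e(v := y)) i))"
    using definable_ex1[OF insert.IH[OF insert.prems], of v] .
  then show ?case by (simp only: eq Diff_insert[of V v W])
qed simp

text \<open>Projection along a block of variables. The variables to be kept and those to be
  eliminated are told apart by the sum type; as \<open>P\<close> sees only the finitely many indices
  in \<open>J\<close>, quantifying over whole functions \<open>q\<close> is quantifying over
  finitely many values.\<close>

lemma definable_ex:
  fixes P :: "('i + 'j \<Rightarrow> 'a::{alg_closed_field, field_char_0}) \<Rightarrow> bool"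
  assumes J: "finite J" and P: "definable (Inl ` K \<union> Inr ` J) P"
  shows "definable K (\<lambda>T. \<exists>q. P (case_sum T q))"
proof -
  let ?W = "Inr ` J :: ('i + 'j) set"
  have "definable (Inl ` K \<union> ?W - ?W) (\<lambda>e. \<exists>x. P (\<lambda>i. if i \<in> ?W then x i else e i))"
    using J by (intro definable_ex_finite P) simp
  moreover have "Inl ` K \<union> ?W - ?W = Inl ` K" by auto
  ultimately have "definable (Inl ` K) (\<lambda>e. \<exists>x. P (\<lambda>i. if i \<in> ?W then x i else e i))" by simp
  then have "definable K (\<lambda>T. \<exists>x. P (\<lambda>i. if i \<in> ?W then x i else case_sum T (\<lambda>_. 0) i))"
    by (rule definable_subst[where g = "\<lambda>i T. case_sum T (\<lambda>_. 0) i"]) (auto intro: polyfun.var)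
  moreover have "(\<exists>x. P (\<lambda>i. if i \<in> ?W then x i else case_sum T (\<lambda>_. 0) i)) \<longleftrightarrow>
      (\<exists>q. P (case_sum T q))" for T
  proof (intro iffI; elim exE)
    fix x assume "P (\<lambda>i. if i \<in> ?W then x i else case_sum T (\<lambda>_. 0) i)"
    then have "P (case_sum T (x \<circ> Inr))"
      by (subst definable_cong[OF P]) auto
    then show "\<exists>q. P (case_sum T q)" by blast
  next
    fix q assume "P (case_sum T q)"
    then have "P (\<lambda>i. if i \<in> ?W then case_sum T q i else case_sum T (\<lambda>_. 0) i)"
      by (subst definable_cong[OF P]) auto
    then show "\<exists>x. P (\<lambda>i. if i \<in> ?W then x i else case_sum T (\<lambda>_. 0) i)" by (rule exI[of _ "case_sum T q"])
  qed
  ultimately show ?thesis by simp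
qed

section \<open>Algebraic dependence\<close>

text \<open>Gaussian elimination: an unknown \<open>p\<close> that really occurs in the equation
  \<open>g\<close> is eliminated from the others and recovered at the end from that
  equation.\<close>

lemma homogeneous_system_solution:
  fixes a :: "'i \<Rightarrow> 'g \<Rightarrow> 'a::field"
  assumes "finite G" "finite I" "card G < card I"
  shows "\<exists>c. (\<exists>i\<in>I. c i \<noteq> 0) \<and> (\<forall>g\<in>G. (\<Sum>i\<in>I. c i * a i g) = 0)"
  using assms
proof (induction G arbitrary: a I)
  case empty
  then have "\<exists>i. i \<in> I" by (metis card.empty ex_in_conv less_irrefl)
  then show ?case by (intro exI[of _ "\<lambda>_. 1"]) auto
next
  case (insert g G)
  show ?case
  proof (cases "\<forall>i\<in>I. a i g = 0")
    case True
    have "card G < card I" using insert by simp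
    from insert.IH[OF insert.prems(1) this, of a] obtain c where
      "\<exists>i\<in>I. c i \<noteq> 0" "\<forall>g\<in>G. (\<Sum>i\<in>I. c i * a i g) = 0" by blast
    then show ?thesis using True by (intro exI[of _ c]) simp
  next
    case False
    then obtain p where p: "p \<in> I" "a p g \<noteq> 0" by blast
    define b where "b i h = a i h - a i g / a p g * a p h" for i h
    have "card G < card (I - {p})" using insert p by simp
    from insert.IH[OF _ this, of b] insert.prems obtain c where
      c: "\<exists>i\<in>I - {p}. c i \<noteq> 0" "\<And>h. h \<in> G \<Longrightarrow> (\<Sum>i\<in>I - {p}. c i * b i h) = 0" by auto
    define C where "C = (\<Sum>i\<in>I - {p}. c i * a i g)"
    define d where "d = c(p := - C / a p g)"
    have sum: "(\<Sum>i\<in>I. d i * a i h) = (\<Sum>i\<in>I - {p}. c i * a i h) - C / a p g * a p h" for h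
    proof -
      have "(\<Sum>i\<in>I. d i * a i h) = d p * a p h + (\<Sum>i\<in>I - {p}. d i * a i h)"
        using p insert.prems by (simp add: sum.remove)
      also have "(\<Sum>i\<in>I - {p}. d i * a i h) = (\<Sum>i\<in>I - {p}. c i * a i h)"
        by (rule sum.cong) (auto simp: d_def)
      finally show ?thesis by (simp add: d_def)
    qed
    have "(\<Sum>i\<in>I. d i * a i h) = 0" if "h \<in> G" for h
    proof -
      have "0 = (\<Sum>i\<in>I - {p}. c i * b i h)" using c(2)[OF that] by simp
      also have "\<dots> = (\<Sum>i\<in>I - {p}. c i * a i h - c i * a i g * (a p h / a p g))"
        by (rule sum.cong) (auto simp: b_def algebra_simps)
      also have "\<dots> = (\<Sum>i\<in>I - {p}. c i * a i h) - C * (a p h / a p g)"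
        by (simp add: sum_subtractf C_def sum_distrib_right sum_divide_distrib)
      also have "\<dots> = (\<Sum>i\<in>I. d i * a i h)" by (simp add: sum)
      finally show ?thesis by simp
    qed
    moreover have "(\<Sum>i\<in>I. d i * a i g) = 0" unfolding sum using p by (simp add: C_def)
    moreover have "\<exists>i\<in>I. d i \<noteq> 0" using c(1) by (auto simp: d_def)
    ultimately show ?thesis by blast
  qed
qed

section \<open>Counting monomials of bounded degree\<close>

definition monomial :: "'j set \<Rightarrow> ('j \<Rightarrow> nat) \<Rightarrow> ('j \<Rightarrow> 'a::comm_ring_1) \<Rightarrow> 'a" where
  "monomial J \<gamma> x = (\<Prod>j\<in>J. x j ^ \<gamma> j)"

abbreviation exponents :: "'j set \<Rightarrow> nat \<Rightarrow> ('j \<Rightarrow> nat) set" where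
  "exponents J D \<equiv> PiE J (\<lambda>_. {..D})"

text \<open>The degree is bounded in each variable separately. The exponents then form a product
  set, whose cardinality is a plain power.\<close>

definition degree_bounded :: "'j set \<Rightarrow> nat \<Rightarrow> (('j \<Rightarrow> 'a::comm_ring_1) \<Rightarrow> 'a) \<Rightarrow> bool" where
  "degree_bounded J D f \<longleftrightarrow> (\<exists>c. \<forall>x. f x = (\<Sum>\<gamma>\<in>exponents J D. c \<gamma> * monomial J \<gamma> x))"

lemma polyfun_monomial: "polyfun J (monomial J \<gamma>)"
  unfolding monomial_def[abs_def] by (intro polyfun_intros)

lemma degree_bounded_monomial:
  assumes "finite J" "\<And>j. j \<in> J \<Longrightarrow> \<gamma> j \<le> D"
  shows "degree_bounded J D (\<lambda>x. c * monomial J \<gamma> x)"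
  unfolding degree_bounded_def
proof (intro exI[of _ "\<lambda>\<delta>. if \<delta> = restrict \<gamma> J then c else 0"] allI)
  fix x :: "'a \<Rightarrow> 'b"
  have "(\<Sum>\<delta>\<in>exponents J D. (if \<delta> = restrict \<gamma> J then c else 0) * monomial J \<delta> x)
      = (\<Sum>\<delta>\<in>{restrict \<gamma> J}. c * monomial J \<delta> x)"
    using assms by (intro sum.mono_neutral_cong_right) (auto simp: finite_PiE)
  also have "\<dots> = c * monomial J \<gamma> x" by (simp add: monomial_def)
  finally show "c * monomial J \<gamma> x =
      (\<Sum>\<delta>\<in>exponents J D. (if \<delta> = restrict \<gamma> J then c else 0) * monomial J \<delta> x)" by simp
qed

lemma degree_bounded_add:
  assumes "degree_bounded J D f" "degree_bounded J D g"
  shows "degree_bounded J D (\<lambda>x. f x + g x)"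
proof -
  obtain c d where "\<forall>x. f x = (\<Sum>\<gamma>\<in>exponents J D. c \<gamma> * monomial J \<gamma> x)"
    "\<forall>x. g x = (\<Sum>\<gamma>\<in>exponents J D. d \<gamma> * monomial J \<gamma> x)"
    using assms unfolding degree_bounded_def by blast
  then show ?thesis
    unfolding degree_bounded_def
    by (intro exI[of _ "\<lambda>\<gamma>. c \<gamma> + d \<gamma>"]) (simp add: algebra_simps sum.distrib)
qed

lemma degree_bounded_sum:
  assumes "\<And>a. a \<in> A \<Longrightarrow> degree_bounded J D (f a)"
  shows "degree_bounded J D (\<lambda>x. \<Sum>a\<in>A. f a x)"
proof -
  have "degree_bounded J D (\<lambda>x. 0)"
    unfolding degree_bounded_def by (rule exI[of _ "\<lambda>_. 0"]) simp
  then show ?thesis using assms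
    by (induction A rule: infinite_finite_induct) (auto intro: degree_bounded_add)
qed

lemma degree_bounded_const: "finite J \<Longrightarrow> degree_bounded J D (\<lambda>x. c)"
  using degree_bounded_monomial[of J "\<lambda>_. 0" D c] by (simp add: monomial_def)

lemma degree_bounded_mult:
  assumes J: "finite J" and f: "degree_bounded J D f" and g: "degree_bounded J E g"
  shows "degree_bounded J (D + E) (\<lambda>x. f x * g x)"
proof -
  obtain c d where c: "\<And>x. f x = (\<Sum>\<gamma>\<in>exponents J D. c \<gamma> * monomial J \<gamma> x)"
    and d: "\<And>x. g x = (\<Sum>\<gamma>\<in>exponents J E. d \<gamma> * monomial J \<gamma> x)"
    using f g unfolding degree_bounded_def by blast
  have "f x * g x = (\<Sum>(\<gamma>, \<delta>)\<in>exponents J D \<times> exponents J E.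
      (c \<gamma> * d \<delta>) * monomial J (\<lambda>j. \<gamma> j + \<delta> j) x)" for x
    unfolding c d sum_product sum.cartesian_product
    by (intro sum.cong) (auto simp: monomial_def power_add prod.distrib algebra_simps)
  moreover have "degree_bounded J (D + E)
      (\<lambda>x. c \<gamma> * d \<delta> * monomial J (\<lambda>j. \<gamma> j + \<delta> j) x)" if "(\<gamma>, \<delta>) \<in> exponents J D \<times> exponents J E" for \<gamma> \<delta>
    using that by (intro degree_bounded_monomial J) (auto intro!: add_mono dest!: PiE_mem)
  ultimately show ?thesis
    by (simp add: case_prod_beta) (rule degree_bounded_sum, auto)
qed

lemma degree_bounded_mono:
  assumes "finite J" "degree_bounded J D f" "D \<le> E"
  shows "degree_bounded J E f"
  using degree_bounded_mult[OF assms(1,2) degree_bounded_const[OF assms(1)], of "E - D" 1] assms(3)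
  by simp

lemma degree_bounded_prod_power:
  assumes "finite J" "\<And>k. k \<in> K \<Longrightarrow> degree_bounded J D (F k)" "finite K" "\<And>k. k \<in> K \<Longrightarrow> \<beta> k \<le> E"
  shows "degree_bounded J (card K * (E * D)) (\<lambda>x. \<Prod>k\<in>K. F k x ^ \<beta> k)"
  using assms(3,2,4)
proof (induction K)
  case (insert k K)
  have "degree_bounded J (n * D) (\<lambda>x. F k x ^ n)" for n
  proof (induction n)
    case (Suc n)
    show ?case
      using degree_bounded_mult[OF assms(1) insert.prems(1) Suc, of k] by (simp add: add.commute)
  qed (simp add: degree_bounded_const assms(1))
  then have "degree_bounded J (E * D) (\<lambda>x. F k x ^ \<beta> k)"
    by (rule degree_bounded_mono[OF assms(1)]) (simp add: insert.prems)
  then show ?case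
    using degree_bounded_mult[OF assms(1) _ insert.IH] insert by (simp add: add.commute)
qed (simp add: degree_bounded_const assms(1))

lemma polyfun_degree_bounded:
  assumes "finite J" "polyfun J f"
  shows "\<exists>D. degree_bounded J D f"
  using assms(2)
proof (induction rule: polyfun.induct)
  case (const c)
  then show ?case using degree_bounded_const[OF assms(1)] by blast
next
  case (var i)
  let ?\<gamma> = "\<lambda>j. if j = i then 1 else 0"
  have "monomial J ?\<gamma> x = x i" for x :: "'a \<Rightarrow> 'b"
    unfolding monomial_def using assms(1) var by (simp add: if_distrib prod.delta cong: if_cong)
  moreover have "degree_bounded J 1 (\<lambda>x :: 'a \<Rightarrow> 'b. 1 * monomial J ?\<gamma> x)"
    by (rule degree_bounded_monomial[OF assms(1)]) simp
  ultimately show ?case by auto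
next
  case (add f g)
  then obtain D E where "degree_bounded J D f" "degree_bounded J E g" by blast
  then have "degree_bounded J (max D E) f" "degree_bounded J (max D E) g"
    by (auto intro: degree_bounded_mono[OF assms(1)])
  then show ?case using degree_bounded_add by blast
next
  case (mult f g)
  then show ?case using degree_bounded_mult[OF assms(1)] by blast
qed

lemma monomials_independent:
  fixes c :: "('k \<Rightarrow> nat) \<Rightarrow> 'a::field_char_0"
  assumes "finite K" "\<And>x. (\<Sum>\<beta>\<in>exponents K E. c \<beta> * monomial K \<beta> x) = 0"
  shows "\<forall>\<beta>\<in>exponents K E. c \<beta> = 0"
  using assms
proof (induction K arbitrary: c)
  case empty
  then show ?case by (simp add: monomial_def)
next
  case (insert k K)
  have inj: "inj_on (\<lambda>(n, \<beta>). \<beta>(k := n)) ({..E} \<times> exponents K E)"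
    using insert.hyps inj_combinator[of k K "\<lambda>_. {..E}"] by simp
  have sum: "(\<Sum>n\<le>E. (\<Sum>\<beta>\<in>exponents K E. c (\<beta>(k := n)) * monomial K \<beta> x) * t ^ n) = 0" for x t
  proof -
    have m: "monomial (insert k K) (\<beta>(k := n)) (x(k := t)) = monomial K \<beta> x * t ^ n" for \<beta> n
    proof -
      have "(\<Prod>j\<in>K. (x(k := t)) j ^ (\<beta>(k := n)) j) = (\<Prod>j\<in>K. x j ^ \<beta> j)"
        using insert.hyps by (intro prod.cong) auto
      then show ?thesis using insert.hyps by (simp add: monomial_def mult.commute)
    qed
    have "0 = (\<Sum>\<beta>\<in>exponents (insert k K) E. c \<beta> * monomial (insert k K) \<beta> (x(k := t)))"
      using insert.prems by simp
    also have "\<dots> = (\<Sum>(n, \<beta>)\<in>{..E} \<times> exponents K E.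
        c (\<beta>(k := n)) * monomial (insert k K) (\<beta>(k := n)) (x(k := t)))"
      unfolding PiE_insert_eq sum.reindex[OF inj] by (rule sum.cong) auto
    also have "\<dots> = (\<Sum>n\<le>E. (\<Sum>\<beta>\<in>exponents K E. c (\<beta>(k := n)) * monomial K \<beta> x) * t ^ n)"
      unfolding m by (simp add: sum.cartesian_product[symmetric] sum_distrib_right mult.assoc)
    finally show ?thesis by simp
  qed
  have "(\<Sum>\<beta>\<in>exponents K E. c (\<beta>(k := n)) * monomial K \<beta> x) = 0" if "n \<le> E" for n x
  proof -
    let ?a = "\<lambda>n. \<Sum>\<beta>\<in>exponents K E. c (\<beta>(k := n)) * monomial K \<beta> x"
    let ?p = "\<Sum>n\<le>E. monom (?a n) n"
    have "poly ?p t = 0" for t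
      using sum[where x = x and t = t] by (simp add: poly_sum poly_monom)
    then have "?p = 0" using poly_all_0_iff_0 by blast
    then have "coeff ?p n = 0" by simp
    then show ?thesis using that by (simp add: coeff_sum)
  qed
  then have "\<forall>\<beta>\<in>exponents K E. c (\<beta>(k := n)) = 0" if "n \<le> E" for n
    using that insert.IH[of "\<lambda>\<beta>. c (\<beta>(k := n))"] by blast
  then show ?case unfolding PiE_insert_eq by auto
qed

text \<open>There are more products of \<open>F k\<close> of bounded degree than monomials that they can involve.\<close>

theorem algebraic_dependence:
  fixes F :: "'k \<Rightarrow> ('j \<Rightarrow> 'a::field_char_0) \<Rightarrow> 'a"
  assumes J: "finite J" and K: "finite K" and card: "card J < card K"
    and F: "\<And>k. k \<in> K \<Longrightarrow> polyfun J (F k)"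
  obtains Q where "polyfun K Q" "\<exists>y. Q y \<noteq> 0" "\<And>x. Q (\<lambda>k. F k x) = 0"
proof -
  have "\<forall>k\<in>K. \<exists>D. degree_bounded J D (F k)" using F polyfun_degree_bounded[OF J] by blast
  from bchoice[OF this] obtain d where d: "\<And>k. k \<in> K \<Longrightarrow> degree_bounded J (d k) (F k)" by blast
  define D where "D = (\<Sum>k\<in>K. d k)"
  have D: "degree_bounded J D (F k)" if "k \<in> K" for k
    using that K by (intro degree_bounded_mono[OF J d]) (auto simp: D_def intro: member_le_sum)
  \<comment> \<open>The degrees in the products are at most \<open>?N\<close>, and
    \<open>?N + 1\<close> is at most C(E + 1). With j = \<open>card J\<close> there are thus at most
    C^j (E + 1)^j monomials, against (E + 1)^(j + 1) or more products; the choice E = C^j makes the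
    latter larger.\<close>
  define C where "C = card K * D + 1"
  define E where "E = C ^ card J"
  let ?N = "card K * (E * D)"
  have "\<forall>\<beta>\<in>exponents K E. \<exists>a. \<forall>x. (\<Prod>k\<in>K. F k x ^ \<beta> k) = (\<Sum>\<gamma>\<in>exponents J ?N. a \<gamma> * monomial J \<gamma> x)"
  proof
    fix \<beta> assume "\<beta> \<in> exponents K E"
    then have "degree_bounded J ?N (\<lambda>x. \<Prod>k\<in>K. F k x ^ \<beta> k)"
      using degree_bounded_prod_power[where E = E and F = F and \<beta> = \<beta>, OF J D K] by (auto dest: PiE_mem)
    then show "\<exists>a. \<forall>x. (\<Prod>k\<in>K. F k x ^ \<beta> k) = (\<Sum>\<gamma>\<in>exponents J ?N. a \<gamma> * monomial J \<gamma> x)"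
      unfolding degree_bounded_def .
  qed
  from bchoice[OF this] obtain a where a: "\<And>\<beta> x. \<beta> \<in> exponents K E \<Longrightarrow>
    (\<Prod>k\<in>K. F k x ^ \<beta> k) = (\<Sum>\<gamma>\<in>exponents J ?N. a \<beta> \<gamma> * monomial J \<gamma> x)" by blast
  have "card (exponents J ?N) = (?N + 1) ^ card J" using J by (simp add: card_PiE)
  also have "\<dots> \<le> (C * (E + 1)) ^ card J"
    by (intro power_mono) (auto simp: C_def algebra_simps)
  also have "\<dots> = E * (E + 1) ^ card J" by (simp only: power_mult_distrib E_def)
  also have "\<dots> < (E + 1) * (E + 1) ^ card J" by simp
  also have "\<dots> = (E + 1) ^ Suc (card J)" by simp
  also have "\<dots> \<le> (E + 1) ^ card K" using card by (intro power_increasing) auto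
  also have "\<dots> = card (exponents K E)" using K by (simp add: card_PiE)
  finally have "card (exponents J ?N) < card (exponents K E)" .
  from homogeneous_system_solution[OF _ _ this, of a] obtain c where
    c: "\<exists>\<beta>\<in>exponents K E. c \<beta> \<noteq> 0"
      "\<And>\<gamma>. \<gamma> \<in> exponents J ?N \<Longrightarrow> (\<Sum>\<beta>\<in>exponents K E. c \<beta> * a \<beta> \<gamma>) = 0"
    using J K by (auto simp: finite_PiE)
  let ?Q = "\<lambda>y. \<Sum>\<beta>\<in>exponents K E. c \<beta> * monomial K \<beta> y"
  have "polyfun K ?Q" by (intro polyfun_intros polyfun_monomial)
  moreover have "\<exists>y. ?Q y \<noteq> 0" using monomials_independent[OF K, of c E] c(1) by blast
  moreover have "?Q (\<lambda>k. F k x) = 0" for x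
  proof -
    have "?Q (\<lambda>k. F k x) = (\<Sum>\<beta>\<in>exponents K E. c \<beta> * (\<Sum>\<gamma>\<in>exponents J ?N. a \<beta> \<gamma> * monomial J \<gamma> x))"
      by (rule sum.cong) (simp_all add: monomial_def a)
    also have "\<dots> = (\<Sum>\<gamma>\<in>exponents J ?N. \<Sum>\<beta>\<in>exponents K E. c \<beta> * a \<beta> \<gamma> * monomial J \<gamma> x)"
      unfolding sum_distrib_left by (subst sum.swap) (simp add: mult.assoc)
    also have "\<dots> = 0" using c(2) by (simp add: sum_distrib_right[symmetric])
    finally show ?thesis .
  qed
  ultimately show ?thesis using that by blast
qed

section \<open>Dominant maps between affine spaces of equal dimension\<close>

lemma polyfam_cong:
  assumes "polyfam V n p" "\<And>i. i \<in> V \<Longrightarrow> e i = e' i"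
  shows "p e = p e'"
proof (rule poly_eqI)
  fix k show "coeff (p e) k = coeff (p e') k"
    by (rule polyfun_cong[OF polyfam_coeff[OF assms(1)] assms(2)])
qed

lemma polyfam_0_eq_0: "polyfam V 0 p \<Longrightarrow> p e = 0"
  by (simp add: polyfam_def poly_eq_iff)

lemma polyfam_drop_lead:
  assumes p: "polyfam V (Suc n) p" and "\<And>e. coeff (p e) n = 0"
  shows "polyfam V n p"
  using assms unfolding polyfam_def by (metis Suc_leI le_neq_implies_less)

lemma polyfam_subst:
  assumes "polyfam V n p" "\<And>i. i \<in> V \<Longrightarrow> polyfun W (g i)"
  shows "polyfam W n (\<lambda>e. p (\<lambda>i. g i e))"
  using assms unfolding polyfam_def by (auto intro: polyfun_subst)

text \<open>Dominance is expressed through functions: no nonzero polynomial on the target vanishes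
  on the image. Together with the inequality of dimensions it makes the general fibre finite and
  nonempty.\<close>

locale dominant_map =
  fixes K :: "'k set" and J :: "'j set"
    and \<Phi> :: "('j \<Rightarrow> 'a::{alg_closed_field, field_char_0}) \<Rightarrow> 'k \<Rightarrow> 'a"
  assumes fin: "finite K" "finite J" and card: "card J \<le> card K"
    and \<Phi>: "\<And>k. k \<in> K \<Longrightarrow> polyfun J (\<lambda>q. \<Phi> q k)"
    and dominant: "\<And>Q T. polyfun K Q \<Longrightarrow> (\<And>q. Q (\<Phi> q) = 0) \<Longrightarrow> Q T = 0"
begin

lemma polyfun_comp: "polyfun K A \<Longrightarrow> polyfun J (\<lambda>q. A (\<Phi> q))"
  using polyfun_subst[of K A J "\<lambda>k q. \<Phi> q k"] \<Phi> by simp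

lemma polyfun_rel: "polyfam K n R \<Longrightarrow> polyfun J s \<Longrightarrow> polyfun J (\<lambda>q. poly (R (\<Phi> q)) (s q))"
  using polyfun_polyfam_poly[of K n R J "\<lambda>k q. \<Phi> q k" s] \<Phi> by simp

text \<open>\<open>s\<close> and the coordinates of the map are more functions than there are
  variables, hence dependent. The index \<open>None\<close> stands for \<open>s\<close>, and the
  dependence is read as a polynomial in the value of \<open>s\<close>.\<close>

lemma ex_relation:
  assumes s: "polyfun J s"
  shows "\<exists>n R. polyfam K n R \<and> (\<exists>T. R T \<noteq> 0) \<and> (\<forall>q. poly (R (\<Phi> q)) (s q) = 0)"
proof -
  let ?F = "\<lambda>z q. case z of None \<Rightarrow> s q | Some k \<Rightarrow> \<Phi> q k"
  let ?K = "insert None (Some ` K)"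
  have c: "card J < card ?K" using fin card by (simp add: card_image)
  obtain Q where Q: "polyfun ?K Q" "\<exists>y. Q y \<noteq> 0" "\<And>x. Q (\<lambda>k. ?F k x) = 0"
    by (rule algebraic_dependence[of J ?K ?F]) (use fin c s \<Phi> in auto)
  obtain n p where p: "polyfam (?K - {None}) n p" "\<And>e x. Q (e(None := x)) = poly (p e) x"
    using polyfun_imp_polyfam[OF Q(1), of None] by metis
  define R where "R T = p (\<lambda>z. case z of None \<Rightarrow> 0 | Some k \<Rightarrow> T k)" for T
  have "polyfam K n R" unfolding R_def
    by (rule polyfam_subst[OF p(1), where g = "\<lambda>i T. case i of None \<Rightarrow> 0 | Some k \<Rightarrow> T k"])
      (auto intro: polyfun.intros)
  moreover have eq: "poly (R T) u = Q (case_option u T)" for T u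
  proof -
    have "poly (R T) u = Q ((case_option 0 T)(None := u))" unfolding R_def p(2) ..
    also have "(case_option 0 T)(None := u) = case_option u T" by (auto split: option.splits)
    finally show ?thesis .
  qed
  moreover have "poly (R (\<Phi> q)) (s q) = 0" for q
    using Q(3)[of q] unfolding eq .
  moreover have "\<exists>T. R T \<noteq> 0"
  proof -
    obtain y where "Q y \<noteq> 0" using Q(2) by blast
    moreover have "case_option (y None) (y \<circ> Some) = y" by (auto split: option.splits)
    ultimately have "poly (R (y \<circ> Some)) (y None) \<noteq> 0" unfolding eq by simp
    then show ?thesis by (metis poly_0)
  qed
  ultimately show ?thesis by blast
qed

text \<open>A multiple, free of denominators, of the minimal polynomial of \<open>s\<close> over the
  function field of the target. Minimality of the formal degree takes the place of irreducibility: a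
  relation of smaller degree is zero.\<close>

lemma minimal_relation:
  assumes s: "polyfun J s"
  obtains n R where "polyfam K (Suc n) R" "\<exists>T. coeff (R T) n \<noteq> 0"
    "\<And>q. poly (R (\<Phi> q)) (s q) = 0"
    "\<And>p T. polyfam K n p \<Longrightarrow> (\<And>q. poly (p (\<Phi> q)) (s q) = 0) \<Longrightarrow> p T = 0"
proof -
  let ?P = "\<lambda>n. \<exists>R. polyfam K n R \<and> (\<exists>T. R T \<noteq> 0) \<and> (\<forall>q. poly (R (\<Phi> q)) (s q) = 0)"
  define m where "m = (LEAST n. ?P n)"
  have "?P m" unfolding m_def by (rule LeastI_ex) (rule ex_relation[OF s])
  then obtain R where R: "polyfam K m R" "\<exists>T. R T \<noteq> 0" "\<And>q. poly (R (\<Phi> q)) (s q) = 0" by blast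
  have min: "\<not> ?P n" if "n < m" for n using that not_less_Least unfolding m_def by blast
  have "m \<noteq> 0" using R(1,2) polyfam_0_eq_0 by metis
  then obtain n where n: "m = Suc n" by (cases m) auto
  have "\<exists>T. coeff (R T) n \<noteq> 0"
  proof (rule ccontr)
    assume "\<nexists>T. coeff (R T) n \<noteq> 0"
    then have "coeff (R T) n = 0" for T by blast
    from polyfam_drop_lead[OF R(1)[unfolded n] this] have "polyfam K n R" .
    with R(2,3) have "?P n" by blast
    then show False using min[of n] n by simp
  qed
  then show ?thesis
  proof (rule that[OF R(1)[unfolded n] _ R(3)])
    fix p T assume "polyfam K n p" "\<And>q. poly (p (\<Phi> q)) (s q) = 0"
    then show "p T = 0" using min[of n] n by auto
  qed
qed

text \<open>The constant coefficient of the minimal relation acts as a norm of \<open>f\<close>: it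
  vanishes wherever \<open>f\<close> does. It is not identically zero, since otherwise the relation
  could be divided by its variable.\<close>

lemma hypersurface_image:
  assumes f: "polyfun J f" and nz: "\<exists>q. f q \<noteq> 0"
  obtains Q where "polyfun K Q" "\<exists>T. Q T \<noteq> 0" "\<And>q. Q (\<Phi> q) \<noteq> 0 \<Longrightarrow> f q \<noteq> 0"
proof -
  obtain n R where R: "polyfam K (Suc n) R" "\<exists>T. coeff (R T) n \<noteq> 0"
    "\<And>q. poly (R (\<Phi> q)) (f q) = 0"
    and min: "\<And>p T. polyfam K n p \<Longrightarrow> (\<And>q. poly (p (\<Phi> q)) (f q) = 0) \<Longrightarrow> p T = 0"
    by (rule minimal_relation[OF f]) blast
  have "\<exists>T. coeff (R T) 0 \<noteq> 0"
  proof (rule ccontr)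
    assume 0: "\<nexists>T. coeff (R T) 0 \<noteq> 0"
    let ?p = "\<lambda>T. poly_shift 1 (R T)"
    have p: "polyfam K n ?p"
      using R(1) by (auto simp: polyfam_def coeff_poly_shift)
    have Rp: "R T = [:0, 1:] * ?p T" for T
      using 0 by (auto simp: poly_eq_iff coeff_poly_shift coeff_pCons split: nat.splits)
    have "f q * poly (?p (\<Phi> q)) (f q) = 0" for q
      using R(3)[of q] by (subst (asm) Rp) simp
    then have "\<forall>q. poly (?p (\<Phi> q)) (f q) = 0"
      using polyfun_mult_eq_0[OF f polyfun_rel[OF p f]] nz by blast
    then have "?p T = 0" for T using min[OF p] by blast
    then have "R T = 0" for T by (subst Rp) simp
    then show False using R(2) by simp
  qed
  moreover have "f q \<noteq> 0" if "coeff (R (\<Phi> q)) 0 \<noteq> 0" for q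
    using that R(3)[of q] by (auto simp: poly_0_coeff_0)
  ultimately show ?thesis using that[of "\<lambda>T. coeff (R T) 0"] polyfam_coeff[OF R(1)] by blast
qed

text \<open>Every coordinate of a point in the fibre is a root of a polynomial that depends only on
  the point below, and which is generically nonzero. Restricting to \<open>extensional J\<close>
  fixes the irrelevant values of \<open>q\<close>, without which no fibre could be finite.\<close>

lemma generic_fibre_finite:
  obtains Q B where "polyfun K Q" "\<exists>T. Q T \<noteq> 0"
    "\<And>T. Q T \<noteq> 0 \<Longrightarrow> finite {q \<in> extensional J. \<forall>k\<in>K. \<Phi> q k = T k} \<and>
      card {q \<in> extensional J. \<forall>k\<in>K. \<Phi> q k = T k} \<le> B"
proof -
  have "\<forall>j\<in>J. \<exists>z. polyfam K (fst z) (snd z) \<and> (\<exists>T. snd z T \<noteq> 0) \<and>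
      (\<forall>q. poly (snd z (\<Phi> q)) (q j) = 0)"
    using ex_relation polyfun.var[of _ J] by fastforce
  from bchoice[OF this] obtain z where z: "\<And>j. j \<in> J \<Longrightarrow> polyfam K (fst (z j)) (snd (z j))"
    "\<And>j. j \<in> J \<Longrightarrow> \<exists>T. snd (z j) T \<noteq> 0"
    "\<And>j q. j \<in> J \<Longrightarrow> poly (snd (z j) (\<Phi> q)) (q j) = 0" by blast
  have "\<forall>j\<in>J. \<exists>i. \<exists>T. coeff (snd (z j) T) i \<noteq> 0"
    using z(2) by (metis leading_coeff_0_iff)
  from bchoice[OF this] obtain i where i: "\<And>j. j \<in> J \<Longrightarrow> \<exists>T. coeff (snd (z j) T) (i j) \<noteq> 0" by blast
  define Q where "Q T = (\<Prod>j\<in>J. coeff (snd (z j) T) (i j))" for T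
  have "polyfun K Q" unfolding Q_def[abs_def] by (rule polyfun_prod) (rule polyfam_coeff[OF z(1)])
  moreover have "\<exists>T. Q T \<noteq> 0" unfolding Q_def
    by (rule polyfun_nonzero_prod[where V = K], rule fin(2), erule polyfam_coeff[OF z(1)], erule i)
  moreover have "finite {q \<in> extensional J. \<forall>k\<in>K. \<Phi> q k = T k} \<and>
      card {q \<in> extensional J. \<forall>k\<in>K. \<Phi> q k = T k} \<le> (\<Prod>j\<in>J. fst (z j))" if "Q T \<noteq> 0" for T
  proof -
    let ?R = "\<lambda>j. snd (z j) T"
    let ?X = "PiE J (\<lambda>j. {u. poly (?R j) u = 0})"
    have nz: "?R j \<noteq> 0" if "j \<in> J" for j
      using \<open>Q T \<noteq> 0\<close> that fin by (auto simp: Q_def)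
    have "finite ?X" using nz fin by (intro finite_PiE) (auto intro: poly_roots_finite)
    moreover have "{q \<in> extensional J. \<forall>k\<in>K. \<Phi> q k = T k} \<subseteq> ?X"
    proof (rule subsetI)
      fix q assume q: "q \<in> {q \<in> extensional J. \<forall>k\<in>K. \<Phi> q k = T k}"
      have "poly (?R j) (q j) = 0" if "j \<in> J" for j
        using z(3)[OF that, of q] polyfam_cong[OF z(1)[OF that], of "\<Phi> q" T] q by simp
      then show "q \<in> ?X" using q by (simp add: PiE_def Pi_def)
    qed
    moreover have "card ?X \<le> (\<Prod>j\<in>J. fst (z j))"
    proof -
      have "card {u. poly (?R j) u = 0} \<le> fst (z j)" if "j \<in> J" for j
      proof -
        have "card {u. poly (?R j) u = 0} \<le> degree (?R j)"
          using nz[OF that] by (rule card_poly_roots_bound)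
        also have "\<dots> \<le> fst (z j)"
          using polyfam_coeff_0[OF z(1)[OF that]] by (intro degree_le) auto
        finally show ?thesis .
      qed
      then show ?thesis using fin by (simp add: card_PiE) (rule prod_mono, auto)
    qed
    ultimately show ?thesis by (meson card_mono finite_subset le_trans)
  qed
  ultimately show ?thesis using that by blast
qed

text \<open>The image is definable, so a general point is either always in it or never. In the
  second case a nonzero polynomial would vanish on the image, against dominance.\<close>

lemma generic_in_image:
  obtains Q where "polyfun K Q" "\<exists>T. Q T \<noteq> 0" "\<And>T. Q T \<noteq> 0 \<Longrightarrow> \<exists>q. \<forall>k\<in>K. \<Phi> q k = T k"
proof -
  let ?P = "\<lambda>T. \<exists>q. \<forall>k\<in>K. \<Phi> q k = T k"
  have "definable K (\<lambda>T. \<exists>q. (\<lambda>e. \<forall>k\<in>K. \<Phi> (e \<circ> Inr) k = e (Inl k)) (case_sum T q))"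
  proof (rule definable_ex[OF fin(2)], intro definable_ball fin definable_eq)
    fix k assume "k \<in> K"
    then show "polyfun (Inl ` K \<union> Inr ` J) (\<lambda>e. \<Phi> (e \<circ> Inr) k)"
      using polyfun_subst[OF \<Phi>, of k "Inl ` K \<union> Inr ` J" "\<lambda>j e. e (Inr j)"]
      by (simp add: comp_def polyfun.var)
  qed (auto intro: polyfun.var)
  then have "definable K ?P" by (simp add: comp_def)
  then obtain Q where Q: "polyfun K Q" "\<exists>T. Q T \<noteq> 0"
    "(\<forall>T. Q T \<noteq> 0 \<longrightarrow> ?P T) \<or> (\<forall>T. Q T \<noteq> 0 \<longrightarrow> \<not> ?P T)" by (rule definable_generic)
  have "Q (\<Phi> q) = 0" if "\<forall>T. Q T \<noteq> 0 \<longrightarrow> \<not> ?P T" for q using that by blast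
  then show ?thesis using Q dominant that by blast
qed

text \<open>If \<open>s\<close> is not a rational function on the target then its minimal polynomial has degree at
  least two, and over a general point every root of the minimal polynomial is a value of \<open>s\<close>.\<close>

theorem generic_two_values:
  assumes s: "polyfun J s"
    and nonrational: "\<And>A B T. polyfun K A \<Longrightarrow> polyfun K B \<Longrightarrow>
      (\<And>q. A (\<Phi> q) * s q = B (\<Phi> q)) \<Longrightarrow> A T = 0"
  obtains Q where "polyfun K Q" "\<exists>T. Q T \<noteq> 0" "\<And>T. Q T \<noteq> 0 \<Longrightarrow>
    \<exists>q q'. (\<forall>k\<in>K. \<Phi> q k = T k) \<and> (\<forall>k\<in>K. \<Phi> q' k = T k) \<and> s q \<noteq> s q'"
proof -
  obtain n R where R: "polyfam K (Suc n) R" "\<exists>T. coeff (R T) n \<noteq> 0"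
    "\<And>q. poly (R (\<Phi> q)) (s q) = 0"
    and min: "\<And>p T. polyfam K n p \<Longrightarrow> (\<And>q. poly (p (\<Phi> q)) (s q) = 0) \<Longrightarrow> p T = 0"
    by (rule minimal_relation[OF s]) blast
  define c where "c T = coeff (R T) n" for T
  have c: "polyfun K c" unfolding c_def[abs_def] by (rule polyfam_coeff[OF R(1)])
  have c_nz: "\<exists>T. c T \<noteq> 0" using R(2) by (simp add: c_def)
  \<comment> \<open>Degree 0 would give a polynomial of the target that vanishes on the image,
    degree 1 would write \<open>s\<close> as a quotient of two functions of the target.\<close>
  have "n \<noteq> 0"
  proof
    assume "n = 0"
    then have "R T = [:c T:]" for T
      using polyfam_coeff_0[OF R(1)] by (auto simp: poly_eq_iff c_def coeff_pCons split: nat.splits)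
    then have "c (\<Phi> q) = 0" for q using R(3)[of q] by simp
    then show False using dominant[OF c] c_nz by blast
  qed
  moreover have "n \<noteq> 1"
  proof
    assume n: "n = 1"
    have "poly (R T) u = coeff (R T) 0 + c T * u" for T u
      unfolding polyfam_poly[OF R(1)] by (simp add: n c_def lessThan_Suc)
    then have "c (\<Phi> q) * s q = - coeff (R (\<Phi> q)) 0" for q
      using R(3)[of q] by (simp add: add_eq_0_iff add.commute)
    then show False
      using nonrational[OF c polyfun_uminus[OF polyfam_coeff[OF R(1)]]] c_nz by blast
  qed
  ultimately have n: "2 \<le> n" by linarith
  \<comment> \<open>Over a general point, a polynomial \<open>a\<close> vanishes at all roots of
    \<open>R\<close> or at none of them; which case holds is decided by the generic value of
    \<open>s\<close>.\<close>
  have roots: "\<exists>g. polyfun K g \<and> (\<exists>T. g T \<noteq> 0) \<and>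
      ((\<forall>T u. g T \<noteq> 0 \<longrightarrow> poly (R T) u = 0 \<longrightarrow> poly (a T) u = 0) \<and> (\<forall>q. poly (a (\<Phi> q)) (s q) = 0) \<or>
       (\<forall>T u. g T \<noteq> 0 \<longrightarrow> poly (R T) u = 0 \<longrightarrow> poly (a T) u \<noteq> 0))" if a: "polyfam K m a" for m a
  proof (cases "\<forall>q. poly (a (\<Phi> q)) (s q) = 0")
    case True
    obtain N x r where r: "polyfam K n r"
      and eq: "\<And>T. smult (c T ^ N) (a T) = x T * R T + r T"
      using polyfam_pseudo_divmod[OF R(1) a] unfolding c_def by blast
    have eqp: "c T ^ N * poly (a T) u = poly (x T) u * poly (R T) u + poly (r T) u" for T u
      using arg_cong[OF eq[of T], of "\<lambda>p. poly p u"] by simp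
    have "poly (r (\<Phi> q)) (s q) = 0" for q
      using eqp[of "\<Phi> q" "s q"] True R(3) by simp
    then have "r T = 0" for T using min[OF r] by blast
    then have "poly (a T) u = 0" if "c T \<noteq> 0" "poly (R T) u = 0" for T u
      using eqp[of T u] that by simp
    then show ?thesis using c c_nz True by blast
  next
    case False
    \<comment> \<open>The ideal generated by \<open>a\<close> and \<open>R\<close>. A nonzero
      element \<open>p\<close> of least formal degree is their greatest common divisor up to factors
      from the target.\<close>
    define I where "I p \<longleftrightarrow> (\<exists>k x l y. polyfam K k x \<and> polyfam K l y \<and>
      (\<forall>T. p T = x T * a T + y T * R T))" for p
    let ?P = "\<lambda>d. \<exists>p. polyfam K d p \<and> (\<exists>T. p T \<noteq> 0) \<and> I p"
    define m where "m = (LEAST d. ?P d)"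
    have one: "polyfam K 1 (\<lambda>_. 1)" using polyfam_const[OF polyfun.const[of K 1]] by (simp add: one_pCons)
    have "I R" unfolding I_def
      by (rule exI[of _ 0], rule exI[of _ "\<lambda>_. 0"], rule exI[of _ 1], rule exI[of _ "\<lambda>_. 1"])
        (simp add: polyfam_0 one[simplified])
    have "I a" unfolding I_def
      by (rule exI[of _ 1], rule exI[of _ "\<lambda>_. 1"], rule exI[of _ 0], rule exI[of _ "\<lambda>_. 0"])
        (simp add: polyfam_0 one[simplified])
    have "?P (Suc n)" using R(1,2) \<open>I R\<close> by (metis coeff_0)
    then have "?P m" unfolding m_def by (rule LeastI)
    then obtain p where p: "polyfam K m p" "\<exists>T. p T \<noteq> 0" "I p" by blast
    have minI: "\<not> ?P d" if "d < m" for d using that not_less_Least unfolding m_def by blast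
    have "m \<noteq> 0" using p(1,2) polyfam_0_eq_0 by metis
    then obtain d where d: "m = Suc d" by (cases m) auto
    define b where "b T = coeff (p T) d" for T
    have b: "polyfun K b" unfolding b_def[abs_def] by (rule polyfam_coeff[OF p(1)])
    have b_nz: "\<exists>T. b T \<noteq> 0"
    proof (rule ccontr)
      assume "\<nexists>T. b T \<noteq> 0"
      then have "coeff (p T) d = 0" for T unfolding b_def by blast
      from polyfam_drop_lead[OF p(1)[unfolded d] this] have "polyfam K d p" .
      with p(2,3) have "?P d" by blast
      then show False using minI[of d] d by simp
    qed
    \<comment> \<open>The remainder of an element of the ideal is again in it and has smaller
      degree, so it is zero and \<open>p\<close> divides up to a power of its leading
      coefficient.\<close>
    have divide: "\<exists>N x. polyfam K (l - d) x \<and> (\<forall>T. smult (b T ^ N) (f T) = x T * p T)"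
      if f: "polyfam K l f" "I f" for l f
    proof -
      obtain N x r where x: "polyfam K (l - d) x" and r: "polyfam K d r"
        and eq: "\<And>T. smult (b T ^ N) (f T) = x T * p T + r T"
        using polyfam_pseudo_divmod[OF p(1)[unfolded d] f(1)] unfolding b_def by blast
      obtain k1 x1 l1 y1 where f1: "polyfam K k1 x1" "polyfam K l1 y1"
        "\<And>T. f T = x1 T * a T + y1 T * R T" using f(2) unfolding I_def by blast
      obtain k2 x2 l2 y2 where p2: "polyfam K k2 x2" "polyfam K l2 y2"
        "\<And>T. p T = x2 T * a T + y2 T * R T" using p(3) unfolding I_def by blast
      have "r T = (smult (b T ^ N) (x1 T) - x T * x2 T) * a T +
          (smult (b T ^ N) (y1 T) - x T * y2 T) * R T" for T
        using eq[of T] unfolding f1(3) p2(3) by (simp add: algebra_simps smult_add_right)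
      then have "I r" unfolding I_def
        using polyfam_diff[OF polyfam_smult[OF polyfun_power[OF b] f1(1)] polyfam_mult[OF x p2(1)]]
          polyfam_diff[OF polyfam_smult[OF polyfun_power[OF b] f1(2)] polyfam_mult[OF x p2(2)]]
        by blast
      then have "r T = 0" for T using minI[of d] r d by blast
      then show ?thesis using x eq by auto
    qed
    obtain N x where xa: "\<And>T. smult (b T ^ N) (a T) = x T * p T"
      using divide[OF a \<open>I a\<close>] by blast
    obtain M y where y: "polyfam K (Suc n - d) y" and yR: "\<And>T. smult (b T ^ M) (R T) = y T * p T"
      using divide[OF R(1) \<open>I R\<close>] by blast
    \<comment> \<open>One of the two factors of \<open>R\<close> vanishes at \<open>s\<close>. It
      cannot be \<open>p\<close>, because then \<open>a\<close> would vanish there as well.\<close>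
    have "poly (y (\<Phi> q)) (s q) * poly (p (\<Phi> q)) (s q) = 0" for q
      using arg_cong[OF yR[of "\<Phi> q"], of "\<lambda>p. poly p (s q)"] R(3)[of q] by simp
    then consider "\<forall>q. poly (y (\<Phi> q)) (s q) = 0" | "\<forall>q. poly (p (\<Phi> q)) (s q) = 0"
      using polyfun_mult_eq_0[OF polyfun_rel[OF y s] polyfun_rel[OF p(1) s]] by blast
    then have y0: "\<forall>q. poly (y (\<Phi> q)) (s q) = 0"
    proof cases
      case 2
      then have "b (\<Phi> q) ^ N * poly (a (\<Phi> q)) (s q) = 0" for q
        using arg_cong[OF xa[of "\<Phi> q"], of "\<lambda>p. poly p (s q)"] by simp
      then have "\<forall>q. b (\<Phi> q) ^ N = 0"
        using polyfun_mult_eq_0[OF polyfun_comp[OF polyfun_power[OF b]] polyfun_rel[OF a s]] False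
        by blast
      then have "b T ^ N = 0" for T using dominant[OF polyfun_power[OF b, of N]] by blast
      then show ?thesis using b_nz by simp
    qed
    \<comment> \<open>Otherwise the cofactor \<open>y\<close> would be a relation of smaller degree
      than \<open>R\<close>, hence zero. So \<open>p\<close> is free of the variable, and the
      identity that puts it into the ideal shows that \<open>a\<close> and \<open>R\<close> have no
      common root where \<open>b\<close> is nonzero.\<close>
    have "d = 0"
    proof (rule ccontr)
      assume "d \<noteq> 0"
      then have "polyfam K n y" by (intro polyfam_mono[OF y]) simp
      then have "y T = 0" for T using min y0 by blast
      then have "b T ^ M * c T = 0" for T
        using arg_cong[OF yR[of T], of "\<lambda>p. coeff p n"] by (simp add: c_def)
      then show False
        using polyfun_mult_eq_0[OF polyfun_power[OF b] c] b_nz c_nz by (metis power_not_zero)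
    qed
    then have pb: "p T = [:b T:]" for T
      using polyfam_coeff_0[OF p(1)] d by (auto simp: poly_eq_iff b_def coeff_pCons split: nat.splits)
    obtain k2 x2 l2 y2 where p2: "\<And>T. p T = x2 T * a T + y2 T * R T"
      using p(3) unfolding I_def by blast
    have "poly (a T) u \<noteq> 0" if "b T \<noteq> 0" "poly (R T) u = 0" for T u
    proof -
      have "b T = poly (x2 T) u * poly (a T) u + poly (y2 T) u * poly (R T) u"
        using arg_cong[OF p2[of T], of "\<lambda>p. poly p u"] by (simp add: pb)
      then show ?thesis using that by auto
    qed
    then show ?thesis using b b_nz by blast
  qed
  \<comment> \<open>The pairs of a point of the target and a value of \<open>s\<close> attained
    above it form a definable set; the index \<open>None\<close> holds the value.\<close>
  let ?K = "insert None (Some ` K)"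
  let ?P = "\<lambda>e. \<exists>q. (\<forall>k\<in>K. \<Phi> q k = e (Some k)) \<and> s q = e None"
  have "definable ?K (\<lambda>E. \<exists>q. (\<lambda>e. (\<forall>k\<in>K. \<Phi> (e \<circ> Inr) k = e (Inl (Some k))) \<and> s (e \<circ> Inr) = e (Inl None))
      (case_sum E q))"
  proof (rule definable_ex[OF fin(2)], intro definable_conj definable_ball fin definable_eq)
    fix k assume "k \<in> K"
    then show "polyfun (Inl ` ?K \<union> Inr ` J) (\<lambda>e. \<Phi> (e \<circ> Inr) k)"
      using polyfun_subst[OF \<Phi>, of k "Inl ` ?K \<union> Inr ` J" "\<lambda>j e. e (Inr j)"]
      by (simp add: comp_def polyfun.var)
  next
    show "polyfun (Inl ` ?K \<union> Inr ` J) (\<lambda>e. s (e \<circ> Inr))"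
      using polyfun_subst[OF s, of "Inl ` ?K \<union> Inr ` J" "\<lambda>j e. e (Inr j)"]
      by (simp add: comp_def polyfun.var)
  qed (auto intro: polyfun.var)
  then have "definable ?K ?P" by (simp add: comp_def)
  then obtain A where A: "finite A" "\<forall>a\<in>A. polyfun ?K a"
      "\<forall>e e'. (\<forall>a\<in>A. a e = 0 \<longleftrightarrow> a e' = 0) \<longrightarrow> ?P e = ?P e'"
    unfolding definable_def by blast
  \<comment> \<open>Over a general point all roots of \<open>R\<close> produce the same pattern of
    zeros, so they are all attained or all missed.\<close>
  have "\<forall>a\<in>A. \<exists>g. polyfun K g \<and> (\<exists>T. g T \<noteq> 0) \<and>
      (\<forall>T u v. g T \<noteq> 0 \<longrightarrow> poly (R T) u = 0 \<longrightarrow> poly (R T) v = 0 \<longrightarrow>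
        (a (case_option u T) = 0 \<longleftrightarrow> a (case_option v T) = 0))"
  proof
    fix a assume "a \<in> A"
    then obtain m p where p: "polyfam (?K - {None}) m p" "\<And>e x. a (e(None := x)) = poly (p e) x"
      using polyfun_imp_polyfam[of ?K a None] A(2) by metis
    let ?a = "\<lambda>T. p (case_option 0 T)"
    have a: "polyfam K m ?a"
      by (rule polyfam_subst[OF p(1), where g = "\<lambda>i T. case_option 0 T i"]) (auto intro: polyfun.intros)
    have "a (case_option u T) = poly (?a T) u" for T u
    proof -
      have "case_option u T = (case_option 0 T)(None := u)" by (auto split: option.splits)
      then show ?thesis by (simp only: p(2))
    qed
    then show "\<exists>g. polyfun K g \<and> (\<exists>T. g T \<noteq> 0) \<and>
      (\<forall>T u v. g T \<noteq> 0 \<longrightarrow> poly (R T) u = 0 \<longrightarrow> poly (R T) v = 0 \<longrightarrow>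
        (a (case_option u T) = 0 \<longleftrightarrow> a (case_option v T) = 0))"
      using roots[OF a] by metis
  qed
  from bchoice[OF this] obtain g where g: "\<And>a. a \<in> A \<Longrightarrow> polyfun K (g a)"
    "\<And>a. a \<in> A \<Longrightarrow> \<exists>T. g a T \<noteq> 0"
    "\<And>a T u v. a \<in> A \<Longrightarrow> g a T \<noteq> 0 \<Longrightarrow> poly (R T) u = 0 \<Longrightarrow> poly (R T) v = 0 \<Longrightarrow>
        (a (case_option u T) = 0 \<longleftrightarrow> a (case_option v T) = 0)" by blast
  have R': "polyfam K n (\<lambda>T. pderiv (R T))"
    using R(1) unfolding polyfam_def coeff_pderiv by (auto intro: polyfun.intros)
  \<comment> \<open>\<open>h\<close> plays the role of a discriminant. The derivative has smaller
    degree than \<open>R\<close> and is nonzero by characteristic zero, so it does not vanish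
    identically at \<open>s\<close>.\<close>
  obtain h where h: "polyfun K h" "\<exists>T. h T \<noteq> 0"
    "\<And>T u. h T \<noteq> 0 \<Longrightarrow> poly (R T) u = 0 \<Longrightarrow> poly (pderiv (R T)) u \<noteq> 0"
  proof -
    have "\<not> (\<forall>q. poly (pderiv (R (\<Phi> q))) (s q) = 0)"
    proof
      assume "\<forall>q. poly (pderiv (R (\<Phi> q))) (s q) = 0"
      then have "pderiv (R T) = 0" for T using min[OF R'] by blast
      moreover obtain T where "c T \<noteq> 0" using c_nz by blast
      ultimately have "of_nat n * c T = 0"
        using n coeff_pderiv[of "R T" "n - 1"] by (simp add: c_def)
      with \<open>c T \<noteq> 0\<close> n show False by simp
    qed
    then show ?thesis using roots[OF R'] that by blast
  qed
  obtain f where f: "polyfun K f" "\<exists>T. f T \<noteq> 0" "\<And>T. f T \<noteq> 0 \<Longrightarrow> \<exists>q. \<forall>k\<in>K. \<Phi> q k = T k"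
    by (rule generic_in_image) blast
  define G where "G T = (\<Prod>a\<in>A. g a T)" for T
  have G: "polyfun K G" "\<exists>T. G T \<noteq> 0" unfolding G_def[abs_def]
    using polyfun_nonzero_prod[OF A(1) g(1,2)] g(1) by (auto intro: polyfun_prod)
  define Q where "Q T = (c T * h T) * (f T * G T)" for T
  have ch: "polyfun K (\<lambda>T. c T * h T)" and fG: "polyfun K (\<lambda>T. f T * G T)"
    using c h f G by (auto intro: polyfun.mult)
  have "\<exists>T. c T * h T \<noteq> 0" "\<exists>T. f T * G T \<noteq> 0"
    using polyfun_nonzero_mult[OF c h(1)] polyfun_nonzero_mult[OF f(1) G(1)] c_nz h(2) f(2) G(2)
    by blast+
  then have Q_nz: "\<exists>T. Q T \<noteq> 0" unfolding Q_def using polyfun_nonzero_mult[OF ch fG] by blast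
  have Q: "polyfun K Q" unfolding Q_def[abs_def] by (intro polyfun.mult ch fG)
  show ?thesis
  proof (rule that[OF Q Q_nz])
    fix T assume "Q T \<noteq> 0"
    then have nz: "c T \<noteq> 0" "h T \<noteq> 0" "f T \<noteq> 0" "\<And>a. a \<in> A \<Longrightarrow> g a T \<noteq> 0"
      using A(1) by (auto simp: Q_def G_def)
    have deg: "degree (R T) = n" using degree_polyfam[OF R(1)] nz(1) by (simp add: c_def)
    obtain q0 where q0: "\<forall>k\<in>K. \<Phi> q0 k = T k" using f(3)[OF nz(3)] by blast
    have root0: "poly (R T) (s q0) = 0"
      using R(3)[of q0] polyfam_cong[OF R(1), of "\<Phi> q0" T] q0 by simp
    have att: "\<exists>q. (\<forall>k\<in>K. \<Phi> q k = T k) \<and> s q = u" if "poly (R T) u = 0" for u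
    proof -
      have "?P (case_option u T) = ?P (case_option (s q0) T)"
        by (rule A(3)[rule_format]) (rule g(3)[OF _ nz(4) that root0])
      then show ?thesis using q0 by auto
    qed
    \<comment> \<open>Since \<open>n\<close> is at least 2, the cofactor of the known root has a
      root too, and it differs from the known one because roots are simple.\<close>
    obtain S where S: "R T = [:- s q0, 1:] * S"
      using root0 unfolding poly_eq_0_iff_dvd by (elim dvdE)
    have "S \<noteq> 0" using deg n S by auto
    then have "degree (R T) = Suc (degree S)" unfolding S by (subst degree_mult_eq) auto
    then have "degree S > 0" using deg n by simp
    then obtain u where u: "poly S u = 0" using alg_closed_imp_poly_has_root by blast
    have "u \<noteq> s q0"
    proof
      assume "u = s q0"
      then have "poly (pderiv (R T)) u = 0" using u \<open>u = s q0\<close>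
        unfolding S pderiv_mult by (simp del: mult_pCons_left)
      moreover have "poly (R T) u = 0" using u by (simp add: S)
      ultimately show False using h(3)[OF nz(2)] by blast
    qed
    moreover have "poly (R T) u = 0" using u by (simp add: S)
    ultimately show "\<exists>q q'. (\<forall>k\<in>K. \<Phi> q k = T k) \<and> (\<forall>k\<in>K. \<Phi> q' k = T k) \<and> s q \<noteq> s q'"
      using att[of u] q0 by blast
  qed
qed

end

section \<open>Sums of monomials\<close>

text \<open>The parameters of the \<open>i\<close>-th summand are a coefficient \<open>q (i, 0)\<close> and a point with affine
  coordinates \<open>q (i, 1)\<close>, \<open>q (i, 2)\<close>, \<open>q (i, 3)\<close>.\<close>

type_synonym expo = "nat \<times> nat \<times> nat"

definition term_at :: "(nat \<times> nat \<Rightarrow> 'a::comm_ring_1) \<Rightarrow> nat \<Rightarrow> expo \<Rightarrow> 'a" where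
  "term_at q i = (\<lambda>(\<alpha>, \<beta>, \<gamma>). q (i, 0) * q (i, 1) ^ \<alpha> * q (i, 2) ^ \<beta> * q (i, 3) ^ \<gamma>)"

definition terms_sum :: "nat \<Rightarrow> (nat \<times> nat \<Rightarrow> 'a::comm_ring_1) \<Rightarrow> expo \<Rightarrow> 'a" where
  "terms_sum m q \<alpha> = (\<Sum>i<m. term_at q i \<alpha>)"

definition square_sum :: "nat \<Rightarrow> expo \<Rightarrow> (nat \<times> nat \<Rightarrow> 'a::comm_ring_1) \<Rightarrow> 'a" where
  "square_sum m \<alpha> q = (\<Sum>i<m. (term_at q i \<alpha>)\<^sup>2)"

abbreviation torus :: "('i \<Rightarrow> 'a::zero) \<Rightarrow> bool" where
  "torus q \<equiv> \<forall>p. q p \<noteq> 0"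

text \<open>Only parameters in the torus are tested, because they will be multiplied by negative
  powers and divided by one another; by density this describes the same closure of the image. The
  type argument records the field, which \<open>S\<close> and \<open>m\<close> do not
  determine.\<close>

definition dominates :: "'a::field_char_0 itself \<Rightarrow> expo set \<Rightarrow> nat \<Rightarrow> bool" where
  "dominates _ S m \<longleftrightarrow> (\<forall>Q :: (expo \<Rightarrow> 'a) \<Rightarrow> 'a. polyfun S Q \<longrightarrow>
    (\<forall>q. torus q \<longrightarrow> Q (terms_sum m q) = 0) \<longrightarrow> (\<forall>T. Q T = 0))"

definition irrational_on :: "'a::field_char_0 itself \<Rightarrow> expo set \<Rightarrow> nat \<Rightarrow> expo \<Rightarrow> bool" where
  "irrational_on _ S m \<alpha> \<longleftrightarrow> (\<forall>A B :: (expo \<Rightarrow> 'a) \<Rightarrow> 'a. polyfun S A \<longrightarrow> polyfun S B \<longrightarrow>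
    (\<forall>q. torus q \<longrightarrow> A (terms_sum m q) * square_sum m \<alpha> q = B (terms_sum m q)) \<longrightarrow> (\<forall>T. A T = 0))"

lemma polyfun_term_at: "(\<And>l. l < 4 \<Longrightarrow> (i, l) \<in> V) \<Longrightarrow> polyfun V (\<lambda>q. term_at q i \<alpha>)"
  unfolding term_at_def case_prod_beta by (intro polyfun_intros) auto

lemma polyfun_terms_sum: "polyfun ({..<m} \<times> {..<4}) (\<lambda>q. terms_sum m q \<alpha>)"
  unfolding terms_sum_def by (intro polyfun_sum polyfun_term_at) auto

lemma polyfun_square_sum: "polyfun ({..<m} \<times> {..<4}) (square_sum m \<alpha>)"
  unfolding square_sum_def[abs_def] by (intro polyfun_sum polyfun_power polyfun_term_at) auto

lemma term_at_nonzero: "torus q \<Longrightarrow> term_at q i \<alpha> \<noteq> (0 :: 'a::field)"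
  by (auto simp: term_at_def split: prod.split)

subsection \<open>Degeneration along a linear weight\<close>

definition weight :: "(nat \<Rightarrow> nat) \<Rightarrow> expo \<Rightarrow> nat" where
  "weight u = (\<lambda>(\<alpha>, \<beta>, \<gamma>). u 0 + u 1 * \<alpha> + u 2 * \<beta> + u 3 * \<gamma>)"

text \<open>A one-parameter degeneration: the coordinate of a summand at an exponent is multiplied
  by \<open>t\<close> to the \<open>weight\<close> of that exponent, so near \<open>t = 0\<close>
  the group with the smaller weight prevails.\<close>

definition join_scaled where
  "join_scaled m u v t q r = (\<lambda>(i, l). if i < m then t ^ u l * q (i, l) else t ^ v l * r (i - m, l))"

lemma sum_lessThan_add: "(\<Sum>i<m + n. f i) = (\<Sum>i<m. f i) + (\<Sum>i<n. f (m + i :: nat) :: 'a::comm_monoid_add)"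
  by (induction n) (auto simp: add.assoc)

lemma term_at_join_scaled:
  "term_at (join_scaled m u v t q r) i \<alpha> =
    (if i < m then t ^ weight u \<alpha> * term_at q i \<alpha> else t ^ weight v \<alpha> * term_at r (i - m) \<alpha>)"
proof -
  obtain a b c where \<alpha>: "\<alpha> = (a, b, c)" by (cases \<alpha>)
  show ?thesis
    unfolding \<alpha> term_at_def join_scaled_def weight_def prod.case power_add power_mult
    by (cases "i < m") (simp_all add: power_mult_distrib mult.assoc mult.left_commute)
qed

lemma terms_sum_join_scaled:
  "terms_sum (m + n) (join_scaled m u v t q r) \<alpha> =
    t ^ weight u \<alpha> * terms_sum m q \<alpha> + t ^ weight v \<alpha> * terms_sum n r \<alpha>"
  by (simp add: terms_sum_def sum_lessThan_add term_at_join_scaled sum_distrib_left)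

lemma square_sum_join_scaled:
  "square_sum (m + n) \<alpha> (join_scaled m u v t q r) =
    t ^ (2 * weight u \<alpha>) * square_sum m \<alpha> q + t ^ (2 * weight v \<alpha>) * square_sum n \<alpha> r"
  by (simp add: square_sum_def sum_lessThan_add term_at_join_scaled sum_distrib_left
      power_mult_distrib power_mult[symmetric] mult.commute)

lemma torus_join_scaled:
  "torus q \<Longrightarrow> torus r \<Longrightarrow> t \<noteq> 0 \<Longrightarrow> torus (join_scaled m u v t q r :: _ \<Rightarrow> 'a::field)"
  by (auto simp: join_scaled_def)

lemma poly_lowest_terms:
  fixes p q :: "'a::field_char_0 poly"
  assumes "a \<le> b" "\<And>t. t \<noteq> 0 \<Longrightarrow> t ^ a * poly p t = t ^ b * poly q t"
  shows "poly p 0 = (if a = b then poly q 0 else 0)"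
proof -
  \<comment> \<open>Nothing is assumed at \<open>t = 0\<close>; the extra factor vanishes there and
    makes the whole product vanish everywhere.\<close>
  let ?d = "[:0, 1:] * (p - monom 1 (b - a) * q)"
  have "poly ?d t = 0" for t
  proof (cases "t = 0")
    case False
    have "t ^ b = t ^ a * t ^ (b - a)" using assms(1) by (simp flip: power_add)
    then have "poly p t = t ^ (b - a) * poly q t" using assms(2)[OF False] False by simp
    then show ?thesis by (simp add: poly_monom)
  qed simp
  then have "?d = 0" using poly_all_0_iff_0 by blast
  then have "p = monom 1 (b - a) * q" by (simp only: mult_eq_0_iff) simp
  then show ?thesis using assms(1) by (auto simp: poly_monom)
qed

text \<open>\<open>Q0\<close> is the part of \<open>Q\<close> of lowest weight with respect to
  \<open>h\<close>, and \<open>N\<close> is that weight. The statement is about curves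
  \<open>c\<close> because after the lowest power of \<open>t\<close> is taken out, the other group
  of summands still contributes terms of higher order.\<close>

lemma initial_form:
  fixes Q :: "('k \<Rightarrow> 'a::field_char_0) \<Rightarrow> 'a"
  assumes Q: "polyfun S Q" and nz: "\<exists>T. Q T \<noteq> 0"
  obtains N Q0 where "polyfun S Q0" "\<exists>T. Q0 T \<noteq> 0"
    "\<And>c. \<exists>r. (\<forall>t. Q (\<lambda>\<alpha>. t ^ h \<alpha> * poly (c \<alpha>) t) = t ^ N * poly r t) \<and>
      poly r 0 = Q0 (\<lambda>\<alpha>. poly (c \<alpha>) 0)"
proof -
  have "\<exists>D C. polyfam S D C \<and> (\<forall>T t. Q (\<lambda>\<alpha>. t ^ h \<alpha> * T \<alpha>) = poly (C T) t)"
    using Q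
  proof (induction rule: polyfun.induct)
    case (const c)
    show ?case
      by (rule exI[of _ 1], rule exI[of _ "\<lambda>_. [:c:]"]) (use polyfam_const[OF polyfun.const] in auto)
  next
    case (var i)
    show ?case
      by (rule exI[of _ "Suc (h i)"], rule exI[of _ "\<lambda>T. monom (T i) (h i)"])
        (use var in \<open>auto simp: poly_monom intro!: polyfam_monom polyfun.var\<close>)
  next
    case (add f g)
    then obtain D C E B where "polyfam S D C" "\<forall>T t. f (\<lambda>\<alpha>. t ^ h \<alpha> * T \<alpha>) = poly (C T) t"
      "polyfam S E B" "\<forall>T t. g (\<lambda>\<alpha>. t ^ h \<alpha> * T \<alpha>) = poly (B T) t" by blast
    then show ?case
      by (intro exI[of _ "max D E"] exI[of _ "\<lambda>T. C T + B T"]) (auto intro: polyfam_add)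
  next
    case (mult f g)
    then obtain D C E B where "polyfam S D C" "\<forall>T t. f (\<lambda>\<alpha>. t ^ h \<alpha> * T \<alpha>) = poly (C T) t"
      "polyfam S E B" "\<forall>T t. g (\<lambda>\<alpha>. t ^ h \<alpha> * T \<alpha>) = poly (B T) t" by blast
    then show ?case
      by (intro exI[of _ "D + E"] exI[of _ "\<lambda>T. C T * B T"]) (auto intro: polyfam_mult)
  qed
  then obtain D C where C: "polyfam S D C" "\<And>T t. Q (\<lambda>\<alpha>. t ^ h \<alpha> * T \<alpha>) = poly (C T) t" by blast
  obtain T where "Q T \<noteq> 0" using nz by blast
  then have "poly (C T) 1 \<noteq> 0" using C(2)[of 1 T] by simp
  then have ex: "\<exists>k T. coeff (C T) k \<noteq> 0" by (metis leading_coeff_0_iff poly_0)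
  define N where "N = (LEAST k. \<exists>T. coeff (C T) k \<noteq> 0)"
  have N: "\<exists>T. coeff (C T) N \<noteq> 0" unfolding N_def by (rule LeastI_ex) (rule ex)
  have less: "coeff (C T) k = 0" if "k < N" for k T using not_less_Least that unfolding N_def by blast
  have "N < D" using N polyfam_coeff_0[OF C(1)] by (metis not_le)
  show ?thesis
  proof (rule that[of "\<lambda>T. coeff (C T) N" N])
    fix c :: "'k \<Rightarrow> 'a poly"
    have "\<forall>k. \<exists>p. \<forall>t. poly p t = coeff (C (\<lambda>\<alpha>. poly (c \<alpha>) t)) k"
      using polyfun_curve[OF polyfam_coeff[OF C(1)]] by blast
    then obtain p where p: "\<And>k t. poly (p k) t = coeff (C (\<lambda>\<alpha>. poly (c \<alpha>) t)) k" by metis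
    define r where "r = (\<Sum>k=N..<D. monom 1 (k - N) * p k)"
    have "Q (\<lambda>\<alpha>. t ^ h \<alpha> * poly (c \<alpha>) t) = t ^ N * poly r t" for t
    proof -
      have "Q (\<lambda>\<alpha>. t ^ h \<alpha> * poly (c \<alpha>) t) = (\<Sum>k<D. poly (p k) t * t ^ k)"
        unfolding C(2) polyfam_poly[OF C(1)] p ..
      also have "\<dots> = (\<Sum>k=N..<D. poly (p k) t * t ^ k)"
        by (rule sum.mono_neutral_right) (auto simp: p less)
      also have "\<dots> = (\<Sum>k=N..<D. t ^ N * (t ^ (k - N) * poly (p k) t))"
        by (rule sum.cong) (auto simp: mult.assoc[symmetric] power_add[symmetric] mult.commute)
      also have "\<dots> = t ^ N * poly r t"
        unfolding r_def by (simp add: poly_sum poly_monom sum_distrib_left)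
      finally show ?thesis .
    qed
    moreover have "poly r 0 = coeff (C (\<lambda>\<alpha>. poly (c \<alpha>) 0)) N"
    proof -
      have "poly r 0 = (\<Sum>k=N..<D. (if k = N then poly (p N) 0 else 0))"
        unfolding r_def poly_sum by (rule sum.cong) (auto simp: poly_monom power_0_left)
      also have "\<dots> = poly (p N) 0" using \<open>N < D\<close> by simp
      finally show ?thesis by (simp add: p)
    qed
    ultimately show "\<exists>r. (\<forall>t. Q (\<lambda>\<alpha>. t ^ h \<alpha> * poly (c \<alpha>) t) = t ^ N * poly r t) \<and>
      poly r 0 = coeff (C (\<lambda>\<alpha>. poly (c \<alpha>) 0)) N" by blast
  qed (use N polyfam_coeff[OF C(1)] in auto)
qed

section \<open>Cutting a set of exponents by a plane\<close>

definition merge :: "'k set \<Rightarrow> ('k \<Rightarrow> 'a) \<Rightarrow> ('k \<Rightarrow> 'a) \<Rightarrow> 'k \<Rightarrow> 'a" where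
  "merge S T U = (\<lambda>\<alpha>. if \<alpha> \<in> S then T \<alpha> else U \<alpha>)"

lemma merge_same [simp]: "merge S T T = T"
  by (auto simp: merge_def)

lemma polyfun_merge_right:
  assumes "polyfun (S1 \<union> S2) Q"
  shows "polyfun S2 (\<lambda>U. Q (merge S1 T U))"
proof -
  have "polyfun S2 (\<lambda>U. if \<alpha> \<in> S1 then T \<alpha> else U \<alpha>)" if "\<alpha> \<in> S1 \<union> S2" for \<alpha>
    using that by (cases "\<alpha> \<in> S1") (auto intro: polyfun.intros)
  then show ?thesis unfolding merge_def by (rule polyfun_subst[OF assms])
qed

lemma polyfun_merge_left:
  assumes "polyfun (S1 \<union> S2) Q"
  shows "polyfun S1 (\<lambda>T. Q (merge S1 T U))"
proof -
  have "polyfun S1 (\<lambda>T. if \<alpha> \<in> S1 then T \<alpha> else U \<alpha>)" if "\<alpha> \<in> S1 \<union> S2" for \<alpha>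
    using that by (cases "\<alpha> \<in> S1") (auto intro: polyfun.intros)
  then show ?thesis unfolding merge_def by (rule polyfun_subst[OF assms])
qed

text \<open>A product of dominant maps is dominant: for fixed \<open>q\<close> the coordinates on
  \<open>S2\<close> are freed, and then those on \<open>S1\<close>.\<close>

lemma dominates_merge:
  assumes "dominates TYPE('a::field_char_0) S1 m" "dominates TYPE('a) S2 n"
    and Q: "polyfun (S1 \<union> S2) Q"
    and 0: "\<And>q r. torus q \<Longrightarrow> torus r \<Longrightarrow> Q (merge S1 (terms_sum m q) (terms_sum n r)) = (0 :: 'a)"
  shows "Q T = 0"
proof -
  have "Q (merge S1 (terms_sum m q) U) = 0" if "torus q" for q U
    using assms(2) polyfun_merge_right[OF Q] 0[OF that] unfolding dominates_def by blast
  then have "Q (merge S1 T U) = 0" for T U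
    using assms(1) polyfun_merge_left[OF Q] unfolding dominates_def by blast
  from this[of T T] show ?thesis by simp
qed

text \<open>The difference of the two weights is an affine function that is positive on
  \<open>S1\<close> and negative on \<open>S2\<close>. It is kept as a pair of weights with natural
  coefficients, so that only nonnegative powers of \<open>t\<close> occur.\<close>

locale cut =
  fixes S1 S2 :: "expo set" and u v :: "nat \<Rightarrow> nat"
  assumes less1: "\<And>\<alpha>. \<alpha> \<in> S1 \<Longrightarrow> weight u \<alpha> < weight v \<alpha>"
    and less2: "\<And>\<alpha>. \<alpha> \<in> S2 \<Longrightarrow> weight v \<alpha> < weight u \<alpha>"
begin

lemma initial_form_join:
  fixes Q :: "(expo \<Rightarrow> 'a::field_char_0) \<Rightarrow> 'a"
  assumes Q: "polyfun (S1 \<union> S2) Q" and nz: "\<exists>T. Q T \<noteq> 0"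
  obtains N Q0 where "polyfun (S1 \<union> S2) Q0" "\<exists>T. Q0 T \<noteq> 0"
    "\<And>q r. \<exists>p. (\<forall>t. Q (terms_sum (m + n) (join_scaled m u v t q r)) = t ^ N * poly p t) \<and>
      poly p 0 = Q0 (merge S1 (terms_sum m q) (terms_sum n r))"
proof -
  \<comment> \<open>The smaller weight is taken out of each coordinate. By strictness of the
    inequalities, at \<open>t = 0\<close> only the summands of \<open>q\<close> remain on
    \<open>S1\<close>, and only those of \<open>r\<close> on \<open>S2\<close>.\<close>
  define h where "h \<alpha> = min (weight u \<alpha>) (weight v \<alpha>)" for \<alpha>
  obtain N Q0 where Q0: "polyfun (S1 \<union> S2) Q0" "\<exists>T. Q0 T \<noteq> 0"
    "\<And>c. \<exists>r. (\<forall>t. Q (\<lambda>\<alpha>. t ^ h \<alpha> * poly (c \<alpha>) t) = t ^ N * poly r t) \<and>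
      poly r 0 = Q0 (\<lambda>\<alpha>. poly (c \<alpha>) 0)"
    by (rule initial_form[OF Q nz, where h = h]) blast
  show ?thesis
  proof (rule that[OF Q0(1,2)])
    fix q r :: "nat \<times> nat \<Rightarrow> 'a"
    define c where "c \<alpha> = monom (terms_sum m q \<alpha>) (weight u \<alpha> - h \<alpha>) +
      monom (terms_sum n r \<alpha>) (weight v \<alpha> - h \<alpha>)" for \<alpha>
    have "terms_sum (m + n) (join_scaled m u v t q r) = (\<lambda>\<alpha>. t ^ h \<alpha> * poly (c \<alpha>) t)" for t
    proof
      fix \<alpha>
      have "t ^ weight u \<alpha> = t ^ h \<alpha> * t ^ (weight u \<alpha> - h \<alpha>)"
        "t ^ weight v \<alpha> = t ^ h \<alpha> * t ^ (weight v \<alpha> - h \<alpha>)"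
        by (auto simp: h_def simp flip: power_add)
      then show "terms_sum (m + n) (join_scaled m u v t q r) \<alpha> = t ^ h \<alpha> * poly (c \<alpha>) t"
        by (simp add: terms_sum_join_scaled c_def poly_monom algebra_simps)
    qed
    moreover have "Q0 (\<lambda>\<alpha>. poly (c \<alpha>) 0) = Q0 (merge S1 (terms_sum m q) (terms_sum n r))"
    proof (rule polyfun_cong[OF Q0(1)])
      fix \<alpha> assume "\<alpha> \<in> S1 \<union> S2"
      then show "poly (c \<alpha>) 0 = merge S1 (terms_sum m q) (terms_sum n r) \<alpha>"
        using less1[of \<alpha>] less2[of \<alpha>]
        by (cases "\<alpha> \<in> S1") (auto simp: c_def merge_def h_def poly_monom power_0_left)
    qed
    ultimately show "\<exists>p. (\<forall>t. Q (terms_sum (m + n) (join_scaled m u v t q r)) = t ^ N * poly p t) \<and>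
      poly p 0 = Q0 (merge S1 (terms_sum m q) (terms_sum n r))"
      using Q0(3)[of c] by simp
  qed
qed

lemma dominates_cut:
  assumes 1: "dominates TYPE('a::field_char_0) S1 m" and 2: "dominates TYPE('a) S2 n"
  shows "dominates TYPE('a) (S1 \<union> S2) (m + n)"
  unfolding dominates_def
proof (intro allI impI)
  fix Q :: "(expo \<Rightarrow> 'a) \<Rightarrow> 'a" and T
  assume Q: "polyfun (S1 \<union> S2) Q" and 0: "\<forall>q. torus q \<longrightarrow> Q (terms_sum (m + n) q) = 0"
  show "Q T = 0"
  proof (rule ccontr)
    assume "Q T \<noteq> 0"
    then have "\<exists>T. Q T \<noteq> 0" by blast
    then obtain N Q0 where Q0: "polyfun (S1 \<union> S2) Q0" "\<exists>T. Q0 T \<noteq> 0"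
      "\<And>q r. \<exists>p. (\<forall>t. Q (terms_sum (m + n) (join_scaled m u v t q r)) = t ^ N * poly p t) \<and>
        poly p 0 = Q0 (merge S1 (terms_sum m q) (terms_sum n r))"
      by (rule initial_form_join[OF Q, of m n]) blast
    have "Q0 (merge S1 (terms_sum m q) (terms_sum n r)) = 0" if "torus q" "torus r" for q r
    proof -
      obtain p where p: "\<And>t. Q (terms_sum (m + n) (join_scaled m u v t q r)) = t ^ N * poly p t"
        "poly p 0 = Q0 (merge S1 (terms_sum m q) (terms_sum n r))" using Q0(3) by blast
      have "t ^ N * poly p t = t ^ N * poly 0 t" if "t \<noteq> 0" for t
        using p(1)[of t] 0 torus_join_scaled[OF \<open>torus q\<close> \<open>torus r\<close> that] by simp
      from poly_lowest_terms[OF order_refl this] show ?thesis using p(2) by simp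
    qed
    then show False using dominates_merge[OF 1 2 Q0(1)] Q0(2) by blast
  qed
qed

text \<open>As \<open>\<alpha>\<close> lies in \<open>S1\<close>, the lowest order term of the sum
  of squares comes from the first group alone. Lowest order terms of the relation then form a
  relation of the same kind for \<open>S1\<close>, with the second group as constants.\<close>

lemma irrational_cut:
  assumes 1: "dominates TYPE('a::field_char_0) S1 m" and 2: "dominates TYPE('a) S2 n"
    and irr: "irrational_on TYPE('a) S1 m \<alpha>" and \<alpha>: "\<alpha> \<in> S1"
  shows "irrational_on TYPE('a) (S1 \<union> S2) (m + n) \<alpha>"
  unfolding irrational_on_def
proof (intro allI impI)
  fix A B :: "(expo \<Rightarrow> 'a) \<Rightarrow> 'a" and T
  assume A: "polyfun (S1 \<union> S2) A" and B: "polyfun (S1 \<union> S2) B"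
    and AB: "\<forall>q. torus q \<longrightarrow> A (terms_sum (m + n) q) * square_sum (m + n) \<alpha> q = B (terms_sum (m + n) q)"
  show "A T = 0"
  proof (rule ccontr)
    assume "A T \<noteq> 0"
    then have "\<exists>T. A T \<noteq> 0" by blast
    then obtain N A0 where A0: "polyfun (S1 \<union> S2) A0" "\<exists>T. A0 T \<noteq> 0"
      "\<And>q r. \<exists>p. (\<forall>t. A (terms_sum (m + n) (join_scaled m u v t q r)) = t ^ N * poly p t) \<and>
        poly p 0 = A0 (merge S1 (terms_sum m q) (terms_sum n r))"
      by (rule initial_form_join[OF A, of m n]) blast
    \<comment> \<open>The order in \<open>t\<close> of the left-hand side.\<close>
    define a where "a = N + 2 * weight u \<alpha>"
    have lhs: "\<exists>p. (\<forall>t. A (terms_sum (m + n) (join_scaled m u v t q r)) *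
          square_sum (m + n) \<alpha> (join_scaled m u v t q r) = t ^ a * poly p t) \<and>
        poly p 0 = A0 (merge S1 (terms_sum m q) (terms_sum n r)) * square_sum m \<alpha> q" for q r
    proof -
      obtain p where p: "\<And>t. A (terms_sum (m + n) (join_scaled m u v t q r)) = t ^ N * poly p t"
        "poly p 0 = A0 (merge S1 (terms_sum m q) (terms_sum n r))" using A0(3) by blast
      define d where "d = 2 * weight v \<alpha> - 2 * weight u \<alpha>"
      have d: "2 * weight v \<alpha> = 2 * weight u \<alpha> + d" "d \<noteq> 0" using less1[OF \<alpha>] by (auto simp: d_def)
      let ?p = "p * ([:square_sum m \<alpha> q:] + monom (square_sum n \<alpha> r) d)"
      show ?thesis
      proof (intro exI[of _ ?p] conjI allI)
        show "A (terms_sum (m + n) (join_scaled m u v t q r)) *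
          square_sum (m + n) \<alpha> (join_scaled m u v t q r) = t ^ a * poly ?p t" for t
          unfolding p(1) square_sum_join_scaled d(1) a_def
          by (simp add: poly_monom power_add algebra_simps)
        show "poly ?p 0 = A0 (merge S1 (terms_sum m q) (terms_sum n r)) * square_sum m \<alpha> q"
          using d(2) by (simp add: p(2) poly_monom power_0_left)
      qed
    qed
    have "\<exists>B1. polyfun (S1 \<union> S2) B1 \<and> (\<forall>q r. torus q \<longrightarrow> torus r \<longrightarrow>
      A0 (merge S1 (terms_sum m q) (terms_sum n r)) * square_sum m \<alpha> q =
      B1 (merge S1 (terms_sum m q) (terms_sum n r)))"
    proof (cases "\<exists>T. B T \<noteq> 0")
      case True
      then obtain M B0 where B0: "polyfun (S1 \<union> S2) B0" "\<exists>T. B0 T \<noteq> 0"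
        "\<And>q r. \<exists>p. (\<forall>t. B (terms_sum (m + n) (join_scaled m u v t q r)) = t ^ M * poly p t) \<and>
          poly p 0 = B0 (merge S1 (terms_sum m q) (terms_sum n r))"
        by (rule initial_form_join[OF B, of m n]) blast
      have eq: "\<exists>p p'. (\<forall>t. t \<noteq> 0 \<longrightarrow> t ^ a * poly p t = t ^ M * poly p' t) \<and>
          poly p 0 = A0 (merge S1 (terms_sum m q) (terms_sum n r)) * square_sum m \<alpha> q \<and>
          poly p' 0 = B0 (merge S1 (terms_sum m q) (terms_sum n r))" if "torus q" "torus r" for q r
        using lhs[of q r] B0(3)[of q r] AB torus_join_scaled[OF that, of _ m u v] by metis
      \<comment> \<open>If the right-hand side had smaller order, its initial form would vanish on
        all merged vectors, which dominance forbids.\<close>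
      have "a \<le> M"
      proof (rule ccontr)
        assume "\<not> a \<le> M"
        then have aM: "M \<le> a" "M \<noteq> a" by auto
        have "B0 (merge S1 (terms_sum m q) (terms_sum n r)) = 0" if qr: "torus q" "torus r" for q r
        proof -
          obtain p p' where pp: "\<And>t. t \<noteq> 0 \<Longrightarrow> t ^ a * poly p t = t ^ M * poly p' t"
            "poly p' 0 = B0 (merge S1 (terms_sum m q) (terms_sum n r))" using eq[OF qr] by blast
          show ?thesis using poly_lowest_terms[OF aM(1) pp(1)[symmetric]] pp(2) aM(2) by simp
        qed
        then show False using dominates_merge[OF 1 2 B0(1)] B0(2) by blast
      qed
      \<comment> \<open>A right-hand side of strictly larger order leaves nothing at the order of
        the left-hand side.\<close>
      define B1 where "B1 T = (if a = M then B0 T else 0)" for T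
      have "polyfun (S1 \<union> S2) B1" unfolding B1_def[abs_def]
        using B0(1) by (cases "a = M") (auto intro: polyfun.const)
      moreover have "A0 (merge S1 (terms_sum m q) (terms_sum n r)) * square_sum m \<alpha> q =
        B1 (merge S1 (terms_sum m q) (terms_sum n r))" if qr: "torus q" "torus r" for q r
      proof -
        obtain p p' where pp: "\<And>t. t \<noteq> 0 \<Longrightarrow> t ^ a * poly p t = t ^ M * poly p' t"
          "poly p 0 = A0 (merge S1 (terms_sum m q) (terms_sum n r)) * square_sum m \<alpha> q"
          "poly p' 0 = B0 (merge S1 (terms_sum m q) (terms_sum n r))" using eq[OF qr] by blast
        show ?thesis using poly_lowest_terms[OF \<open>a \<le> M\<close> pp(1)] pp(2,3) by (simp add: B1_def)
      qed
      ultimately show ?thesis by blast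
    next
      case False
      have "A0 (merge S1 (terms_sum m q) (terms_sum n r)) * square_sum m \<alpha> q = 0"
        if "torus q" "torus r" for q r
      proof -
        obtain p where p: "\<And>t. A (terms_sum (m + n) (join_scaled m u v t q r)) *
          square_sum (m + n) \<alpha> (join_scaled m u v t q r) = t ^ a * poly p t"
          "poly p 0 = A0 (merge S1 (terms_sum m q) (terms_sum n r)) * square_sum m \<alpha> q"
          using lhs by blast
        have "t ^ a * poly p t = t ^ a * poly 0 t" if "t \<noteq> 0" for t
          using p(1)[of t] AB torus_join_scaled[OF \<open>torus q\<close> \<open>torus r\<close> that] False by simp
        from poly_lowest_terms[OF order_refl this] show ?thesis using p(2) by simp
      qed
      then show ?thesis by (intro exI[of _ "\<lambda>_. 0"]) (simp add: polyfun.const)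
    qed
    then obtain B1 where B1: "polyfun (S1 \<union> S2) B1" "\<And>q r. torus q \<Longrightarrow> torus r \<Longrightarrow>
      A0 (merge S1 (terms_sum m q) (terms_sum n r)) * square_sum m \<alpha> q =
      B1 (merge S1 (terms_sum m q) (terms_sum n r))" by blast
    obtain T where T: "A0 T \<noteq> 0" using A0(2) by blast
    \<comment> \<open>The second group is frozen at parameters for which \<open>A0\<close> stays
      nonzero as a function of the coordinates on \<open>S1\<close>.\<close>
    obtain r where r: "torus r" "A0 (merge S1 T (terms_sum n r)) \<noteq> 0"
    proof (rule ccontr)
      assume "\<not> thesis"
      then have "\<forall>r. torus r \<longrightarrow> A0 (merge S1 T (terms_sum n r)) = 0" using that by blast
      then have "A0 (merge S1 T T) = 0"
        using 2 polyfun_merge_right[OF A0(1)] unfolding dominates_def by blast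
      then show False using T by simp
    qed
    have "A0 (merge S1 T (terms_sum n r)) = 0"
      using irr polyfun_merge_left[OF A0(1), of "terms_sum n r"]
        polyfun_merge_left[OF B1(1), of "terms_sum n r"] B1(2)[OF _ r(1)]
      unfolding irrational_on_def by blast
    then show False using r(2) by simp
  qed
qed

end

subsection \<open>Cells\<close>

lemma powi_root_exists:
  fixes \<tau> :: "'a::alg_closed_field"
  assumes "n \<noteq> 0" "\<tau> \<noteq> 0"
  shows "\<exists>s. s \<noteq> 0 \<and> s powi n = \<tau>"
proof -
  obtain s where s: "s ^ nat \<bar>n\<bar> = (if n > 0 then \<tau> else inverse \<tau>)"
    using nth_root_exists[of "nat \<bar>n\<bar>"] assms by auto
  have "s \<noteq> 0" using s assms by (auto simp: power_0_left split: if_splits)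
  moreover have "s powi n = \<tau>"
    using s assms by (auto simp: power_int_def power_inverse split: if_splits)
  ultimately show ?thesis by blast
qed

text \<open>Cramer's rule in multiplicative form: the unknowns are products of roots of order D of
  the right-hand sides, raised to the entries of the adjugate matrix, where D is the
  determinant.\<close>

lemma monomial_system_solution:
  fixes \<tau> :: "nat \<Rightarrow> 'a::alg_closed_field"
  assumes D: "p1 * (q2 * r3 - q3 * r2) + p2 * (q3 * r1 - q1 * r3) + p3 * (q1 * r2 - q2 * r1) \<noteq> (0::int)"
    and \<tau>: "\<tau> 1 \<noteq> 0" "\<tau> 2 \<noteq> 0" "\<tau> 3 \<noteq> 0"
  obtains x y z where "x \<noteq> 0" "y \<noteq> 0" "z \<noteq> 0"
    "x powi p1 * y powi p2 * z powi p3 = \<tau> 1"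
    "x powi q1 * y powi q2 * z powi q3 = \<tau> 2"
    "x powi r1 * y powi r2 * z powi r3 = \<tau> 3"
proof -
  define D where "D = p1 * (q2 * r3 - q3 * r2) + p2 * (q3 * r1 - q1 * r3) + p3 * (q1 * r2 - q2 * r1)"
  have "D \<noteq> 0" using D by (simp add: D_def)
  then obtain s1 s2 s3 where s: "s1 \<noteq> 0" "s1 powi D = \<tau> 1" "s2 \<noteq> 0" "s2 powi D = \<tau> 2"
    "s3 \<noteq> 0" "s3 powi D = \<tau> 3" using powi_root_exists \<tau> by metis
  define x where "x = s1 powi (q2 * r3 - q3 * r2) * s2 powi (p3 * r2 - p2 * r3) * s3 powi (p2 * q3 - p3 * q2)"
  define y where "y = s1 powi (q3 * r1 - q1 * r3) * s2 powi (p1 * r3 - p3 * r1) * s3 powi (p3 * q1 - p1 * q3)"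
  define z where "z = s1 powi (q1 * r2 - q2 * r1) * s2 powi (p2 * r1 - p1 * r2) * s3 powi (p1 * q2 - p2 * q1)"
  have xyz: "x powi a * y powi b * z powi c =
      s1 powi ((q2 * r3 - q3 * r2) * a + (q3 * r1 - q1 * r3) * b + (q1 * r2 - q2 * r1) * c) *
      s2 powi ((p3 * r2 - p2 * r3) * a + (p1 * r3 - p3 * r1) * b + (p2 * r1 - p1 * r2) * c) *
      s3 powi ((p2 * q3 - p3 * q2) * a + (p3 * q1 - p1 * q3) * b + (p1 * q2 - p2 * q1) * c)" for a b c
    unfolding x_def y_def z_def power_int_mult_distrib power_int_mult[symmetric]
    using s by (simp add: power_int_add)
  show ?thesis
  proof
    show "x \<noteq> 0" "y \<noteq> 0" "z \<noteq> 0" using s by (auto simp: x_def y_def z_def)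
    have e: "s1 powi i * s2 powi j * s3 powi k = s1 powi i' * s2 powi j' * s3 powi k'"
      if "i = i'" "j = j'" "k = k'" for i j k i' j' k' using that by simp
    show "x powi p1 * y powi p2 * z powi p3 = \<tau> 1"
      unfolding xyz s(2)[symmetric]
      by (rule trans[OF e[of _ D _ 0 _ 0]]) (auto simp: D_def algebra_simps)
    show "x powi q1 * y powi q2 * z powi q3 = \<tau> 2"
      unfolding xyz s(4)[symmetric]
      by (rule trans[OF e[of _ 0 _ D _ 0]]) (auto simp: D_def algebra_simps)
    show "x powi r1 * y powi r2 * z powi r3 = \<tau> 3"
      unfolding xyz s(6)[symmetric]
      by (rule trans[OF e[of _ 0 _ 0 _ D]]) (auto simp: D_def algebra_simps)
  qed
qed

fun affine_det :: "expo \<Rightarrow> expo \<Rightarrow> expo \<Rightarrow> expo \<Rightarrow> int" where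
  "affine_det (a1, a2, a3) (b1, b2, b3) (c1, c2, c3) (d1, d2, d3) =
    (let p1 = int b1 - int a1; p2 = int b2 - int a2; p3 = int b3 - int a3;
         q1 = int c1 - int a1; q2 = int c2 - int a2; q3 = int c3 - int a3;
         r1 = int d1 - int a1; r2 = int d2 - int a2; r3 = int d3 - int a3
     in p1 * (q2 * r3 - q3 * r2) + p2 * (q3 * r1 - q1 * r3) + p3 * (q1 * r2 - q2 * r1))"

text \<open>A single summand can take arbitrary nonzero values at four affinely independent
  exponents: the quotients by the value at \<open>a\<close> determine the point through a
  nonsingular monomial system, and the value at \<open>a\<close> then gives the coefficient.\<close>

lemma dominates_simplex:
  assumes "affine_det a b c d \<noteq> 0"
  shows "dominates TYPE('a::{alg_closed_field, field_char_0}) {a, b, c, d} 1"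
  unfolding dominates_def
proof (intro allI impI)
  fix Q :: "(expo \<Rightarrow> 'a) \<Rightarrow> 'a" and T
  assume Q: "polyfun {a, b, c, d} Q" and 0: "\<forall>q. torus q \<longrightarrow> Q (terms_sum 1 q) = 0"
  obtain a1 a2 a3 b1 b2 b3 c1 c2 c3 d1 d2 d3 where abcd: "a = (a1, a2, a3)" "b = (b1, b2, b3)"
    "c = (c1, c2, c3)" "d = (d1, d2, d3)" by (metis prod.exhaust)
  show "Q T = 0"
  proof (rule polyfun_eq_0_if_torus[OF Q])
    fix T :: "expo \<Rightarrow> 'a" assume T: "torus T"
    obtain x y z where xyz: "x \<noteq> 0" "y \<noteq> 0" "z \<noteq> 0"
      "x powi (int b1 - int a1) * y powi (int b2 - int a2) * z powi (int b3 - int a3) = T b / T a"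
      "x powi (int c1 - int a1) * y powi (int c2 - int a2) * z powi (int c3 - int a3) = T c / T a"
      "x powi (int d1 - int a1) * y powi (int d2 - int a2) * z powi (int d3 - int a3) = T d / T a"
      by (rule monomial_system_solution[of "int b1 - int a1" "int c2 - int a2" "int d3 - int a3"
            "int c3 - int a3" "int d2 - int a2" "int b2 - int a2" "int d1 - int a1" "int c1 - int a1"
            "int b3 - int a3" "\<lambda>i. if i = 1 then T b / T a else if i = 2 then T c / T a else T d / T a"])
        (use assms T in \<open>simp_all add: abcd Let_def\<close>)
    define w where "w = T a / (x ^ a1 * y ^ a2 * z ^ a3)"
    define q where "q = (\<lambda>(i::nat, l::nat). if l = 0 then w else if l = 1 then x else if l = 2 then y else z)"
    have "torus q" using xyz T by (auto simp: q_def w_def)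
    moreover have "terms_sum 1 q \<alpha> = T \<alpha>" if "\<alpha> \<in> {a, b, c, d}" for \<alpha>
    proof -
      have *: "terms_sum 1 q (e1, e2, e3) = T a * (x powi (int e1 - int a1) *
          y powi (int e2 - int a2) * z powi (int e3 - int a3))" for e1 e2 e3
        using xyz(1-3) by (simp add: terms_sum_def term_at_def q_def w_def power_int_diff)
      show ?thesis
        using that xyz T unfolding abcd by (auto simp: * abcd simp del: One_nat_def)
    qed
    ultimately show "Q T = 0" using 0 polyfun_cong[OF Q, of "terms_sum 1 q" T] by metis
  qed simp
qed

fun affine :: "int \<times> int \<times> int \<times> int \<Rightarrow> expo \<Rightarrow> int" where
  "affine (n0, n1, n2, n3) (\<alpha>, \<beta>, \<gamma>) = n0 + n1 * int \<alpha> + n2 * int \<beta> + n3 * int \<gamma>"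

lemma term_at_powi:
  fixes q :: "nat \<times> nat \<Rightarrow> 'a::field"
  assumes "\<mu> i \<noteq> 0" "n = (n0, n1, n2, n3)"
  defines "q' \<equiv> \<lambda>(i, l). q (i, l) * \<mu> i powi (if l = 0 then n0 else if l = 1 then n1 else if l = 2 then n2 else n3)"
  shows "term_at q' i \<alpha> = term_at q i \<alpha> * \<mu> i powi affine n \<alpha>"
  using assms(1) unfolding assms(2)
  by (cases \<alpha>) (simp add: q'_def term_at_def power_mult_distrib power_int_add power_int_mult)

text \<open>The involution that sends \<open>q\<close> to \<open>q'\<close> below preserves the sums of monomials, but not the sum of
  the squares.\<close>

lemma irrational_on_pair:
  assumes dom: "dominates TYPE('a::field_char_0) S 2" and S: "finite S"
    and e: "e \<in> S" "f \<in> S" "affine n e = 1" "affine n f = - 1"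
    and n0: "\<And>\<alpha>. \<alpha> \<in> S \<Longrightarrow> \<alpha> \<noteq> e \<Longrightarrow> \<alpha> \<noteq> f \<Longrightarrow> affine n \<alpha> = 0"
  shows "irrational_on TYPE('a) S 2 e"
  unfolding irrational_on_def
proof (intro allI impI)
  fix A B :: "(expo \<Rightarrow> 'a) \<Rightarrow> 'a" and T
  assume A: "polyfun S A" and B: "polyfun S B"
    and AB: "\<forall>q. torus q \<longrightarrow> A (terms_sum 2 q) * square_sum 2 e q = B (terms_sum 2 q)"
  \<comment> \<open>\<open>V\<close> is the coordinate at \<open>e\<close>. The product
    \<open>C\<close> of the coordinates at \<open>e\<close> and \<open>f\<close> is invariant under
    the rescaling, since \<open>n\<close> has opposite values there.\<close>
  define V :: "nat \<Rightarrow> (nat \<times> nat \<Rightarrow> 'a) \<Rightarrow> 'a" where "V i q = term_at q i e" for i q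
  define C :: "nat \<Rightarrow> (nat \<times> nat \<Rightarrow> 'a) \<Rightarrow> 'a" where "C i q = term_at q i e * term_at q i f" for i q
  let ?J = "{..<2} \<times> {..<4} :: (nat \<times> nat) set"
  have VC: "polyfun ?J (V i)" "polyfun ?J (C i)" if "i < 2" for i
    using that unfolding V_def[abs_def] C_def[abs_def]
    by (auto intro!: polyfun.mult polyfun_term_at)
  \<comment> \<open>\<open>G1\<close> keeps the denominator and the numerator of
    \<open>\<sigma>\<close> nonzero; \<open>G2\<close> is the obstruction to the involution changing
    the sum of squares.\<close>
  define G1 where "G1 q = (C 0 q * V 1 q + C 1 q * V 0 q) * (V 0 q + V 1 q)" for q
  define G2 where "G2 q = (C 0 q - C 1 q) * (C 0 q * (V 1 q)\<^sup>2 - C 1 q * (V 0 q)\<^sup>2)" for q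
  have G1: "polyfun ?J G1" and G2: "polyfun ?J G2"
    unfolding G1_def[abs_def] G2_def[abs_def] by (auto intro!: polyfun_intros VC)
  have "\<exists>q. G1 q \<noteq> 0"
    by (rule exI[of _ "\<lambda>_. 1"]) (auto simp: G1_def V_def C_def term_at_def split: prod.splits)
  moreover have "\<exists>q. G2 q \<noteq> 0"
  proof -
    have "e \<noteq> f" using e by auto
    obtain e1 e2 e3 f1 f2 f3 where ef: "e = (e1, e2, e3)" "f = (f1, f2, f3)" by (metis prod.exhaust)
    \<comment> \<open>A variable in which \<open>e\<close> and \<open>f\<close> have different
      exponents; putting it equal to 2 in the first summand separates the two coordinates.\<close>
    define l :: nat where "l = (if e1 \<noteq> f1 then 1 else if e2 \<noteq> f2 then 2 else 3)"
    define q :: "nat \<times> nat \<Rightarrow> 'a" where "q = (\<lambda>_. 1)((0, l) := 2)"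
    define q' :: "nat \<times> nat \<Rightarrow> 'a" where "q' = (\<lambda>_. 1)((0, 0) := 2)"
    have "C 0 q' - C 1 q' \<noteq> 0" by (simp add: C_def q'_def term_at_def ef)
    have p2: "(2::'a) ^ i = 2 ^ j \<longleftrightarrow> i = j" for i j
    proof -
      have "(2::'a) ^ i = 2 ^ j \<longleftrightarrow> of_nat (2 ^ i) = (of_nat (2 ^ j) :: 'a)" by simp
      also have "\<dots> \<longleftrightarrow> (2::nat) ^ i = 2 ^ j" by (rule of_nat_eq_iff)
      finally show ?thesis by simp
    qed
    have "V 1 q = 1" "C 1 q = 1" by (simp_all add: V_def C_def q_def term_at_def ef)
    then have "C 0 q * (V 1 q)\<^sup>2 - C 1 q * (V 0 q)\<^sup>2 = term_at q 0 e * (term_at q 0 f - term_at q 0 e)"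
      by (simp add: V_def C_def power2_eq_square algebra_simps)
    moreover have "term_at q 0 f \<noteq> term_at q 0 e"
      using \<open>e \<noteq> f\<close> p2 by (auto simp: ef q_def term_at_def l_def)
    moreover have "term_at q 0 e \<noteq> 0" by (rule term_at_nonzero) (simp add: q_def)
    ultimately have "C 0 q * (V 1 q)\<^sup>2 - C 1 q * (V 0 q)\<^sup>2 \<noteq> 0" by simp
    with \<open>C 0 q' - C 1 q' \<noteq> 0\<close> show ?thesis unfolding G2_def
      by (intro polyfun_nonzero_mult[of ?J _ ?J _ q' q]) (auto intro!: polyfun_intros VC)
  qed
  ultimately have G: "\<exists>q. G1 q * G2 q \<noteq> 0" using polyfun_nonzero_mult[OF G1 G2] by blast
  obtain m0 m1 m2 m3 where n: "n = (m0, m1, m2, m3)" by (cases n)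
  have "A (terms_sum 2 q) = 0" if q: "torus q" and nz: "G1 q * G2 q \<noteq> 0" for q
  proof -
    define v where "v i = V i q" for i
    define c where "c i = C i q" for i
    have v: "v i \<noteq> 0" for i unfolding v_def V_def by (rule term_at_nonzero[OF q])
    have c: "c i \<noteq> 0" for i unfolding c_def C_def using term_at_nonzero[OF q] by simp
    have nz': "c 0 * v 1 + c 1 * v 0 \<noteq> 0" "v 0 + v 1 \<noteq> 0" "c 0 \<noteq> c 1"
      "c 0 * (v 1)\<^sup>2 \<noteq> c 1 * (v 0)\<^sup>2"
      using nz by (auto simp: G1_def G2_def v_def c_def)
    \<comment> \<open>The product of v0 + v1 and c0/v0 + c1/v1 depends on the ratio of v0 to v1, say
      r, only through c1 r + c0/r. The second solution therefore has ratio c0/(c1 r), and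
      \<open>\<sigma>\<close> normalizes the sum of the new coordinates.\<close>
    define \<sigma> where "\<sigma> = (v 0 + v 1) / (c 0 * v 1 + c 1 * v 0)"
    have \<sigma>: "\<sigma> \<noteq> 0" "\<sigma> * (c 0 * v 1 + c 1 * v 0) = v 0 + v 1" using nz' by (auto simp: \<sigma>_def)
    define \<mu> where "\<mu> i = (if i = 0 then \<sigma> * c 0 * v 1 / v 0 else \<sigma> * c 1 * v 0 / v 1)" for i :: nat
    have \<mu>: "\<mu> i \<noteq> 0" for i using \<sigma> c v by (simp add: \<mu>_def)
    define q' where "q' = (\<lambda>(i, l). q (i, l) *
      \<mu> i powi (if l = 0 then m0 else if l = 1 then m1 else if l = 2 then m2 else m3))"
    have t: "term_at q' i \<alpha> = term_at q i \<alpha> * \<mu> i powi affine n \<alpha>" for i \<alpha>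
      unfolding q'_def by (rule term_at_powi[OF \<mu> n])
    have q': "torus q'" using q \<mu> by (auto simp: q'_def)
    have e_term: "term_at q i e = v i" for i by (simp add: v_def V_def)
    have f_term: "term_at q i f = c i / v i" for i
      using v by (simp add: c_def C_def v_def V_def)
    have e': "term_at q' 0 e = \<sigma> * c 0 * v 1" "term_at q' 1 e = \<sigma> * c 1 * v 0"
      using v by (simp_all add: t e \<mu>_def e_term)
    have f': "term_at q' 0 f = 1 / (\<sigma> * v 1)" "term_at q' 1 f = 1 / (\<sigma> * v 0)"
      using v c \<sigma> by (simp_all add: t e \<mu>_def f_term power_int_minus field_simps)
    have two: "terms_sum 2 r \<alpha> = term_at r 0 \<alpha> + term_at r 1 \<alpha>" for r :: "nat \<times> nat \<Rightarrow> 'a" and \<alpha>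
      by (simp add: terms_sum_def numeral_2_eq_2)
    have "terms_sum 2 q' \<alpha> = terms_sum 2 q \<alpha>" if \<alpha>: "\<alpha> \<in> S" for \<alpha>
    proof -
      consider "\<alpha> = e" | "\<alpha> = f" | "affine n \<alpha> = 0" using n0[OF \<alpha>] by blast
      then show ?thesis
      proof cases
        case 1
        then show ?thesis unfolding two e_term 1 e' using \<sigma>(2) by (simp add: algebra_simps)
      next
        case 2
        have "1 / (\<sigma> * v 1) + 1 / (\<sigma> * v 0) = (v 0 + v 1) / (\<sigma> * v 0 * v 1)"
          using v \<sigma>(1) by (simp add: field_simps)
        also have "\<dots> = (c 0 * v 1 + c 1 * v 0) / (v 0 * v 1)"
          unfolding \<sigma>(2)[symmetric] using \<sigma>(1) by simp
        also have "\<dots> = c 0 / v 0 + c 1 / v 1" using v by (simp add: field_simps)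
        finally show ?thesis unfolding two 2 f_term f' .
      next
        case 3
        then show ?thesis by (simp add: two t)
      qed
    qed
    then have eq: "A (terms_sum 2 q') = A (terms_sum 2 q)" "B (terms_sum 2 q') = B (terms_sum 2 q)"
      using polyfun_cong[OF A] polyfun_cong[OF B] by blast+
    \<comment> \<open>Equal sums and equal sums of squares would give equal products, that is
      \<open>\<sigma>\<^sup>2 * c 0 * c 1 = 1\<close>. Clearing the denominator of
      \<open>\<sigma>\<close> turns this into the vanishing of \<open>G2\<close>.\<close>
    have "square_sum 2 e q' \<noteq> square_sum 2 e q"
    proof
      assume "square_sum 2 e q' = square_sum 2 e q"
      then have "(\<sigma> * c 0 * v 1)\<^sup>2 + (\<sigma> * c 1 * v 0)\<^sup>2 = (v 0)\<^sup>2 + (v 1)\<^sup>2"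
        using e' by (simp add: square_sum_def numeral_2_eq_2 e_term)
      moreover have "(\<sigma> * c 0 * v 1 + \<sigma> * c 1 * v 0)\<^sup>2 = (v 0 + v 1)\<^sup>2"
        using \<sigma>(2) by (simp add: algebra_simps)
      ultimately have "(\<sigma> * c 0 * v 1) * (\<sigma> * c 1 * v 0) = v 0 * v 1"
        unfolding power2_sum by simp
      then have "(\<sigma>\<^sup>2 * c 0 * c 1) * (v 0 * v 1) = 1 * (v 0 * v 1)"
        by (auto simp: power2_eq_square mult.assoc mult.left_commute)
      then have "\<sigma>\<^sup>2 * c 0 * c 1 = 1" using v by (metis mult_cancel_right mult_eq_0_iff)
      moreover have "(\<sigma> * x)\<^sup>2 * (c 0 * c 1) = (\<sigma>\<^sup>2 * c 0 * c 1) * x\<^sup>2" for x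
        by (simp add: power_mult_distrib mult.assoc mult.left_commute)
      ultimately have "(\<sigma> * (c 0 * v 1 + c 1 * v 0))\<^sup>2 * (c 0 * c 1) = (c 0 * v 1 + c 1 * v 0)\<^sup>2"
        by simp
      then have "(v 0 + v 1)\<^sup>2 * (c 0 * c 1) = (c 0 * v 1 + c 1 * v 0)\<^sup>2" unfolding \<sigma>(2) .
      then have "(c 0 - c 1) * (c 0 * (v 1)\<^sup>2 - c 1 * (v 0)\<^sup>2) = 0"
        by (simp add: power2_eq_square algebra_simps)
      then show False using nz' by simp
    qed
    moreover have "A (terms_sum 2 q) * (square_sum 2 e q' - square_sum 2 e q) = 0"
      unfolding right_diff_distrib
      using AB[THEN spec, THEN mp, OF q] AB[THEN spec, THEN mp, OF q'] by (simp only: eq) simp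
    ultimately show ?thesis by simp
  qed
  then have "A (terms_sum 2 q) * (G1 q * G2 q) = 0" if "torus q" for q
    using that by (cases "G1 q * G2 q = 0") simp_all
  moreover have cp: "polyfun ?J (\<lambda>q. A (terms_sum 2 q))"
    by (rule polyfun_subst[OF A]) (rule polyfun_terms_sum)
  moreover have GG: "polyfun ?J (\<lambda>q. G1 q * G2 q)" by (intro polyfun.mult G1 G2)
  ultimately have "A (terms_sum 2 q) * (G1 q * G2 q) = 0" for q
    using polyfun_eq_0_if_torus[OF polyfun.mult[OF cp GG], of q] by simp
  then have "A (terms_sum 2 q) = 0" for q
    using polyfun_mult_eq_0[OF cp GG] G by blast
  then show "A T = 0" using dom A unfolding dominates_def by blast
qed

text \<open>The case of right-hand side zero.\<close>

lemma irrational_on_imp_dominates: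
  assumes "irrational_on TYPE('a::field_char_0) S m \<alpha>"
  shows "dominates TYPE('a) S m"
  unfolding dominates_def
proof (intro allI impI)
  fix Q :: "(expo \<Rightarrow> 'a) \<Rightarrow> 'a" and T
  assume "polyfun S Q" "\<forall>q. torus q \<longrightarrow> Q (terms_sum m q) = 0"
  then show "Q T = 0"
    using assms[unfolded irrational_on_def, rule_format, of Q "\<lambda>_. 0" T] by (simp add: polyfun.const)
qed

text \<open>The negative parts of the coefficients form the weight \<open>u\<close>, the positive
  parts form \<open>v\<close>; their difference is the affine function.\<close>

lemma cut_affine:
  assumes "n = (n0, n1, n2, n3)"
  defines "u \<equiv> (\<lambda>l::nat. nat (- (if l = 0 then n0 else if l = 1 then n1 else if l = 2 then n2 else n3)))"
    and "v \<equiv> (\<lambda>l::nat. nat (if l = 0 then n0 else if l = 1 then n1 else if l = 2 then n2 else n3))"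
  shows "cut {\<alpha> \<in> S. affine n \<alpha> > 0} {\<alpha> \<in> S. affine n \<alpha> < 0} u v"
proof -
  have "int (nat x) * y = int (nat (- x)) * y + x * y" for x y by (cases "x \<ge> 0") auto
  note * = this this[of _ 1, simplified]
  have "int (weight v \<alpha>) = int (weight u \<alpha>) + affine n \<alpha>" for \<alpha>
    unfolding assms(1) by (cases \<alpha>) (simp add: weight_def u_def v_def *)
  then show ?thesis unfolding cut_def by (metis (no_types, lifting) add_less_same_cancel1 less_add_same_cancel1 mem_Collect_eq of_nat_less_iff)
qed

section \<open>Certificates for cuts into cells, to be checked by evaluation\<close>

datatype cut_tree = Leaf | Cut "int \<times> int \<times> int \<times> int" cut_tree cut_tree

fun leaves :: "cut_tree \<Rightarrow> nat" where
  "leaves Leaf = 1"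
| "leaves (Cut n s t) = leaves s + leaves t"

fun cuts_to_simplices :: "cut_tree \<Rightarrow> expo list \<Rightarrow> bool" where
  "cuts_to_simplices Leaf xs = (case xs of [a, b, c, d] \<Rightarrow> affine_det a b c d \<noteq> 0 | _ \<Rightarrow> False)"
| "cuts_to_simplices (Cut n s t) xs = (list_all (\<lambda>\<alpha>. affine n \<alpha> \<noteq> 0) xs \<and>
    cuts_to_simplices s (filter (\<lambda>\<alpha>. 0 < affine n \<alpha>) xs) \<and>
    cuts_to_simplices t (filter (\<lambda>\<alpha>. affine n \<alpha> < 0) xs))"

lemma set_split_affine:
  assumes "list_all (\<lambda>\<alpha>. affine n \<alpha> \<noteq> 0) xs"
  shows "set xs = {\<alpha> \<in> set xs. 0 < affine n \<alpha>} \<union> {\<alpha> \<in> set xs. affine n \<alpha> < 0}"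
  using assms by (auto simp: list_all_iff neq_iff)

lemma dominates_cut_tree:
  "cuts_to_simplices t xs \<Longrightarrow> dominates TYPE('a::{alg_closed_field, field_char_0}) (set xs) (leaves t)"
proof (induction t arbitrary: xs)
  case Leaf
  then show ?case using dominates_simplex by (auto split: list.splits)
next
  case (Cut n s t)
  obtain n0 n1 n2 n3 where n: "n = (n0, n1, n2, n3)" by (cases n)
  have l: "list_all (\<lambda>\<alpha>. affine n \<alpha> \<noteq> 0) xs" using Cut.prems by simp
  have "dominates TYPE('a) {\<alpha> \<in> set xs. 0 < affine n \<alpha>} (leaves s)"
    "dominates TYPE('a) {\<alpha> \<in> set xs. affine n \<alpha> < 0} (leaves t)"
    using Cut.prems Cut.IH(1)[of "filter (\<lambda>\<alpha>. 0 < affine n \<alpha>) xs"]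
      Cut.IH(2)[of "filter (\<lambda>\<alpha>. affine n \<alpha> < 0) xs"] by simp_all
  from cut.dominates_cut[OF cut_affine[OF n] this] show ?case
    unfolding set_split_affine[OF l, symmetric] by simp
qed

text \<open>After the cuts along \<open>us\<close>, the cell that remains is that of \<open>irrational_on_pair\<close>, with \<open>n\<close> as
  affine function; \<open>t\<close> cuts it into simplices. The result is the exponent \<open>e\<close>.\<close>

fun cuts_to_pair :: "int \<times> int \<times> int \<times> int \<Rightarrow> cut_tree \<Rightarrow> ((int \<times> int \<times> int \<times> int) \<times> cut_tree) list \<Rightarrow>
    expo list \<Rightarrow> expo option" where
  "cuts_to_pair n t [] xs = (if cuts_to_simplices t xs \<and> leaves t = 2 then
     (case filter (\<lambda>\<alpha>. affine n \<alpha> \<noteq> 0) xs of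
        [e, f] \<Rightarrow> if affine n e = 1 \<and> affine n f = - 1 then Some e else None
      | _ \<Rightarrow> None) else None)"
| "cuts_to_pair n t ((u, s) # us) xs = (if list_all (\<lambda>\<alpha>. affine u \<alpha> \<noteq> 0) xs \<and>
     cuts_to_simplices s (filter (\<lambda>\<alpha>. affine u \<alpha> < 0) xs)
     then cuts_to_pair n t us (filter (\<lambda>\<alpha>. 0 < affine u \<alpha>) xs) else None)"

lemma irrational_on_cuts_to_pair:
  "cuts_to_pair n t us xs = Some e \<Longrightarrow> e \<in> set xs \<and>
    irrational_on TYPE('a::{alg_closed_field, field_char_0}) (set xs)
      (2 + (\<Sum>(u, s)\<leftarrow>us. leaves s)) e"
proof (induction us arbitrary: xs)
  case Nil
  then obtain f where t: "cuts_to_simplices t xs" "leaves t = 2"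
    and ef: "filter (\<lambda>\<alpha>. affine n \<alpha> \<noteq> 0) xs = [e, f]" "affine n e = 1" "affine n f = - 1"
    by (auto split: if_splits list.splits)
  have set: "set (filter (\<lambda>\<alpha>. affine n \<alpha> \<noteq> 0) xs) = {e, f}" unfolding ef(1) by simp
  have "irrational_on TYPE('a) (set xs) 2 e"
    by (rule irrational_on_pair[of _ _ f n])
      (use set ef(2,3) dominates_cut_tree[OF t(1), where 'a = 'a] t(2) in auto)
  then show ?case using set by auto
next
  case (Cons us' us)
  obtain u s where us': "us' = (u, s)" by (cases us')
  obtain n0 n1 n2 n3 where u: "u = (n0, n1, n2, n3)" by (cases u)
  have l: "list_all (\<lambda>\<alpha>. affine u \<alpha> \<noteq> 0) xs"
    and s: "cuts_to_simplices s (filter (\<lambda>\<alpha>. affine u \<alpha> < 0) xs)"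
    and r: "cuts_to_pair n t us (filter (\<lambda>\<alpha>. 0 < affine u \<alpha>) xs) = Some e"
    using Cons.prems by (auto simp: us' split: if_splits)
  from Cons.IH[OF r] have e: "e \<in> {\<alpha> \<in> set xs. 0 < affine u \<alpha>}"
    and i: "irrational_on TYPE('a) {\<alpha> \<in> set xs. 0 < affine u \<alpha>} (2 + (\<Sum>(u, s)\<leftarrow>us. leaves s)) e"
    by auto
  have d: "dominates TYPE('a) {\<alpha> \<in> set xs. affine u \<alpha> < 0} (leaves s)"
    using dominates_cut_tree[OF s, where 'a = 'a] by simp
  have "irrational_on TYPE('a) (set xs) (2 + (\<Sum>(u, s)\<leftarrow>us. leaves s) + leaves s) e"
    using cut.irrational_cut[OF cut_affine[OF u] irrational_on_imp_dominates[OF i] d i e]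
    unfolding set_split_affine[OF l, symmetric] .
  then show ?case using e by (simp add: us' algebra_simps)
qed

subsection \<open>Boxes\<close>

text \<open>A renaming \<open>f\<close> of the exponents costs nothing if a change of parameters
  within each summand undoes it. Permutations of the three variables and translations are of this
  kind.\<close>

lemma dominates_reparametrize:
  assumes "dominates TYPE('a::field_char_0) S m" and g: "\<And>\<alpha>. \<alpha> \<in> S \<Longrightarrow> g (f \<alpha>) = \<alpha>"
    and q': "\<And>q :: nat \<times> nat \<Rightarrow> 'a. torus q \<Longrightarrow> \<exists>q'. torus q' \<and> (\<forall>i. \<forall>\<alpha>\<in>S. term_at q' i (f \<alpha>) = term_at q i \<alpha>)"
  shows "dominates TYPE('a) (f ` S) m"
  unfolding dominates_def
proof (intro allI impI)
  fix Q :: "(expo \<Rightarrow> 'a) \<Rightarrow> 'a" and T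
  assume Q: "polyfun (f ` S) Q" and 0: "\<forall>q. torus q \<longrightarrow> Q (terms_sum m q) = 0"
  have Q': "polyfun S (\<lambda>T. Q (\<lambda>\<alpha>. T (g \<alpha>)))"
    by (rule polyfun_subst[OF Q]) (auto simp: g intro: polyfun.var)
  have "Q (\<lambda>\<alpha>. terms_sum m q (g \<alpha>)) = 0" if q: "torus q" for q
  proof -
    obtain q' where q': "torus q'" "\<forall>i. \<forall>\<alpha>\<in>S. term_at q' i (f \<alpha>) = term_at q i \<alpha>" using q'[OF q] by blast
    have "Q (\<lambda>\<alpha>. terms_sum m q (g \<alpha>)) = Q (terms_sum m q')"
      by (rule polyfun_cong[OF Q]) (use q'(2) g in \<open>auto simp: terms_sum_def\<close>)
    then show ?thesis using 0 q'(1) by simp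
  qed
  then have "Q (\<lambda>\<alpha>. T (f (g \<alpha>))) = 0"
    using assms(1)[unfolded dominates_def, rule_format, OF Q', of "\<lambda>\<alpha>. T (f \<alpha>)"] by blast
  moreover have "Q (\<lambda>\<alpha>. T (f (g \<alpha>))) = Q T" by (rule polyfun_cong[OF Q]) (auto simp: g)
  ultimately show "Q T = 0" by simp
qed

lemma irrational_on_reparametrize:
  assumes "irrational_on TYPE('a::field_char_0) S m e" and g: "\<And>\<alpha>. \<alpha> \<in> S \<Longrightarrow> g (f \<alpha>) = \<alpha>" and e: "e \<in> S"
    and q': "\<And>q :: nat \<times> nat \<Rightarrow> 'a. torus q \<Longrightarrow> \<exists>q'. torus q' \<and> (\<forall>i. \<forall>\<alpha>\<in>S. term_at q' i (f \<alpha>) = term_at q i \<alpha>)"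
  shows "irrational_on TYPE('a) (f ` S) m (f e)"
  unfolding irrational_on_def
proof (intro allI impI)
  fix A B :: "(expo \<Rightarrow> 'a) \<Rightarrow> 'a" and T
  assume A: "polyfun (f ` S) A" and B: "polyfun (f ` S) B"
    and 0: "\<forall>q. torus q \<longrightarrow> A (terms_sum m q) * square_sum m (f e) q = B (terms_sum m q)"
  have A': "polyfun S (\<lambda>T. A (\<lambda>\<alpha>. T (g \<alpha>)))" and B': "polyfun S (\<lambda>T. B (\<lambda>\<alpha>. T (g \<alpha>)))"
    by (rule polyfun_subst[OF A] polyfun_subst[OF B]; auto simp: g intro: polyfun.var)+
  have "A (\<lambda>\<alpha>. terms_sum m q (g \<alpha>)) * square_sum m e q = B (\<lambda>\<alpha>. terms_sum m q (g \<alpha>))"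
    if q: "torus q" for q
  proof -
    obtain q' where q': "torus q'" "\<forall>i. \<forall>\<alpha>\<in>S. term_at q' i (f \<alpha>) = term_at q i \<alpha>" using q'[OF q] by blast
    have "A (\<lambda>\<alpha>. terms_sum m q (g \<alpha>)) = A (terms_sum m q')"
      by (rule polyfun_cong[OF A]) (use q'(2) g in \<open>auto simp: terms_sum_def\<close>)
    moreover have "B (\<lambda>\<alpha>. terms_sum m q (g \<alpha>)) = B (terms_sum m q')"
      by (rule polyfun_cong[OF B]) (use q'(2) g in \<open>auto simp: terms_sum_def\<close>)
    moreover have "square_sum m e q = square_sum m (f e) q'"
      using q'(2) e by (simp add: square_sum_def)
    ultimately show ?thesis using 0 q'(1) by simp
  qed
  then have "A (\<lambda>\<alpha>. T (f (g \<alpha>))) = 0"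
    using assms(1)[unfolded irrational_on_def, rule_format, OF A' B', of "\<lambda>\<alpha>. T (f \<alpha>)"] by blast
  moreover have "A (\<lambda>\<alpha>. T (f (g \<alpha>))) = A T" by (rule polyfun_cong[OF A]) (auto simp: g)
  ultimately show "A T = 0" by simp
qed

definition box :: "nat \<Rightarrow> nat \<Rightarrow> nat \<Rightarrow> expo set" where
  "box a b c = {..<a} \<times> {..<b} \<times> {..<c}"

lemma finite_box [simp]: "finite (box a b c)" and card_box: "card (box a b c) = a * b * c"
  by (simp_all add: box_def mult.assoc)

definition perfect_box where
  "perfect_box t a b c \<longleftrightarrow> 4 dvd a * b * c \<and> dominates t (box a b c) (a * b * c div 4)"

definition irrational_box where
  "irrational_box t a b c \<longleftrightarrow> 4 dvd a * b * c \<and>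
    (\<exists>e\<in>box a b c. irrational_on t (box a b c) (a * b * c div 4) e)"

section \<open>Symmetries, translations and unions of boxes\<close>

lemma reparametrize_swap12:
  "torus q \<Longrightarrow> \<exists>q'. torus q' \<and> (\<forall>i. \<forall>\<alpha>\<in>S. term_at q' i ((\<lambda>(a, b, c). (b, a, c)) \<alpha>) = term_at q i \<alpha>)"
  by (rule exI[of _ "\<lambda>(i, l). q (i, if l = 1 then 2 else if l = 2 then 1 else l)"])
    (auto simp: term_at_def algebra_simps)

lemma reparametrize_swap23:
  "torus q \<Longrightarrow> \<exists>q'. torus q' \<and> (\<forall>i. \<forall>\<alpha>\<in>S. term_at q' i ((\<lambda>(a, b, c). (a, c, b)) \<alpha>) = term_at q i \<alpha>)"
  by (rule exI[of _ "\<lambda>(i, l). q (i, if l = 2 then 3 else if l = 3 then 2 else l)"])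
    (auto simp: term_at_def algebra_simps)

text \<open>A translation of the exponents multiplies every term of a summand by the same power of
  its first coordinate, which is absorbed in the coefficient. This requires that coordinate to be
  nonzero.\<close>

lemma reparametrize_shift:
  fixes q :: "nat \<times> nat \<Rightarrow> 'a::field"
  assumes "torus q"
  shows "\<exists>q'. torus q' \<and> (\<forall>i. \<forall>\<alpha>\<in>S. term_at q' i ((\<lambda>(x, y, z). (d + x, y, z)) \<alpha>) = term_at q i \<alpha>)"
  by (rule exI[of _ "\<lambda>(i, l). if l = 0 then q (i, 0) / q (i, 1) ^ d else q (i, l)"])
    (use assms in \<open>auto simp: term_at_def power_add\<close>)

lemma box_swap12: "box b a c = (\<lambda>(a, b, c). (b, a, c)) ` box a b c"
  and box_swap23: "box a c b = (\<lambda>(a, b, c). (a, c, b)) ` box a b c"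
  by (auto simp: box_def image_iff)

lemma perfect_box_swap12: "perfect_box TYPE('a::field_char_0) a b c \<Longrightarrow> perfect_box TYPE('a) b a c"
  unfolding perfect_box_def box_swap12[of b a c]
  by (auto simp: mult.commute[of b a] intro!: reparametrize_swap12
      dominates_reparametrize[where g = "\<lambda>(a, b, c). (b, a, c)"])

lemma perfect_box_swap23: "perfect_box TYPE('a::field_char_0) a b c \<Longrightarrow> perfect_box TYPE('a) a c b"
  unfolding perfect_box_def box_swap23[of a c b]
  by (auto simp: mult.assoc mult.commute[of c b] intro!: reparametrize_swap23
      dominates_reparametrize[where g = "\<lambda>(a, b, c). (a, c, b)"])

lemma irrational_swap12:
  assumes "irrational_box TYPE('a::field_char_0) a b c"
  shows "irrational_box TYPE('a) b a c"
proof -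
  obtain e where e: "e \<in> box a b c" "irrational_on TYPE('a) (box a b c) (a * b * c div 4) e"
    using assms unfolding irrational_box_def by blast
  have "irrational_on TYPE('a) (box b a c) (a * b * c div 4) ((\<lambda>(a, b, c). (b, a, c)) e)"
    unfolding box_swap12[of b a c]
    by (rule irrational_on_reparametrize[OF e(2) _ e(1), where g = "(\<lambda>(a, b, c). (b, a, c))"])
      (simp split: prod.splits, erule reparametrize_swap12)
  moreover have "(\<lambda>(a, b, c). (b, a, c)) e \<in> box b a c" using e(1) by (auto simp: box_def)
  moreover have eq: "b * a * c = a * b * c" by simp
  ultimately show ?thesis using assms unfolding irrational_box_def eq by blast
qed

lemma irrational_swap23:
  assumes "irrational_box TYPE('a::field_char_0) a b c"
  shows "irrational_box TYPE('a) a c b"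
proof -
  obtain e where e: "e \<in> box a b c" "irrational_on TYPE('a) (box a b c) (a * b * c div 4) e"
    using assms unfolding irrational_box_def by blast
  have "irrational_on TYPE('a) (box a c b) (a * b * c div 4) ((\<lambda>(a, b, c). (a, c, b)) e)"
    unfolding box_swap23[of a c b]
    by (rule irrational_on_reparametrize[OF e(2) _ e(1), where g = "(\<lambda>(a, b, c). (a, c, b))"])
      (simp split: prod.splits, erule reparametrize_swap23)
  moreover have "(\<lambda>(a, b, c). (a, c, b)) e \<in> box a c b" using e(1) by (auto simp: box_def)
  moreover have eq: "a * c * b = a * b * c" by simp
  ultimately show ?thesis using assms unfolding irrational_box_def eq by blast
qed

text \<open>The cutting plane lies halfway between the layers \<open>a - 1\<close> and
  \<open>a\<close>; everything is doubled to keep the weights integral, so 1 + 2x is compared with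
  2a.\<close>

lemma cut_boxes:
  "cut (box a b c) ((\<lambda>(x, y, z). (a + x, y, z)) ` box d b c)
    (\<lambda>l. if l = 0 then 1 else if l = 1 then 2 else 0) (\<lambda>l. if l = 0 then 2 * a else 0)"
  by unfold_locales (auto simp: box_def weight_def)

lemma box_add: "box (a + d) b c = box a b c \<union> (\<lambda>(x, y, z). (a + x, y, z)) ` box d b c"
proof (intro equalityI subsetI)
  fix \<alpha> assume \<alpha>: "\<alpha> \<in> box (a + d) b c"
  obtain x y z where xyz: "\<alpha> = (x, y, z)" by (cases \<alpha>)
  show "\<alpha> \<in> box a b c \<union> (\<lambda>(x, y, z). (a + x, y, z)) ` box d b c"
  proof (cases "x < a")
    case False
    then have "\<alpha> = (\<lambda>(x, y, z). (a + x, y, z)) (x - a, y, z)" "(x - a, y, z) \<in> box d b c"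
      using \<alpha> by (auto simp: xyz box_def)
    then show ?thesis by blast
  qed (use \<alpha> in \<open>auto simp: xyz box_def\<close>)
qed (auto simp: box_def)

lemma dominates_shift:
  "dominates TYPE('a::field_char_0) (box d b c) m \<Longrightarrow>
    dominates TYPE('a) ((\<lambda>(x, y, z). (a + x, y, z)) ` box d b c) m"
  by (rule dominates_reparametrize[where g = "\<lambda>(x, y, z). (x - a, y, z)"])
    (auto simp only: split_paired_all prod.case diff_add_inverse intro!: reparametrize_shift)

lemma perfect_box_add:
  assumes "perfect_box TYPE('a::field_char_0) a b c" "perfect_box TYPE('a) d b c"
  shows "perfect_box TYPE('a) (a + d) b c"
  using cut.dominates_cut[OF cut_boxes _ dominates_shift, of a b c] assms
  unfolding perfect_box_def box_add by (auto simp: add_mult_distrib div_plus_div_distrib_dvd_left)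

lemma irrational_box_add:
  assumes "irrational_box TYPE('a::field_char_0) a b c" "perfect_box TYPE('a) d b c"
  shows "irrational_box TYPE('a) (a + d) b c"
proof -
  obtain e where e: "e \<in> box a b c" "irrational_on TYPE('a) (box a b c) (a * b * c div 4) e"
    using assms(1) unfolding irrational_box_def by blast
  show ?thesis
    using cut.irrational_cut[OF cut_boxes irrational_on_imp_dominates[OF e(2)] dominates_shift e(2,1)]
      e(1) assms
    unfolding perfect_box_def irrational_box_def box_add
    by (auto simp: add_mult_distrib div_plus_div_distrib_dvd_left)
qed

definition box_list :: "nat \<Rightarrow> nat \<Rightarrow> nat \<Rightarrow> expo list" where
  "box_list a b c = List.product [0..<a] (List.product [0..<b] [0..<c])"

lemma set_box_list: "set (box_list a b c) = box a b c"
  by (auto simp: box_list_def box_def)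

lemma perfect_box_cut_tree:
  "cuts_to_simplices t (box_list a b c) \<Longrightarrow> 4 * leaves t = a * b * c \<Longrightarrow>
    perfect_box TYPE('a::{alg_closed_field, field_char_0}) a b c"
  using dominates_cut_tree[of t "box_list a b c", where 'a = 'a]
  unfolding perfect_box_def set_box_list by (metis dvd_triv_left nonzero_mult_div_cancel_left zero_neq_numeral)

lemma irrational_box_cuts_to_pair:
  "cuts_to_pair n t us (box_list a b c) = Some e \<Longrightarrow> 4 * (2 + (\<Sum>(u, s)\<leftarrow>us. leaves s)) = a * b * c \<Longrightarrow>
    irrational_box TYPE('a::{alg_closed_field, field_char_0}) a b c"
  using irrational_on_cuts_to_pair[of n t us "box_list a b c" e, where 'a = 'a]
  unfolding irrational_box_def set_box_list
  by (metis dvd_triv_left nonzero_mult_div_cancel_left zero_neq_numeral)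

text \<open>The following cuts were found by a computer search.\<close>

lemma perfect_box_222: "perfect_box TYPE('a::{alg_closed_field, field_char_0}) 2 2 2"
  by (rule perfect_box_cut_tree[of "Cut (5, -4, -4, -2) Leaf Leaf"]) code_simp+

lemma perfect_box_423: "perfect_box TYPE('a::{alg_closed_field, field_char_0}) 4 2 3"
  by (rule perfect_box_cut_tree[of "Cut (7, -6, -6, -4) Leaf (Cut (9, -6, -4, -2) Leaf
      (Cut (17, -6, -4, -6) Leaf (Cut (17, -6, -6, -2) Leaf (Cut (25, -6, -6, -4) Leaf Leaf))))"])
    code_simp+

lemma perfect_box_623: "perfect_box TYPE('a::{alg_closed_field, field_char_0}) 6 2 3"
  by (rule perfect_box_cut_tree[of "Cut (7, -6, -6, -4) Leaf (Cut (9, -6, -4, -2) Leaf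
      (Cut (17, -6, -4, -6) Leaf (Cut (17, -6, -6, -2) Leaf (Cut (23, -6, -4, -4) Leaf
      (Cut (27, -6, -4, -4) Leaf (Cut (29, -6, -4, -2) Leaf (Cut (37, -6, -6, -4) Leaf Leaf)))))))"])
    code_simp+

lemma perfect_box_433: "perfect_box TYPE('a::{alg_closed_field, field_char_0}) 4 3 3"
  by (rule perfect_box_cut_tree[of "Cut (7, -6, -6, -4) Leaf (Cut (3, -6, -4, 2) Leaf
      (Cut (11, -6, -4, -2) Leaf (Cut (17, -6, -4, -6) Leaf (Cut (11, -6, -2, 0) Leaf
      (Cut (15, -6, -6, 2) Leaf (Cut (23, -6, -4, -6) Leaf (Cut (31, -6, -6, -4) Leaf Leaf)))))))"])
    code_simp+

lemma irrational_box_442: "irrational_box TYPE('a::{alg_closed_field, field_char_0}) 4 4 2"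
proof (rule irrational_box_cuts_to_pair)
  \<comment> \<open>The cell that is kept has six exponents whose first two entries add up to 3; the
    other two are (2, 0, 1) and (2, 2, 1).\<close>
  show "cuts_to_pair (3, -1, -1, 0) (Cut (21, -8, -6, 0) Leaf Leaf)
    [((-9, 8, 8, 6), Leaf), ((-13, 8, 6, 0), Leaf), ((-19, 8, 6, 4), Leaf), ((9, -2, -2, 2), Leaf),
     ((13, -2, -4, 0), Leaf), ((11, -4, -2, 2), Leaf)] (box_list 4 4 2) = Some (2, 0, 1)"
    by code_simp
qed simp

lemma irrational_box_433: "irrational_box TYPE('a::{alg_closed_field, field_char_0}) 4 3 3"
proof (rule irrational_box_cuts_to_pair)
  \<comment> \<open>The cell that is kept has six exponents whose last two entries agree; the other
    two are (3, 1, 2) and (3, 2, 1).\<close>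
  show "cuts_to_pair (0, 0, -1, 1) (Cut (23, -6, -8, 2) Leaf Leaf)
    [((-9, 8, 8, 6), Leaf), ((-11, 8, 6, 2), Leaf), ((-15, 8, 6, 2), Leaf), ((-11, 6, -2, 8), Leaf),
     ((-3, 4, 8, -6), Leaf), ((-5, 2, -4, 8), Leaf), ((-9, 2, 8, -2), Leaf)] (box_list 4 3 3) =
    Some (3, 1, 2)"
    by code_simp
qed simp

section \<open>Assembling large boxes from small ones\<close>

lemma perfect_box_0: "perfect_box TYPE('a::field_char_0) 0 b c"
proof -
  have "Q T = 0" if "polyfun {} Q" "\<forall>q. torus q \<longrightarrow> Q (terms_sum 0 q) = 0"
    for Q :: "(expo \<Rightarrow> 'a) \<Rightarrow> 'a" and T
  proof -
    have "Q T = Q (terms_sum 0 (\<lambda>_. 1))" by (rule polyfun_cong[OF that(1)]) simp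
    then show ?thesis using that(2)[THEN spec, of "\<lambda>_. 1"] by simp
  qed
  then show ?thesis unfolding perfect_box_def dominates_def by (simp add: box_def)
qed

lemma perfect_box_mult: "perfect_box TYPE('a::field_char_0) a b c \<Longrightarrow> perfect_box TYPE('a) (a * i) b c"
proof (induction i)
  case (Suc i)
  then show ?case using perfect_box_add[of a b c "a * i", where 'a = 'a] by simp
qed (simp add: perfect_box_0)

lemma perfect_box_add2:
  "perfect_box TYPE('a::field_char_0) a b c \<Longrightarrow> perfect_box TYPE('a) a d c \<Longrightarrow>
    perfect_box TYPE('a) a (b + d) c"
  by (rule perfect_box_swap12, rule perfect_box_add) (rule perfect_box_swap12, assumption)+

lemma perfect_box_mult2:
  "perfect_box TYPE('a::field_char_0) a b c \<Longrightarrow> perfect_box TYPE('a) a (b * i) c"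
  by (rule perfect_box_swap12, rule perfect_box_mult, rule perfect_box_swap12)

lemma perfect_box_add3:
  "perfect_box TYPE('a::field_char_0) a b c \<Longrightarrow> perfect_box TYPE('a) a b d \<Longrightarrow>
    perfect_box TYPE('a) a b (c + d)"
  by (rule perfect_box_swap23, rule perfect_box_add2) (rule perfect_box_swap23, assumption)+

lemma perfect_box_mult3:
  "perfect_box TYPE('a::field_char_0) a b c \<Longrightarrow> perfect_box TYPE('a) a b (c * i)"
  by (rule perfect_box_swap23, rule perfect_box_mult2, rule perfect_box_swap23)

lemma irrational_box_add2:
  "irrational_box TYPE('a::field_char_0) a b c \<Longrightarrow> perfect_box TYPE('a) a d c \<Longrightarrow>
    irrational_box TYPE('a) a (b + d) c"
  by (rule irrational_swap12, rule irrational_box_add, erule irrational_swap12, erule perfect_box_swap12)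

lemma irrational_box_add3:
  "irrational_box TYPE('a::field_char_0) a b c \<Longrightarrow> perfect_box TYPE('a) a b d \<Longrightarrow>
    irrational_box TYPE('a) a b (c + d)"
  by (rule irrational_swap23, rule irrational_box_add2, erule irrational_swap23, erule perfect_box_swap23)

lemma perfect_box_even: "perfect_box TYPE('a::{alg_closed_field, field_char_0}) (2 * i) (2 * j) (2 * l)"
  by (intro perfect_box_mult perfect_box_mult2 perfect_box_mult3 perfect_box_222)

text \<open>If \<open>c\<close> is odd, a slab of thickness 3 is split off. Its first side is a sum
  of pieces of length 4 and at most one of length 6, which is why \<open>i\<close> starts at
  2.\<close>

lemma perfect_box_even_even:
  assumes "i \<ge> 2" "c \<ge> 2"
  shows "perfect_box TYPE('a::{alg_closed_field, field_char_0}) (2 * i) (2 * j) c"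
proof (cases "even c")
  case True
  then show ?thesis using perfect_box_even[of i j "c div 2"] by simp
next
  case False
  have 4: "perfect_box TYPE('a) (4 * h) 2 3" for h by (intro perfect_box_mult perfect_box_423)
  have "perfect_box TYPE('a) (2 * i) 2 3"
  proof (cases "even i")
    case True
    then obtain h where "i = 2 * h" by (elim evenE)
    then show ?thesis using 4[of h] by simp
  next
    case False
    then have "2 * i = 6 + 4 * ((i - 3) div 2)" using \<open>i \<ge> 2\<close> by presburger
    then show ?thesis using perfect_box_add[OF perfect_box_623 4] by simp
  qed
  from perfect_box_mult2[OF this] have 3: "perfect_box TYPE('a) (2 * i) (2 * j) 3" .
  have "c = 3 + 2 * ((c - 3) div 2)" using False assms by presburger
  then show ?thesis using perfect_box_add3[OF 3 perfect_box_even] by metis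
qed

lemma irrational_box_even_even:
  assumes "i \<ge> 2" "j \<ge> 2" "c \<ge> 4"
  shows "irrational_box TYPE('a::{alg_closed_field, field_char_0}) (2 * i) (2 * j) c"
proof -
  have eqs: "2 * i = 4 + 2 * (i - 2)" "2 * j = 4 + 2 * (j - 2)" "c = 2 + (c - 2)" using assms by auto
  have "irrational_box TYPE('a) (2 * i) 4 2"
    by (subst eqs(1), rule irrational_box_add[OF irrational_box_442])
      (use perfect_box_even[of "i - 2" 2 1, where 'a = 'a] in simp)
  then have "irrational_box TYPE('a) (2 * i) (2 * j) 2"
    by (subst eqs(2), elim irrational_box_add2)
      (use perfect_box_even[of i "j - 2" 1, where 'a = 'a] in simp)
  then show ?thesis
    by (subst eqs(3), elim irrational_box_add3)
      (use perfect_box_even_even[of i "c - 2" j, where 'a = 'a] assms in simp)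
qed

lemma irrational_box_4:
  assumes "i \<ge> 1" "odd b" "odd c" "b \<ge> 3" "c \<ge> 3"
  shows "irrational_box TYPE('a::{alg_closed_field, field_char_0}) (4 * i) b c"
proof -
  have eqs: "4 * i = 4 + 4 * (i - 1)" "b = 3 + 2 * ((b - 3) div 2)" "c = 3 + 2 * ((c - 3) div 2)"
    using assms by presburger+
  have "irrational_box TYPE('a) (4 * i) 3 3"
    by (subst eqs(1), rule irrational_box_add[OF irrational_box_433])
      (intro perfect_box_mult perfect_box_433)
  moreover have "perfect_box TYPE('a) (4 * i) (2 * ((b - 3) div 2)) 3"
    using perfect_box_even_even[of "2 * i" 3 "(b - 3) div 2", where 'a = 'a] assms(1) by simp
  ultimately have "irrational_box TYPE('a) (4 * i) b 3"
    using irrational_box_add2 eqs(2) by metis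
  moreover have "perfect_box TYPE('a) (4 * i) b (2 * ((c - 3) div 2))"
    using perfect_box_swap23[OF perfect_box_even_even[of "2 * i" b "(c - 3) div 2", where 'a = 'a]] assms(1,4) by simp
  ultimately show ?thesis using irrational_box_add3 eqs(3) by metis
qed

text \<open>Two even sides lead to the block 4 x 4 x 2. With a single even side, that side absorbs
  the factor 4 and the block is 4 x 3 x 3.\<close>

theorem irrational_box:
  assumes "a \<ge> 4" "b \<ge> 4" "c \<ge> 4" "4 dvd a * b * c"
  shows "irrational_box TYPE('a::{alg_closed_field, field_char_0}) a b c"
proof -
  have ee: "irrational_box TYPE('a) x y z" if "even x" "even y" "x \<ge> 4" "y \<ge> 4" "z \<ge> 4" for x y z
    using irrational_box_even_even[of "x div 2" "y div 2" z, where 'a = 'a] that by auto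
  have four: "irrational_box TYPE('a) x y z" if "4 dvd x" "odd y" "odd z" "x \<ge> 4" "y \<ge> 4" "z \<ge> 4" for x y z
    using irrational_box_4[of "x div 4" y z, where 'a = 'a] that by auto
  have dvd: "4 dvd x" if "4 dvd x * y" "odd y" for x y :: nat
  proof -
    have "coprime 4 y" using that(2) coprime_power_left_iff[of 2 2 y] by simp
    then show ?thesis using that(1) by (simp add: coprime_dvd_mult_left_iff)
  qed
  consider "even a" "even b" | "even a" "even c" | "even b" "even c" | "even a" "odd b" "odd c"
    | "odd a" "even b" "odd c" | "odd a" "odd b" "even c" | "odd a" "odd b" "odd c" by blast
  then show ?thesis
  proof cases
    case 1
    then show ?thesis using ee assms by blast
  next
    case 2
    then show ?thesis using irrational_swap23[OF ee] assms by blast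
  next
    case 3
    then show ?thesis using irrational_swap12[OF irrational_swap23[OF ee]] assms by blast
  next
    case 4
    then have "4 dvd a" using dvd[of a "b * c"] assms(4) by (simp add: mult.assoc)
    then show ?thesis using four 4 assms by blast
  next
    case 5
    then have "4 dvd b" using dvd[of b "a * c"] assms(4) by (simp add: mult.left_commute mult.assoc)
    then show ?thesis using irrational_swap12[OF four] 5 assms by blast
  next
    case 6
    then have "4 dvd c" using dvd[of c "a * b"] assms(4) by (simp add: mult.commute)
    then show ?thesis using irrational_swap23[OF irrational_swap12[OF four]] 6 assms by blast
  next
    case 7
    then have "odd (a * b * c)" by simp
    moreover have "even (a * b * c)" using assms(4) by (rule dvd_trans[rotated]) simp
    ultimately show ?thesis by blast
  qed
qed

section \<open>General sums of monomials\<close>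

definition points :: "nat \<Rightarrow> (nat \<times> nat \<Rightarrow> 'a) \<Rightarrow> ('a \<times> 'a \<times> 'a \<times> 'a) multiset" where
  "points m q = image_mset (\<lambda>i. (q (i, 0), q (i, 1), q (i, 2), q (i, 3))) (mset_set {..<m})"

text \<open>Equality of unordered decompositions becomes a finite disjunction over permutations,
  hence a definable condition on the parameters.\<close>

lemma points_eq_iff:
  "points m q = points m r \<longleftrightarrow> (\<exists>\<pi>\<in>{\<pi>. \<pi> permutes {..<m}}. \<forall>i\<in>{..<m}. \<forall>l\<in>{..<4}. q (i, l) = r (\<pi> i, l))"
proof -
  have 4: "(\<forall>l\<in>{..<4}. q (i, l) = r (j, l)) \<longleftrightarrow>
      (q (i, 0), q (i, 1), q (i, 2), q (i, 3)) = (r (j, 0), r (j, 1), r (j, 2), r (j, 3))" for i j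
    by (auto simp: less_Suc_eq numeral_eq_Suc)
  show ?thesis
  proof
    assume "points m q = points m r"
    then obtain \<pi> where "\<pi> permutes {..<m}" "\<And>i. i \<in> {..<m} \<Longrightarrow>
      (q (i, 0), q (i, 1), q (i, 2), q (i, 3)) = (r (\<pi> i, 0), r (\<pi> i, 1), r (\<pi> i, 2), r (\<pi> i, 3))"
      unfolding points_def by (rule image_mset_eq_implies_permutes[rotated]) simp_all
    then show "\<exists>\<pi>\<in>{\<pi>. \<pi> permutes {..<m}}. \<forall>i\<in>{..<m}. \<forall>l\<in>{..<4}. q (i, l) = r (\<pi> i, l)"
      unfolding 4 by blast
  next
    assume "\<exists>\<pi>\<in>{\<pi>. \<pi> permutes {..<m}}. \<forall>i\<in>{..<m}. \<forall>l\<in>{..<4}. q (i, l) = r (\<pi> i, l)"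
    then obtain \<pi> where \<pi>: "\<pi> permutes {..<m}" "\<And>i. i < m \<Longrightarrow>
      (q (i, 0), q (i, 1), q (i, 2), q (i, 3)) = (r (\<pi> i, 0), r (\<pi> i, 1), r (\<pi> i, 2), r (\<pi> i, 3))"
      unfolding 4 by blast
    have "points m q = image_mset (\<lambda>i. (r (i, 0), r (i, 1), r (i, 2), r (i, 3))) (image_mset \<pi> (mset_set {..<m}))"
      unfolding points_def image_mset.compositionality by (rule image_mset_cong) (use \<pi>(2) in auto)
    also have "image_mset \<pi> (mset_set {..<m}) = mset_set {..<m}"
      using \<pi>(1) by (simp add: image_mset_mset_set permutes_inj_on permutes_image)
    finally show "points m q = points m r" by (simp add: points_def)
  qed
qed

definition point_term :: "'a::comm_ring_1 \<times> 'a \<times> 'a \<times> 'a \<Rightarrow> expo \<Rightarrow> 'a" where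
  "point_term = (\<lambda>(w, x, y, z) (\<alpha>, \<beta>, \<gamma>). w * x ^ \<alpha> * y ^ \<beta> * z ^ \<gamma>)"

lemma term_at_eq_point_term: "term_at q i \<alpha> = point_term (q (i, 0), q (i, 1), q (i, 2), q (i, 3)) \<alpha>"
  by (simp add: term_at_def point_term_def split: prod.split)

lemma sum_points: "(\<Sum>p\<in>#points m q. f p) = (\<Sum>i<m. f (q (i, 0), q (i, 1), q (i, 2), q (i, 3)))"
  by (simp add: points_def image_mset.compositionality comp_def sum_unfold_sum_mset)

lemma square_sum_points: "square_sum m \<alpha> q = (\<Sum>p\<in>#points m q. (point_term p \<alpha>)\<^sup>2)"
  by (simp add: sum_points square_sum_def term_at_eq_point_term)

text \<open>Coordinates of a summand some of whose three points on the projective line may be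
  the point at infinity, as indicated by \<open>\<sigma>\<close>.\<close>

definition chart_power :: "bool \<Rightarrow> 'a::comm_ring_1 \<Rightarrow> nat \<Rightarrow> nat \<Rightarrow> 'a" where
  "chart_power s x d \<alpha> = (if s then (if \<alpha> = d then 1 else 0) else x ^ \<alpha>)"

definition chart_term :: "nat \<Rightarrow> nat \<Rightarrow> nat \<Rightarrow> (nat \<times> nat \<Rightarrow> bool) \<Rightarrow> (nat \<times> nat \<Rightarrow> 'a::comm_ring_1) \<Rightarrow> nat \<Rightarrow> expo \<Rightarrow> 'a" where
  "chart_term d1 d2 d3 \<sigma> q i = (\<lambda>(\<alpha>, \<beta>, \<gamma>). q (i, 0) * chart_power (\<sigma> (i, 1)) (q (i, 1)) d1 \<alpha> *
    chart_power (\<sigma> (i, 2)) (q (i, 2)) d2 \<beta> * chart_power (\<sigma> (i, 3)) (q (i, 3)) d3 \<gamma>)"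

lemma polyfun_chart_power: "(\<not> s \<Longrightarrow> j \<in> V) \<Longrightarrow> polyfun V (\<lambda>q. chart_power s (q j) d \<alpha>)"
  unfolding chart_power_def by (cases s) (auto intro: polyfun_intros)

text \<open>A coordinate at infinity is one parameter less, so for each of the finitely many choices
  of coordinates at infinity the sums satisfy a nontrivial polynomial relation.\<close>

lemma generic_no_infinity:
  fixes K :: "expo set"
  assumes K: "finite K" and card: "4 * m \<le> card K"
  obtains Q :: "(expo \<Rightarrow> 'a::field_char_0) \<Rightarrow> 'a" where "polyfun K Q" "\<exists>T. Q T \<noteq> 0"
    "\<And>T \<sigma> q i l. Q T \<noteq> 0 \<Longrightarrow> (\<And>k. k \<in> K \<Longrightarrow> (\<Sum>i<m. chart_term d1 d2 d3 \<sigma> q i k) = T k) \<Longrightarrow>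
      i < m \<Longrightarrow> l \<in> {1, 2, 3} \<Longrightarrow> \<not> \<sigma> (i, l)"
proof -
  let ?J = "{..<m} \<times> {..<4::nat}"
  define \<Sigma> where "\<Sigma> = {\<sigma> \<in> PiE ({..<m} \<times> {1, 2, 3 :: nat}) (\<lambda>_. UNIV :: bool set). \<exists>i<m. \<exists>l\<in>{1, 2, 3}. \<sigma> (i, l)}"
  have fin: "finite \<Sigma>" unfolding \<Sigma>_def
    by (rule finite_subset[OF _ finite_PiE[of "{..<m} \<times> {1, 2, 3 :: nat}" "\<lambda>_. UNIV :: bool set"]]) auto
  have "\<forall>\<sigma>\<in>\<Sigma>. \<exists>Q. polyfun K Q \<and> (\<exists>T. Q T \<noteq> 0) \<and>
    (\<forall>q :: nat \<times> nat \<Rightarrow> 'a. Q (\<lambda>k. \<Sum>i<m. chart_term d1 d2 d3 \<sigma> q i k) = 0)"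
  proof
    fix \<sigma> assume "\<sigma> \<in> \<Sigma>"
    then obtain i l where il: "i < m" "l \<in> {1, 2, 3}" "\<sigma> (i, l)" unfolding \<Sigma>_def by blast
    let ?J' = "?J - {(i, l)}"
    have "(i, l) \<in> ?J" using il by auto
    then have "card ?J' < card ?J" by (intro psubset_card_mono) auto
    then have c: "card ?J' < card K" using card by simp
    have p: "polyfun ?J' (\<lambda>q :: _ \<Rightarrow> 'a. \<Sum>i<m. chart_term d1 d2 d3 \<sigma> q i k)" for k
      unfolding chart_term_def case_prod_beta
      by (intro polyfun_sum polyfun.mult polyfun.var polyfun_chart_power) (use il in auto)
    obtain Q :: "(expo \<Rightarrow> 'a) \<Rightarrow> 'a" where "polyfun K Q" "\<exists>T. Q T \<noteq> 0"
      "\<And>q. Q (\<lambda>k. (\<lambda>k q. \<Sum>i<m. chart_term d1 d2 d3 \<sigma> q i k) k q) = 0"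
      by (rule algebraic_dependence[where F = "\<lambda>k q. \<Sum>i<m. chart_term d1 d2 d3 \<sigma> q i k", OF _ K c p]) auto
    then show "\<exists>Q. polyfun K Q \<and> (\<exists>T. Q T \<noteq> 0) \<and>
      (\<forall>q :: nat \<times> nat \<Rightarrow> 'a. Q (\<lambda>k. \<Sum>i<m. chart_term d1 d2 d3 \<sigma> q i k) = 0)" by blast
  qed
  from bchoice[OF this] obtain Q where Q: "\<And>\<sigma>. \<sigma> \<in> \<Sigma> \<Longrightarrow> polyfun K (Q \<sigma>)"
    "\<And>\<sigma>. \<sigma> \<in> \<Sigma> \<Longrightarrow> \<exists>T. Q \<sigma> T \<noteq> 0"
    "\<And>\<sigma> q :: nat \<times> nat \<Rightarrow> 'a. \<sigma> \<in> \<Sigma> \<Longrightarrow> Q \<sigma> (\<lambda>k. \<Sum>i<m. chart_term d1 d2 d3 \<sigma> q i k) = 0" by blast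
  show ?thesis
  proof (rule that[of "\<lambda>T. \<Prod>\<sigma>\<in>\<Sigma>. Q \<sigma> T"])
    fix T \<sigma> and i l :: nat and q :: "nat \<times> nat \<Rightarrow> 'a"
    assume nz: "(\<Prod>\<sigma>\<in>\<Sigma>. Q \<sigma> T) \<noteq> 0" and T: "\<And>k. k \<in> K \<Longrightarrow> (\<Sum>i<m. chart_term d1 d2 d3 \<sigma> q i k) = T k"
      and il: "i < m" "l \<in> {1, 2, 3}"
    show "\<not> \<sigma> (i, l)"
    proof
      assume inf: "\<sigma> (i, l)"
      let ?\<sigma> = "restrict \<sigma> ({..<m} \<times> {1, 2, 3})"
      have \<Sigma>: "?\<sigma> \<in> \<Sigma>" unfolding \<Sigma>_def using inf il by auto
      have "Q ?\<sigma> T = Q ?\<sigma> (\<lambda>k. \<Sum>i<m. chart_term d1 d2 d3 ?\<sigma> q i k)"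
      proof (rule polyfun_cong[OF Q(1)[OF \<Sigma>]])
        fix k assume "k \<in> K"
        then show "T k = (\<Sum>i<m. chart_term d1 d2 d3 ?\<sigma> q i k)"
          by (subst T[symmetric]) (auto simp: chart_term_def intro!: sum.cong)
      qed
      also have "\<dots> = 0" by (rule Q(3)[OF \<Sigma>])
      finally show False using nz fin \<Sigma> by (simp add: prod_zero_iff)
    qed
  next
    show "polyfun K (\<lambda>T. \<Prod>\<sigma>\<in>\<Sigma>. Q \<sigma> T)" by (rule polyfun_prod) (rule Q(1))
    show "\<exists>T. (\<Prod>\<sigma>\<in>\<Sigma>. Q \<sigma> T) \<noteq> 0" by (rule polyfun_nonzero_prod[OF fin Q(1,2)])
  qed
qed

subsection \<open>Separating the points by forms of lower degree\<close>

definition form_value :: "expo set \<Rightarrow> (expo \<Rightarrow> 'a::comm_ring_1) \<Rightarrow> 'a \<times> 'a \<times> 'a \<Rightarrow> 'a" where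
  "form_value M g = (\<lambda>(x, y, z). \<Sum>\<beta>\<in>M. g \<beta> * point_term (1, x, y, z) \<beta>)"

text \<open>Required for all \<open>j < m\<close>, this is the triangular form of the statement that
  the points impose independent conditions on forms with exponents in \<open>M\<close>.\<close>

definition separated :: "expo set \<Rightarrow> nat \<Rightarrow> (nat \<times> nat \<Rightarrow> 'a::comm_ring_1) \<Rightarrow> bool" where
  "separated M j q \<longleftrightarrow> (\<exists>g. (\<forall>i<j. form_value M g (q (i, 1), q (i, 2), q (i, 3)) = 0) \<and>
    form_value M g (q (j, 1), q (j, 2), q (j, 3)) \<noteq> 0)"

lemma power_sums_eq_0:
  fixes c :: "nat \<Rightarrow> 'a::field_char_0"
  assumes "\<And>t. (\<Sum>n<N. c n * t ^ n) = 0" "n < N"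
  shows "c n = 0"
proof -
  have "poly (\<Sum>n<N. monom (c n) n) t = 0" for t using assms(1)[of t] by (simp add: poly_sum poly_monom)
  then have "(\<Sum>n<N. monom (c n) n) = 0" using poly_all_0_iff_0 by blast
  then have "coeff (\<Sum>n<N. monom (c n) n) n = 0" by simp
  then show ?thesis using assms(2) by (simp add: coeff_sum)
qed

lemma form_value_eq_0:
  fixes g :: "expo \<Rightarrow> 'a::field_char_0"
  assumes "\<And>p. form_value (box a b c) g p = 0" "\<beta> \<in> box a b c"
  shows "g \<beta> = 0"
proof -
  obtain i j l where \<beta>: "\<beta> = (i, j, l)" "i < a" "j < b" "l < c" using assms(2) by (auto simp: box_def)
  have "(\<Sum>n<c. (\<Sum>r<b. (\<Sum>s<a. g (s, r, n) * x ^ s) * y ^ r) * z ^ n) = 0" for x y z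
  proof -
    have "form_value (box a b c) g (x, y, z) = (\<Sum>s<a. \<Sum>r<b. \<Sum>n<c. g (s, r, n) * (x ^ s * y ^ r * z ^ n))"
      unfolding form_value_def box_def by (simp add: sum.cartesian_product point_term_def case_prod_unfold)
    also have "\<dots> = (\<Sum>s<a. \<Sum>n<c. \<Sum>r<b. g (s, r, n) * (x ^ s * y ^ r * z ^ n))"
      by (intro sum.cong refl sum.swap)
    also have "\<dots> = (\<Sum>n<c. \<Sum>s<a. \<Sum>r<b. g (s, r, n) * (x ^ s * y ^ r * z ^ n))" by (rule sum.swap)
    also have "\<dots> = (\<Sum>n<c. \<Sum>r<b. \<Sum>s<a. g (s, r, n) * (x ^ s * y ^ r * z ^ n))"
      by (intro sum.cong refl sum.swap)
    finally show ?thesis using assms(1) by (simp add: sum_distrib_right mult.assoc)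
  qed
  from power_sums_eq_0[OF this \<beta>(4)] have "(\<Sum>r<b. (\<Sum>s<a. g (s, r, l) * x ^ s) * y ^ r) = 0" for x y .
  from power_sums_eq_0[OF this \<beta>(3)] have "(\<Sum>s<a. g (s, j, l) * x ^ s) = 0" for x .
  from power_sums_eq_0[OF this \<beta>(2)] show ?thesis by (simp add: \<beta>(1))
qed

text \<open>The condition is definable, so it suffices to meet it once outside the zeros of
  \<open>h\<close>. Fewer conditions than coefficients leave a nonzero form through the first
  \<open>j\<close> points, and the next point is moved off its zeros.\<close>

lemma generic_separated:
  assumes j: "j < a * b * c" and J: "finite J" "\<And>i l. i \<le> j \<Longrightarrow> l < 4 \<Longrightarrow> (i, l) \<in> J"
  obtains h :: "(nat \<times> nat \<Rightarrow> 'a::{alg_closed_field, field_char_0}) \<Rightarrow> 'a" where "polyfun J h"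
    "\<exists>q. h q \<noteq> 0" "\<And>q. h q \<noteq> 0 \<Longrightarrow> separated (box a b c) j q"
proof -
  let ?M = "box a b c"
  have pt: "polyfun V (\<lambda>e. point_term (1, e u1, e u2, e u3) \<beta>)" if "{u1, u2, u3} \<subseteq> V" for V u1 u2 u3 \<beta>
    using that unfolding point_term_def case_prod_beta by (auto intro!: polyfun_intros)
  let ?val = "\<lambda>e i. form_value ?M (e \<circ> Inr) (e (Inl (i, 1)), e (Inl (i, 2)), e (Inl (i, 3)))"
  have v: "polyfun (Inl ` J \<union> Inr ` ?M) (\<lambda>e. ?val e i)" if "i \<le> j" for i
    unfolding form_value_def prod.case
    by (intro polyfun_sum polyfun.mult pt) (use J(2)[OF that] in \<open>auto intro: polyfun.var\<close>)
  define R where "R e \<longleftrightarrow> (\<forall>i\<in>{..<j}. ?val e i = 0) \<and> \<not> ?val e j = 0"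
    for e :: "nat \<times> nat + expo \<Rightarrow> 'a"
  have "definable (Inl ` J \<union> Inr ` ?M) R" unfolding R_def[abs_def]
    by (intro definable_conj definable_ball definable_not definable_eq_0 v) auto
  from definable_ex[OF _ this] have "definable J (\<lambda>q. \<exists>g. R (case_sum q g))" by simp
  moreover have "(\<exists>g. R (case_sum q g)) \<longleftrightarrow> separated ?M j q" for q
    by (auto simp: separated_def comp_def R_def)
  ultimately have "definable J (separated ?M j :: (nat \<times> nat \<Rightarrow> 'a) \<Rightarrow> bool)" by simp
  then obtain h :: "(nat \<times> nat \<Rightarrow> 'a) \<Rightarrow> 'a" where h: "polyfun J h" "\<exists>q. h q \<noteq> 0"
    "(\<forall>q. h q \<noteq> 0 \<longrightarrow> separated ?M j q) \<or> (\<forall>q. h q \<noteq> 0 \<longrightarrow> \<not> separated ?M j q)" by (rule definable_generic)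
  obtain q0 where q0: "h q0 \<noteq> 0" using h(2) by blast
  have "card {..<j} < card ?M" using j by (simp add: card_box)
  from homogeneous_system_solution[OF _ _ this, of "\<lambda>\<beta> i. point_term (1, q0 (i, 1), q0 (i, 2), q0 (i, 3)) \<beta>"]
  obtain g where g: "\<exists>\<beta>\<in>?M. g \<beta> \<noteq> 0"
    "\<And>i. i < j \<Longrightarrow> form_value ?M g (q0 (i, 1), q0 (i, 2), q0 (i, 3)) = 0" by (auto simp: form_value_def)
  then obtain p where p: "form_value ?M g p \<noteq> 0" using form_value_eq_0 by blast
  define G where "G r = form_value ?M g (r (j, 1), r (j, 2), r (j, 3))" for r :: "nat \<times> nat \<Rightarrow> 'a"
  have G: "polyfun UNIV G" unfolding G_def[abs_def] form_value_def prod.case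
    by (intro polyfun_sum polyfun.mult polyfun.const pt) simp
  \<comment> \<open>Only the point \<open>j\<close> moves, so \<open>g\<close> keeps vanishing at
    the earlier ones.\<close>
  define put where "put r = (\<lambda>u. if fst u = j then r u else q0 u)" for r
  have "polyfun UNIV (\<lambda>r. if fst u = j then r u else q0 u)" for u :: "nat \<times> nat"
    by (cases "fst u = j") (auto intro: polyfun.intros)
  then have hp: "polyfun UNIV (\<lambda>r. h (put r))"
    unfolding put_def by (rule polyfun_subst[OF h(1)])
  have "h (put q0) \<noteq> 0"
  proof -
    have "put q0 = q0" by (auto simp: put_def)
    then show ?thesis using q0 by simp
  qed
  moreover have "\<exists>r. G r \<noteq> 0"
  proof -
    obtain x y z where "p = (x, y, z)" by (cases p)
    then have "G (\<lambda>(i, l). if l = 1 then x else if l = 2 then y else z) \<noteq> 0" using p by (simp add: G_def)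
    then show ?thesis by blast
  qed
  ultimately obtain r where r: "h (put r) * G r \<noteq> 0" using polyfun_nonzero_mult[OF hp G] by blast
  have "separated ?M j (put r)" unfolding separated_def
    by (rule exI[of _ g]) (use g(2) r in \<open>auto simp: put_def G_def\<close>)
  then show ?thesis using h r that by auto
qed

subsection \<open>The number of ways to write a general vector as a sum of monomial vectors\<close>

definition solutions :: "expo set \<Rightarrow> nat \<Rightarrow> (expo \<Rightarrow> 'a::comm_ring_1) \<Rightarrow> (nat \<times> nat \<Rightarrow> 'a) set" where
  "solutions K m T = {q. \<forall>k\<in>K. terms_sum m q k = T k}"

text \<open>Having at least \<open>n\<close> unordered solutions is expressed by \<open>n\<close>
  copies of the parameters, no two of which agree up to a permutation of the summands.\<close>

lemma definable_many_solutions: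
  assumes K: "finite K"
  shows "definable K (\<lambda>T :: expo \<Rightarrow> 'a::{alg_closed_field, field_char_0}.
    \<exists>N \<subseteq> points m ` solutions K m T. finite N \<and> card N = n)"
proof -
  let ?J = "{..<n} \<times> ({..<m} \<times> {..<4::nat})"
  let ?V = "Inl ` K \<union> Inr ` ?J :: (expo + nat \<times> nat \<times> nat) set"
  let ?q = "\<lambda>e c p. e (Inr (c :: nat, p :: nat \<times> nat))"
  define R where "R e \<longleftrightarrow> (\<forall>c\<in>{..<n}. \<forall>k\<in>K. terms_sum m (?q e c) k = e (Inl k)) \<and>
    (\<forall>c\<in>{..<n}. \<forall>c'\<in>{..<c}. \<not> (\<exists>\<pi>\<in>{\<pi>. \<pi> permutes {..<m}}. \<forall>i\<in>{..<m}. \<forall>l\<in>{..<4}. ?q e c (i, l) = ?q e c' (\<pi> i, l)))" for e :: "_ \<Rightarrow> 'a"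
  have "definable ?V R"
    unfolding R_def[abs_def]
  proof (intro definable_conj definable_ball definable_not definable_bex definable_eq)
    fix c k assume ck: "c \<in> {..<n}" "k \<in> K"
    show "polyfun ?V (\<lambda>e :: _ \<Rightarrow> 'a. terms_sum m (?q e c) k)"
      by (rule polyfun_subst[OF polyfun_terms_sum]) (use ck in \<open>auto intro: polyfun.var\<close>)
  next
    fix c c' \<pi> i l assume *: "c \<in> {..<n}" "c' \<in> {..<c}" "\<pi> \<in> {\<pi>. \<pi> permutes {..<m}}" "i \<in> {..<m}" "l \<in> {..<4::nat}"
    show "polyfun ?V (\<lambda>e :: _ \<Rightarrow> 'a. ?q e c (i, l))" "polyfun ?V (\<lambda>e :: _ \<Rightarrow> 'a. ?q e c' (\<pi> i, l))"
      using * permutes_in_image[of \<pi> "{..<m}" i] by (auto intro!: polyfun.var)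
  qed (auto intro: polyfun.var K finite_permutations)
  from definable_ex[OF _ this] have "definable K (\<lambda>T. \<exists>q. R (case_sum T q))" by simp
  moreover have "(\<exists>q. R (case_sum T q)) \<longleftrightarrow> (\<exists>N \<subseteq> points m ` solutions K m T. finite N \<and> card N = n)"
    for T :: "expo \<Rightarrow> 'a"
  proof
    assume "\<exists>q. R (case_sum T q)"
    then obtain q where q: "R (case_sum T q)" ..
    let ?p = "\<lambda>c. points m (\<lambda>p. q (c, p))"
    have ne: "?p c \<noteq> ?p c'" if "c < n" "c' < c" for c c'
      using q that unfolding points_eq_iff R_def by simp
    have inj: "inj_on ?p {..<n}"
      by (rule inj_onI) (metis ne lessThan_iff linorder_neqE_nat)
    have "?p ` {..<n} \<subseteq> points m ` solutions K m T"
      using q by (auto simp: solutions_def R_def)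
    moreover have "card (?p ` {..<n}) = n" using card_image[OF inj] by simp
    ultimately show "\<exists>N \<subseteq> points m ` solutions K m T. finite N \<and> card N = n"
      by (intro exI[of _ "?p ` {..<n}"]) simp
  next
    assume "\<exists>N \<subseteq> points m ` solutions K m T. finite N \<and> card N = n"
    then obtain N where N: "N \<subseteq> points m ` solutions K m T" "finite N" "card N = n" by blast
    obtain f where f: "bij_betw f {..<n} N" using ex_bij_betw_nat_finite[OF N(2)] N(3) by (auto simp: atLeast0LessThan)
    then have "\<forall>c\<in>{..<n}. \<exists>q. q \<in> solutions K m T \<and> f c = points m q"
      using N(1) by (auto simp: bij_betw_def)
    from bchoice[OF this] obtain q where q: "\<And>c. c < n \<Longrightarrow> q c \<in> solutions K m T"
      "\<And>c. c < n \<Longrightarrow> f c = points m (q c)" by auto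
    have "points m (q c) \<noteq> points m (q c')" if "c < n" "c' < c" for c c'
      using f that q(2)[of c] q(2)[of c'] unfolding bij_betw_def inj_on_def
      by (metis lessThan_iff less_irrefl less_trans)
    then have "R (case_sum T (\<lambda>(c, p). q c p))"
      using q(1) unfolding points_eq_iff solutions_def R_def by simp
    then show "\<exists>q. R (case_sum T q)" by (rule exI[of _ "\<lambda>(c, p). q c p"])
  qed
  ultimately show ?thesis by simp
qed

lemma generic_conj:
  fixes P R :: "('k \<Rightarrow> 'a::field_char_0) \<Rightarrow> bool"
  assumes "\<exists>Q. polyfun K Q \<and> (\<exists>T. Q T \<noteq> 0) \<and> (\<forall>T. Q T \<noteq> 0 \<longrightarrow> P T)"
    and "\<exists>Q. polyfun K Q \<and> (\<exists>T. Q T \<noteq> 0) \<and> (\<forall>T. Q T \<noteq> 0 \<longrightarrow> R T)"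
  shows "\<exists>Q. polyfun K Q \<and> (\<exists>T. Q T \<noteq> 0) \<and> (\<forall>T. Q T \<noteq> 0 \<longrightarrow> P T \<and> R T)"
proof -
  obtain Q Q' where Q: "polyfun K Q" "\<exists>T. Q T \<noteq> 0" "\<forall>T. Q T \<noteq> 0 \<longrightarrow> P T"
    and Q': "polyfun K Q'" "\<exists>T. Q' T \<noteq> 0" "\<forall>T. Q' T \<noteq> 0 \<longrightarrow> R T" using assms by blast
  have "\<exists>T. Q T * Q' T \<noteq> 0" using polyfun_nonzero_mult[OF Q(1) Q'(1)] Q(2) Q'(2) by blast
  then show ?thesis using Q Q' by (intro exI[of _ "\<lambda>T. Q T * Q' T"]) (auto intro: polyfun.mult)
qed

lemma generic_mono:
  assumes "\<exists>Q. polyfun K Q \<and> (\<exists>T. Q T \<noteq> 0) \<and> (\<forall>T. Q T \<noteq> 0 \<longrightarrow> P T)" "\<And>T. P T \<Longrightarrow> R T"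
  shows "\<exists>Q. polyfun K Q \<and> (\<exists>T. Q T \<noteq> 0) \<and> (\<forall>T. Q T \<noteq> 0 \<longrightarrow> R T)"
  using assms by blast

text \<open>The conditions that accompany the count are those used for the return to tensors: no
  summand lies at infinity, none is zero, and the points impose independent conditions on forms of
  lower degree.\<close>

theorem general_sum_of_monomial_vectors:
  fixes d1 d2 d3 m :: nat
  assumes d: "d1 \<ge> 3" "d2 \<ge> 3" "d3 \<ge> 3" and m: "(d1 + 1) * (d2 + 1) * (d3 + 1) = 4 * m"
  defines "K \<equiv> box (d1 + 1) (d2 + 1) (d3 + 1)"
  shows "\<exists>\<nu>\<ge>2. \<exists>Q :: (expo \<Rightarrow> 'a::{alg_closed_field, field_char_0}) \<Rightarrow> 'a.
    polyfun K Q \<and> (\<exists>T. Q T \<noteq> 0) \<and> (\<forall>T. Q T \<noteq> 0 \<longrightarrow>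
      card (points m ` solutions K m T) = \<nu> \<and>
      (\<forall>\<sigma> q. (\<forall>k\<in>K. (\<Sum>i<m. chart_term d1 d2 d3 \<sigma> q i k) = T k) \<longrightarrow>
        (\<forall>i<m. \<forall>l\<in>{1, 2, 3}. \<not> \<sigma> (i, l))) \<and>
      (\<forall>q\<in>solutions K m T. (\<forall>i<m. q (i, 0) \<noteq> 0) \<and> (\<forall>j<m. separated (box d1 d2 d3) j q)))"
proof -
  let ?J = "{..<m} \<times> {..<4::nat}"
  have K: "finite K" "card K = 4 * m" using m by (simp_all add: K_def card_box)
  have "irrational_box TYPE('a) (d1 + 1) (d2 + 1) (d3 + 1)"
    using d m by (intro irrational_box) auto
  then obtain e where e: "irrational_on TYPE('a) K m e"
    unfolding irrational_box_def m K_def by auto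
  have dom: "dominates TYPE('a) K m" using irrational_on_imp_dominates[OF e] .
  interpret dominant_map K ?J "terms_sum m :: (nat \<times> nat \<Rightarrow> 'a) \<Rightarrow> _"
  proof
    show "Q T = 0" if "polyfun K Q" "\<And>q. Q (terms_sum m q) = 0" for Q :: "(expo \<Rightarrow> 'a) \<Rightarrow> 'a" and T
      using dom that unfolding dominates_def by blast
  qed (use K polyfun_terms_sum in auto)
  let ?gen = "\<lambda>P. \<exists>Q :: (expo \<Rightarrow> 'a) \<Rightarrow> 'a. polyfun K Q \<and> (\<exists>T. Q T \<noteq> 0) \<and> (\<forall>T. Q T \<noteq> 0 \<longrightarrow> P T)"
  let ?S = "\<lambda>T. points m ` solutions K m T"
  let ?P = "\<lambda>n T. \<exists>N \<subseteq> ?S T. finite N \<and> card N = n"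
  have dichotomy: "?gen (?P n) \<or> ?gen (\<lambda>T. \<not> ?P n T)" for n
    by (rule definable_generic[OF definable_many_solutions[OF K(1), of m n, where 'a = 'a]]) blast
  have two: "?gen (?P 2)"
  proof -
    obtain Q where Q: "polyfun K Q" "\<exists>T. Q T \<noteq> 0" "\<And>T. Q T \<noteq> 0 \<Longrightarrow>
        \<exists>q q'. (\<forall>k\<in>K. terms_sum m q k = T k) \<and> (\<forall>k\<in>K. terms_sum m q' k = T k) \<and>
          square_sum m e q \<noteq> (square_sum m e q' :: 'a)"
      by (rule generic_two_values[OF polyfun_square_sum[of m e]])
        (use e in \<open>auto simp: irrational_on_def\<close>)
    have "?P 2 T" if nz: "Q T \<noteq> 0" for T
    proof -
      obtain q q' where q: "q \<in> solutions K m T" "q' \<in> solutions K m T"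
        "square_sum m e q \<noteq> square_sum m e q'" using Q(3)[OF nz] unfolding solutions_def by blast
      then have "points m q \<noteq> points m q'" by (auto simp: square_sum_points)
      then show ?thesis using q by (intro exI[of _ "{points m q, points m q'}"]) auto
    qed
    then show ?thesis using Q by blast
  qed
  obtain B where B: "?gen (\<lambda>T. finite (?S T) \<and> card (?S T) \<le> B)"
  proof -
    obtain Q B where Q: "polyfun K Q" "\<exists>T. Q T \<noteq> (0::'a)"
      "\<And>T. Q T \<noteq> 0 \<Longrightarrow> finite {q \<in> extensional ?J. \<forall>k\<in>K. terms_sum m q k = T k} \<and>
        card {q \<in> extensional ?J. \<forall>k\<in>K. terms_sum m q k = T k} \<le> B"
      by (rule generic_fibre_finite) blast
    have sub: "?S T \<subseteq> points m ` {q \<in> extensional ?J. \<forall>k\<in>K. terms_sum m q k = T k}" for T :: "expo \<Rightarrow> 'a"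
    proof
      fix N assume "N \<in> ?S T"
      then obtain q where q: "N = points m q" "\<forall>k\<in>K. terms_sum m q k = T k"
        by (auto simp: solutions_def)
      have "points m q = points m (restrict q ?J)"
        by (auto simp: points_def intro!: image_mset_cong)
      moreover have "terms_sum m (restrict q ?J) k = terms_sum m q k" for k
        by (auto simp: terms_sum_def term_at_def intro!: sum.cong)
      ultimately show "N \<in> points m ` {q \<in> extensional ?J. \<forall>k\<in>K. terms_sum m q k = T k}"
        using q by (intro image_eqI[of _ _ "restrict q ?J"]) auto
    qed
    have "finite (?S T) \<and> card (?S T) \<le> B" if "Q T \<noteq> 0" for T
      using Q(3)[OF that] sub[of T] by (meson card_image_le card_mono finite_imageI finite_subset le_trans)
    then show ?thesis using that Q by blast
  qed
  have bound: "n \<le> B" if Pn: "?gen (?P n)" for n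
  proof -
    have "?gen (\<lambda>T. ?P n T \<and> finite (?S T) \<and> card (?S T) \<le> B)" using generic_conj[OF Pn B] .
    then have "\<exists>T :: expo \<Rightarrow> 'a. ?P n T \<and> finite (?S T) \<and> card (?S T) \<le> B" by metis
    then show ?thesis by (meson card_mono le_trans)
  qed
  \<comment> \<open>The largest number of solutions that is generically reached. Since
    \<open>?P (Suc \<nu>)\<close> is not generically true, the dichotomy makes it generically false,
    and the count is exact.\<close>
  define \<nu> where "\<nu> = (GREATEST n. ?gen (?P n))"
  have \<nu>: "?gen (?P \<nu>)" unfolding \<nu>_def using two bound by (rule GreatestI_nat)
  have le: "n \<le> \<nu>" if "?gen (?P n)" for n
    unfolding \<nu>_def using that bound by (rule Greatest_le_nat)
  have "\<not> ?gen (?P (Suc \<nu>))"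
  proof
    assume "?gen (?P (Suc \<nu>))"
    from le[OF this] show False by simp
  qed
  then have "?gen (\<lambda>T. \<not> ?P (Suc \<nu>) T)" using dichotomy[of "Suc \<nu>"] by blast
  from generic_conj[OF generic_conj[OF \<nu> this] B]
  have "?gen (\<lambda>T. (?P \<nu> T \<and> \<not> ?P (Suc \<nu>) T) \<and> finite (?S T) \<and> card (?S T) \<le> B)" .
  note exact = this
  have card: "card (?S T) = \<nu>"
    if "(?P \<nu> T \<and> \<not> ?P (Suc \<nu>) T) \<and> finite (?S T) \<and> card (?S T) \<le> B" for T :: "expo \<Rightarrow> 'a"
  proof (rule antisym)
    show "card (?S T) \<le> \<nu>"
    proof (rule ccontr)
      assume "\<not> card (?S T) \<le> \<nu>"
      then have "Suc \<nu> \<le> card (?S T)" by simp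
      then obtain N where "N \<subseteq> ?S T" "card N = Suc \<nu>" by (rule obtain_subset_with_card_n)
      then show False using that by (meson finite_subset)
    qed
    show "\<nu> \<le> card (?S T)" using that by (meson card_mono)
  qed
  have count: "?gen (\<lambda>T. card (?S T) = \<nu>)" by (rule generic_mono[OF exact card])
  have affine: "?gen (\<lambda>T. \<forall>\<sigma> q. (\<forall>k\<in>K. (\<Sum>i<m. chart_term d1 d2 d3 \<sigma> q i k) = T k) \<longrightarrow>
      (\<forall>i<m. \<forall>l\<in>{1, 2, 3}. \<not> \<sigma> (i, l)))"
    by (rule generic_no_infinity[OF K(1), of m, where 'a = 'a and ?d1.0 = d1 and ?d2.0 = d2 and ?d3.0 = d3])
      (use K(2) in \<open>simp, blast\<close>)
  \<comment> \<open>Each side of the large box is at most 4/3 of the side of the small one, so m is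
    at most 64/108 of the volume of the small box.\<close>
  have "m \<le> d1 * d2 * d3"
  proof -
    have "3 * (d1 + 1) \<le> 4 * d1" "3 * (d2 + 1) \<le> 4 * d2" "3 * (d3 + 1) \<le> 4 * d3" using d by auto
    then have "(3 * (d1 + 1)) * (3 * (d2 + 1)) * (3 * (d3 + 1)) \<le> (4 * d1) * (4 * d2) * (4 * d3)"
      using mult_le_mono[OF mult_le_mono] by blast
    then have "27 * (4 * m) \<le> 64 * (d1 * d2 * d3)" unfolding m[symmetric] by (simp add: algebra_simps)
    then show ?thesis by linarith
  qed
  then have "\<forall>j\<in>{..<m}. \<exists>h :: (nat \<times> nat \<Rightarrow> 'a) \<Rightarrow> 'a. polyfun ?J h \<and> (\<exists>q. h q \<noteq> 0) \<and>
      (\<forall>q. h q \<noteq> 0 \<longrightarrow> separated (box d1 d2 d3) j q)"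
  proof (intro ballI)
    fix j assume "j \<in> {..<m}"
    then have j: "j < d1 * d2 * d3" using \<open>m \<le> d1 * d2 * d3\<close> by simp
    show "\<exists>h :: (nat \<times> nat \<Rightarrow> 'a) \<Rightarrow> 'a. polyfun ?J h \<and> (\<exists>q. h q \<noteq> 0) \<and>
      (\<forall>q. h q \<noteq> 0 \<longrightarrow> separated (box d1 d2 d3) j q)"
      by (rule generic_separated[OF j, of ?J]) (use \<open>j \<in> {..<m}\<close> in auto)
  qed
  from bchoice[OF this] obtain h :: "nat \<Rightarrow> (nat \<times> nat \<Rightarrow> 'a) \<Rightarrow> 'a" where
    h: "\<And>j. j \<in> {..<m} \<Longrightarrow> polyfun ?J (h j)" "\<And>j. j \<in> {..<m} \<Longrightarrow> \<exists>q. h j q \<noteq> 0"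
      "\<And>j q. j \<in> {..<m} \<Longrightarrow> h j q \<noteq> 0 \<Longrightarrow> separated (box d1 d2 d3) j q" by blast
  define w where "w q = (\<Prod>i<m. q (i, 0))" for q :: "nat \<times> nat \<Rightarrow> 'a"
  have w: "polyfun ?J w" unfolding w_def[abs_def] by (intro polyfun_prod polyfun.var) auto
  have w1: "w (\<lambda>_. 1) \<noteq> 0" by (simp add: w_def)
  define H where "H q = (\<Prod>j<m. h j q)" for q
  have H: "polyfun ?J H" unfolding H_def[abs_def] by (rule polyfun_prod) (rule h(1))
  have "\<exists>q. H q \<noteq> 0" unfolding H_def by (rule polyfun_nonzero_prod[OF _ h(1,2)]) simp
  then have "\<exists>q. w q * H q \<noteq> 0" using polyfun_nonzero_mult[OF w H w1] by blast
  \<comment> \<open>Genericity is known for the parameters but is required for every solution over a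
    general point of the target; the norm of \<open>w * H\<close> transfers it.\<close>
  then obtain Q where Q: "polyfun K Q" "\<exists>T. Q T \<noteq> 0"
    "\<And>q. Q (terms_sum m q) \<noteq> 0 \<Longrightarrow> w q * H q \<noteq> (0::'a)"
    by (rule hypersurface_image[OF polyfun.mult[OF w H]]) blast
  have "(\<forall>i<m. q (i, 0) \<noteq> 0) \<and> (\<forall>j<m. separated (box d1 d2 d3) j q)"
    if "Q T \<noteq> 0" "q \<in> solutions K m T" for T q
  proof -
    have "Q (terms_sum m q) = Q T" by (rule polyfun_cong[OF Q(1)]) (use that in \<open>simp add: solutions_def\<close>)
    then have "w q * H q \<noteq> 0" using Q(3) that by simp
    then show ?thesis using h(3) by (auto simp: w_def H_def)
  qed
  then have good: "?gen (\<lambda>T. \<forall>q\<in>solutions K m T. (\<forall>i<m. q (i, 0) \<noteq> 0) \<and> (\<forall>j<m. separated (box d1 d2 d3) j q))"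
    using Q(1,2) by blast
  show ?thesis
    using generic_conj[OF count generic_conj[OF affine good]] le[OF two] by blast
qed

section \<open>Linear independence, and no further points on the span\<close>

lemma box_Suc: "box a b c \<subseteq> box (a + 1) (b + 1) (c + 1)"
  by (auto simp: box_def)

text \<open>A linear relation between monomial vectors is paired with the product of the form
  \<open>g\<close> and the monomial \<open>u\<close>; the multiplication by \<open>u\<close> appears
  as the shift \<open>f\<close> of exponents.\<close>

lemma form_value_combination:
  assumes "\<And>\<beta>. \<beta> \<in> M \<Longrightarrow> w * point_term (1, x, y, z) (f \<beta>) =
    (\<Sum>i<m. c i * point_term (1, q (i, 1), q (i, 2), q (i, 3)) (f \<beta>))"
    and "\<And>x y z \<beta>. point_term (1, x, y, z) (f \<beta>) = u x y z * point_term (1, x, y, z) \<beta>"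
  shows "w * (u x y z * form_value M g (x, y, z)) =
    (\<Sum>i<m. c i * (u (q (i, 1)) (q (i, 2)) (q (i, 3)) * form_value M g (q (i, 1), q (i, 2), q (i, 3))))"
proof -
  have "w * (u x y z * form_value M g (x, y, z)) =
      (\<Sum>\<beta>\<in>M. g \<beta> * (w * (u x y z * point_term (1, x, y, z) \<beta>)))"
    by (simp add: form_value_def sum_distrib_left mult.left_commute)
  also have "\<dots> = (\<Sum>\<beta>\<in>M. g \<beta> * (\<Sum>i<m. c i * (u (q (i, 1)) (q (i, 2)) (q (i, 3)) *
      point_term (1, q (i, 1), q (i, 2), q (i, 3)) \<beta>)))"
    using assms by (intro sum.cong) (auto simp: assms(2))
  also have "\<dots> = (\<Sum>i<m. \<Sum>\<beta>\<in>M. g \<beta> * (c i * (u (q (i, 1)) (q (i, 2)) (q (i, 3)) *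
      point_term (1, q (i, 1), q (i, 2), q (i, 3)) \<beta>)))"
    unfolding sum_distrib_left by (rule sum.swap)
  also have "\<dots> = (\<Sum>i<m. c i * (u (q (i, 1)) (q (i, 2)) (q (i, 3)) *
      form_value M g (q (i, 1), q (i, 2), q (i, 3))))"
    by (simp add: form_value_def sum_distrib_left mult.left_commute)
  finally show ?thesis .
qed

text \<open>A form that vanishes at the points \<open>i < j\<close> but not at \<open>j\<close> isolates the last non-zero
  coefficient.\<close>

lemma separated_last:
  fixes c :: "nat \<Rightarrow> 'a::field"
  assumes sep: "\<forall>j<m. separated M j q" and nz: "i < m" "c i \<noteq> 0"
  obtains j g where "j < m" "c j * form_value M g (q (j, 1), q (j, 2), q (j, 3)) \<noteq> 0"
    "\<And>u. (\<Sum>i<m. c i * (u i * form_value M g (q (i, 1), q (i, 2), q (i, 3)))) =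
      c j * (u j * form_value M g (q (j, 1), q (j, 2), q (j, 3)))"
proof -
  define j where "j = Max {i. i < m \<and> c i \<noteq> 0}"
  have "j \<in> {i. i < m \<and> c i \<noteq> 0}" unfolding j_def using nz by (intro Max_in) auto
  then have j: "j < m" "c j \<noteq> 0" by auto
  have last: "i \<le> j" if "i < m" "c i \<noteq> 0" for i unfolding j_def using that by (intro Max_ge) auto
  obtain g where g: "\<And>i. i < j \<Longrightarrow> form_value M g (q (i, 1), q (i, 2), q (i, 3)) = 0"
    "form_value M g (q (j, 1), q (j, 2), q (j, 3)) \<noteq> 0"
    using sep j(1) unfolding separated_def by blast
  show ?thesis
  proof (rule that[of j g])
    fix u :: "nat \<Rightarrow> 'a"
    have "c i * (u i * form_value M g (q (i, 1), q (i, 2), q (i, 3))) = 0" if "i < m" "i \<noteq> j" for i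
      using last[of i] g(1)[of i] that by (cases "i < j") auto
    then have "(\<Sum>i<m. c i * (u i * form_value M g (q (i, 1), q (i, 2), q (i, 3)))) =
        (\<Sum>i\<in>{j}. c i * (u i * form_value M g (q (i, 1), q (i, 2), q (i, 3))))"
      using j(1) by (intro sum.mono_neutral_right) auto
    then show "(\<Sum>i<m. c i * (u i * form_value M g (q (i, 1), q (i, 2), q (i, 3)))) =
        c j * (u j * form_value M g (q (j, 1), q (j, 2), q (j, 3)))" by simp
  qed (use j g(2) in auto)
qed

lemma separated_independent:
  fixes c :: "nat \<Rightarrow> 'a::field"
  assumes sep: "\<forall>j<m. separated (box d1 d2 d3) j q"
    and 0: "\<And>\<beta>. \<beta> \<in> box (d1 + 1) (d2 + 1) (d3 + 1) \<Longrightarrow>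
      (\<Sum>i<m. c i * point_term (1, q (i, 1), q (i, 2), q (i, 3)) \<beta>) = 0"
    and i: "i < m"
  shows "c i = 0"
proof (rule ccontr)
  assume "c i \<noteq> 0"
  then obtain j g where j: "j < m" "c j * form_value (box d1 d2 d3) g (q (j, 1), q (j, 2), q (j, 3)) \<noteq> 0"
    "\<And>u. (\<Sum>i<m. c i * (u i * form_value (box d1 d2 d3) g (q (i, 1), q (i, 2), q (i, 3)))) =
      c j * (u j * form_value (box d1 d2 d3) g (q (j, 1), q (j, 2), q (j, 3)))"
    by (rule separated_last[OF sep i]) blast
  \<comment> \<open>The left-hand point is a dummy with coefficient 0.\<close>
  have "0 * (1 * form_value (box d1 d2 d3) g (0, 0, 0)) =
      (\<Sum>i<m. c i * (1 * form_value (box d1 d2 d3) g (q (i, 1), q (i, 2), q (i, 3))))"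
    by (rule form_value_combination[where f = "\<lambda>\<beta>. \<beta>" and u = "\<lambda>_ _ _. 1"])
      (use 0[OF subsetD[OF box_Suc]] in simp_all)
  then show False using j(2) j(3)[of "\<lambda>_. 1"] by simp
qed

text \<open>Pairing with \<open>g\<close>, \<open>x g\<close>, \<open>y g\<close> and
  \<open>z g\<close>, where \<open>g\<close> isolates one index \<open>j\<close> in the combination,
  shows that the coordinates of the new point are those of the point \<open>j\<close>.\<close>

lemma separated_secant:
  fixes c :: "nat \<Rightarrow> 'a::field"
  assumes sep: "\<forall>j<m. separated (box d1 d2 d3) j q" and w: "w \<noteq> 0"
    and eq: "\<And>\<beta>. \<beta> \<in> box (d1 + 1) (d2 + 1) (d3 + 1) \<Longrightarrow> point_term (w, x, y, z) \<beta> =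
      (\<Sum>i<m. c i * point_term (1, q (i, 1), q (i, 2), q (i, 3)) \<beta>)"
  shows "\<exists>j<m. x = q (j, 1) \<and> y = q (j, 2) \<and> z = q (j, 3)"
proof -
  have eq': "w * point_term (1, x, y, z) \<beta> =
      (\<Sum>i<m. c i * point_term (1, q (i, 1), q (i, 2), q (i, 3)) \<beta>)"
    if "\<beta> \<in> box (d1 + 1) (d2 + 1) (d3 + 1)" for \<beta>
    using eq[OF that] by (simp add: point_term_def mult.assoc split: prod.splits)
  \<comment> \<open>At exponent zero all monomials are 1, so the coefficients add up to
    \<open>w\<close>.\<close>
  have "(\<Sum>i<m. c i) \<noteq> 0" using eq[of "(0, 0, 0)"] w by (simp add: point_term_def box_def)
  then obtain i where "i < m" "c i \<noteq> 0" by (metis lessThan_iff sum.neutral)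
  then obtain j g where j: "j < m" "c j * form_value (box d1 d2 d3) g (q (j, 1), q (j, 2), q (j, 3)) \<noteq> 0"
    "\<And>u. (\<Sum>i<m. c i * (u i * form_value (box d1 d2 d3) g (q (i, 1), q (i, 2), q (i, 3)))) =
      c j * (u j * form_value (box d1 d2 d3) g (q (j, 1), q (j, 2), q (j, 3)))"
    by (rule separated_last[OF sep]) blast
  let ?v = "\<lambda>x y z. form_value (box d1 d2 d3) g (x, y, z)"
  have u: "w * (u x y z * ?v x y z) = c j * (u (q (j, 1)) (q (j, 2)) (q (j, 3)) * ?v (q (j, 1)) (q (j, 2)) (q (j, 3)))"
    if "\<And>\<beta>. \<beta> \<in> box d1 d2 d3 \<Longrightarrow> f \<beta> \<in> box (d1 + 1) (d2 + 1) (d3 + 1)"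
      "\<And>x y z \<beta>. point_term (1 :: 'a, x, y, z) (f \<beta>) = u x y z * point_term (1, x, y, z) \<beta>" for u f
  proof -
    have "w * (u x y z * ?v x y z) =
        (\<Sum>i<m. c i * (u (q (i, 1)) (q (i, 2)) (q (i, 3)) * ?v (q (i, 1)) (q (i, 2)) (q (i, 3))))"
      by (rule form_value_combination[where f = f]) (erule eq'[OF that(1)], rule that(2))
    then show ?thesis unfolding j(3) .
  qed
  have 1: "w * ?v x y z = c j * ?v (q (j, 1)) (q (j, 2)) (q (j, 3))"
    using u[of "\<lambda>\<beta>. \<beta>" "\<lambda>_ _ _. 1"] box_Suc by auto
  have cancel: "s = t" if "w * (s * ?v x y z) = c j * (t * ?v (q (j, 1)) (q (j, 2)) (q (j, 3)))" for s t
  proof -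
    have "s * (w * ?v x y z) = t * (c j * ?v (q (j, 1)) (q (j, 2)) (q (j, 3)))"
      using that by (simp only: mult.left_commute)
    then show ?thesis unfolding 1 using j(2) by simp
  qed
  have "x = q (j, 1)"
    by (rule cancel, rule u[of "\<lambda>(\<alpha>, \<beta>, \<gamma>). (Suc \<alpha>, \<beta>, \<gamma>)" "\<lambda>x y z. x"])
      (auto simp: box_def point_term_def)
  moreover have "y = q (j, 2)"
    by (rule cancel, rule u[of "\<lambda>(\<alpha>, \<beta>, \<gamma>). (\<alpha>, Suc \<beta>, \<gamma>)" "\<lambda>x y z. y"])
      (auto simp: box_def point_term_def)
  moreover have "z = q (j, 3)"
    by (rule cancel, rule u[of "\<lambda>(\<alpha>, \<beta>, \<gamma>). (\<alpha>, \<beta>, Suc \<gamma>)" "\<lambda>x y z. z"])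
      (auto simp: box_def point_term_def)
  ultimately show ?thesis using j(1) by blast
qed

section \<open>Partially symmetric tensors in coordinates\<close>

definition trues :: "bool list \<Rightarrow> nat" where
  "trues xs = length (filter id xs)"

definition sorted_block :: "nat \<Rightarrow> nat \<Rightarrow> bool list" where
  "sorted_block d \<alpha> = replicate \<alpha> True @ replicate (d - \<alpha>) False"

lemma trues_sorted_block [simp]: "trues (sorted_block d \<alpha>) = \<alpha>"
  by (simp add: trues_def sorted_block_def)

lemma length_sorted_block: "\<alpha> \<le> d \<Longrightarrow> length (sorted_block d \<alpha>) = d"
  by (simp add: sorted_block_def)

lemma trues_le: "trues xs \<le> length xs"
  by (simp add: trues_def)

lemma mset_eq_sorted_block: "mset xs = mset (sorted_block (length xs) (trues xs))"
proof (induction xs)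
  case (Cons x xs)
  have "Suc (length xs) - trues xs = Suc (length xs - trues xs)"
    using trues_le[of xs] by (simp add: Suc_diff_le)
  then show ?case using Cons by (cases x) (auto simp: sorted_block_def trues_def)
qed (simp add: sorted_block_def trues_def)

lemma prod_list_trues:
  "prod_list (map a xs) = a True ^ trues xs * (a False ^ (length xs - trues xs) :: 'a::comm_ring_1)"
proof (induction xs)
  case (Cons x xs)
  have "Suc (length xs) - trues xs = Suc (length xs - trues xs)"
    using trues_le[of xs] by (simp add: Suc_diff_le)
  then show ?case using Cons by (cases x) (auto simp: trues_def algebra_simps)
qed (simp add: trues_def)

text \<open>A rearrangement \<open>p\<close> inside the block is moved to the positions of the block
  and extended by the identity.\<close>

lemma invariant_on_block_mset:
  assumes inv: "invariant_on_block {s..<s + d} T" and s: "length us = s" and d: "length xs = d"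
    and xy: "mset xs = mset ys"
  shows "T (us @ xs @ vs) = T (us @ ys @ vs)"
proof -
  obtain p where p: "p permutes {..<length xs}" "permute_list p xs = ys"
    using mset_eq_permutation[of ys xs] xy by auto
  define \<pi> where "\<pi> i = (if s \<le> i \<and> i < s + d then s + p (i - s) else i)" for i
  have in_block: "p (i - s) < d" if "s \<le> i" "i < s + d" for i
    using p(1) that d permutes_in_image[of p "{..<length xs}" "i - s"] by auto
  have "\<pi> permutes {s..<s + d}"
  proof (rule bij_imp_permutes)
    have "inj_on \<pi> {s..<s + d}"
    proof (rule inj_onI)
      fix i j assume ij: "i \<in> {s..<s + d}" "j \<in> {s..<s + d}" "\<pi> i = \<pi> j"
      then have "p (i - s) = p (j - s)" by (simp add: \<pi>_def)
      then have "i - s = j - s" using permutes_inj[OF p(1)] by (simp add: inj_eq)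
      then show "i = j" using ij by auto
    qed
    moreover have "\<pi> ` {s..<s + d} \<subseteq> {s..<s + d}" using in_block by (auto simp: \<pi>_def)
    ultimately show "bij_betw \<pi> {s..<s + d} {s..<s + d}"
      by (simp add: bij_betw_def endo_inj_surj)
  qed (auto simp: \<pi>_def)
  moreover have "permute_list \<pi> (us @ xs @ vs) = us @ ys @ vs"
  proof (rule nth_equalityI)
    show len: "length (permute_list \<pi> (us @ xs @ vs)) = length (us @ ys @ vs)"
      using mset_eq_length[OF xy] by simp
    fix i assume i: "i < length (permute_list \<pi> (us @ xs @ vs))"
    have ys: "ys ! l = xs ! p l" if "l < d" for l
      using that p d by (auto simp: permute_list_def)
    have ly: "length ys = d" using xy d mset_eq_length by metis
    show "permute_list \<pi> (us @ xs @ vs) ! i = (us @ ys @ vs) ! i"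
    proof (cases "s \<le> i \<and> i < s + d")
      case True
      then show ?thesis using i s d ly in_block[of i] ys[of "i - s"]
        by (auto simp: permute_list_def \<pi>_def nth_append)
    next
      case False
      then show ?thesis using i s d ly by (auto simp: permute_list_def \<pi>_def nth_append)
    qed
  qed
  moreover have "{s..<s + d} \<subseteq> {..<length (us @ xs @ vs)}" using s d by auto
  ultimately show ?thesis
    using inv unfolding invariant_on_block_def by metis
qed

lemma trues_block: "s + d \<le> length xs \<Longrightarrow> trues (take d (drop s xs)) = card {i \<in> {s..<s + d}. xs ! i}"
proof -
  assume l: "s + d \<le> length xs"
  have "trues (take d (drop s xs)) = card {i. i < d \<and> xs ! (s + i)}"
    using l unfolding trues_def length_filter_conv_card by (intro arg_cong[of _ _ card]) auto
  also have "\<dots> = card ((+) s ` {i. i < d \<and> xs ! (s + i)})" by (simp add: card_image)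
  also have "(+) s ` {i. i < d \<and> xs ! (s + i)} = {i \<in> {s..<s + d}. xs ! i}"
  proof -
    have "i \<in> (+) s ` {i. i < d \<and> xs ! (s + i)}" if "i \<in> {s..<s + d}" "xs ! i" for i
      using that by (intro image_eqI[of _ _ "i - s"]) auto
    then show ?thesis by auto
  qed
  finally show ?thesis .
qed

lemma trues_block_permute:
  assumes \<pi>: "\<pi> permutes B" and B: "B = {s..<s + d} \<or> B \<inter> {s..<s + d} = {}"
    and l: "s + d \<le> length xs" "B \<subseteq> {..<length xs}"
  shows "trues (take d (drop s (permute_list \<pi> xs))) = trues (take d (drop s xs))"
proof -
  let ?S = "{s..<s + d}"
  have pS: "\<pi> ` ?S = ?S"
    using B
  proof
    assume "B \<inter> ?S = {}"
    then have "\<pi> i = i" if "i \<in> ?S" for i using that \<pi> by (auto simp: permutes_def)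
    then show ?thesis by simp
  qed (use permutes_image[OF \<pi>] in simp)
  have "\<pi> permutes {..<length xs}" using permutes_subset[OF \<pi> l(2)] .
  then have "{i \<in> ?S. permute_list \<pi> xs ! i} = {i \<in> ?S. xs ! \<pi> i}"
    using l(1) by (auto simp: permute_list_nth)
  moreover have "card {i \<in> ?S. xs ! \<pi> i} = card (\<pi> ` {i \<in> ?S. xs ! \<pi> i})"
    using permutes_inj[OF \<pi>] by (simp add: card_image inj_on_def)
  moreover have "\<pi> ` {i \<in> ?S. xs ! \<pi> i} = {i \<in> ?S. xs ! i}"
  proof (intro equalityI subsetI)
    fix j assume j: "j \<in> {i \<in> ?S. xs ! i}"
    then have "j \<in> \<pi> ` ?S" using pS by simp
    then show "j \<in> \<pi> ` {i \<in> ?S. xs ! \<pi> i}" using j by blast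
  next
    fix j assume "j \<in> \<pi> ` {i \<in> ?S. xs ! \<pi> i}"
    then obtain i where i: "i \<in> ?S" "xs ! \<pi> i" "j = \<pi> i" by blast
    then have "j \<in> ?S" using pS by blast
    with i show "j \<in> {i \<in> ?S. xs ! i}" by simp
  qed
  ultimately show ?thesis using l(1) by (simp add: trues_block)
qed

context
  fixes d1 d2 d3 :: nat
begin

definition canonical :: "expo \<Rightarrow> bool list" where
  "canonical = (\<lambda>(\<alpha>, \<beta>, \<gamma>). sorted_block d1 \<alpha> @ sorted_block d2 \<beta> @ sorted_block d3 \<gamma>)"

definition expo_of :: "bool list \<Rightarrow> expo" where
  "expo_of xs = (trues (take d1 xs), trues (take d2 (drop d1 xs)), trues (take d3 (drop (d1 + d2) xs)))"

text \<open>The coordinates on the space of partially symmetric tensors: an orbit of index lists is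
  given by the number of entries \<open>True\<close> in each block. The inverse map evaluates a
  tensor at the sorted lists \<open>canonical\<close>.\<close>

definition sym_tensor :: "(expo \<Rightarrow> 'a::field) \<Rightarrow> 'a tensor" where
  "sym_tensor U = (\<lambda>xs. if length xs = d1 + d2 + d3 then U (expo_of xs) else 0)"

abbreviation "exps \<equiv> box (d1 + 1) (d2 + 1) (d3 + 1)"

lemma expo_of_in: "expo_of xs \<in> exps"
proof -
  have "trues (take d ys) < d + 1" for d ys using trues_le[of "take d ys"] by simp
  then show ?thesis by (simp add: expo_of_def box_def)
qed

lemma length_canonical: "k \<in> exps \<Longrightarrow> length (canonical k) = d1 + d2 + d3"
  by (auto simp: canonical_def box_def length_sorted_block)

lemma expo_of_canonical: "k \<in> exps \<Longrightarrow> expo_of (canonical k) = k"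
  by (auto simp: canonical_def box_def expo_of_def length_sorted_block)

lemma sym_tensor_canonical [simp]: "k \<in> exps \<Longrightarrow> sym_tensor U (canonical k) = U k"
  by (simp add: sym_tensor_def length_canonical expo_of_canonical)

lemma sym_tensor_cong:
  assumes "\<And>k. k \<in> exps \<Longrightarrow> U k = U' k"
  shows "sym_tensor U = sym_tensor U'"
  by (intro ext) (simp only: sym_tensor_def assms[OF expo_of_in])

lemma sym_tensor_eq_iff: "sym_tensor U = sym_tensor U' \<longleftrightarrow> (\<forall>k\<in>exps. U k = U' k)"
  using sym_tensor_cong sym_tensor_canonical by metis

lemma sym_tensor_in: "sym_tensor U \<in> partially_symmetric d1 d2 d3"
proof -
  have "invariant_on_block B (sym_tensor U)"
    if "B = {..<d1} \<or> B = {d1..<d1 + d2} \<or> B = {d1 + d2..<d1 + d2 + d3}" for B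
    unfolding invariant_on_block_def
  proof (intro allI impI)
    fix \<pi> xs assume \<pi>: "\<pi> permutes B" and B: "B \<subseteq> {..<length (xs :: bool list)}"
    have "expo_of (permute_list \<pi> xs) = expo_of xs" if l: "length xs = d1 + d2 + d3"
    proof -
      have "trues (take d1 (drop 0 (permute_list \<pi> xs))) = trues (take d1 (drop 0 xs))"
        by (rule trues_block_permute[OF \<pi> _ _ B]) (use that \<open>B = _ \<or> _\<close> in auto)
      moreover have "trues (take d2 (drop d1 (permute_list \<pi> xs))) = trues (take d2 (drop d1 xs))"
        by (rule trues_block_permute[OF \<pi> _ _ B]) (use that \<open>B = _ \<or> _\<close> in auto)
      moreover have "trues (take d3 (drop (d1 + d2) (permute_list \<pi> xs))) = trues (take d3 (drop (d1 + d2) xs))"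
        by (rule trues_block_permute[OF \<pi> _ _ B]) (use that \<open>B = _ \<or> _\<close> in auto)
      ultimately show ?thesis by (simp add: expo_of_def)
    qed
    then show "sym_tensor U (permute_list \<pi> xs) = sym_tensor U xs" by (simp add: sym_tensor_def)
  qed
  then show ?thesis unfolding partially_symmetric_def tensors_def by (auto simp: sym_tensor_def)
qed

lemma partially_symmetric_eq_sym_tensor:
  assumes T: "T \<in> partially_symmetric d1 d2 d3"
  shows "T = sym_tensor (\<lambda>k. T (canonical k))"
proof
  fix xs
  show "T xs = sym_tensor (\<lambda>k. T (canonical k)) xs"
  proof (cases "length xs = d1 + d2 + d3")
    case False
    then show ?thesis using T by (simp add: partially_symmetric_def tensors_def sym_tensor_def)
  next
    case True
    define us vs ws where "us = take d1 xs" and "vs = take d2 (drop d1 xs)" and "ws = drop (d1 + d2) xs"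
    have xs: "xs = us @ vs @ ws"
      by (simp add: us_def vs_def ws_def) (metis append_take_drop_id drop_drop add.commute)
    have len: "length us = d1" "length vs = d2" "length ws = d3"
      using True by (simp_all add: us_def vs_def ws_def)
    have inv: "invariant_on_block {0..<0 + d1} T" "invariant_on_block {d1..<d1 + d2} T"
      "invariant_on_block {d1 + d2..<d1 + d2 + d3} T"
      using T by (simp_all add: partially_symmetric_def atLeast0LessThan)
    have "T xs = T ([] @ us @ (vs @ ws))" by (simp add: xs)
    also have "\<dots> = T ([] @ sorted_block d1 (trues us) @ (vs @ ws))"
      using mset_eq_sorted_block[of us] len by (intro invariant_on_block_mset[OF inv(1)]) auto
    also have "\<dots> = T (sorted_block d1 (trues us) @ vs @ ws)" by simp
    also have "\<dots> = T (sorted_block d1 (trues us) @ sorted_block d2 (trues vs) @ ws)"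
      using mset_eq_sorted_block[of vs] len trues_le[of us]
      by (intro invariant_on_block_mset[OF inv(2)]) (auto simp: length_sorted_block)
    also have "\<dots> = T ((sorted_block d1 (trues us) @ sorted_block d2 (trues vs)) @ ws @ [])" by simp
    also have "\<dots> = T ((sorted_block d1 (trues us) @ sorted_block d2 (trues vs)) @ sorted_block d3 (trues ws) @ [])"
      using mset_eq_sorted_block[of ws] len trues_le[of us] trues_le[of vs]
      by (intro invariant_on_block_mset[OF inv(3)]) (auto simp: length_sorted_block)
    finally show ?thesis
      using True len by (simp add: sym_tensor_def canonical_def expo_of_def us_def vs_def ws_def)
  qed
qed

lemma sym_tensor_add: "sym_tensor (\<lambda>k. U k + U' k) = sym_tensor U + sym_tensor U'"
  by (auto simp: sym_tensor_def)

lemma sym_tensor_scale: "sym_tensor (\<lambda>k. c * U k) = tscale c (sym_tensor U)"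
  by (auto simp: sym_tensor_def tscale_def)

lemma sym_tensor_0: "sym_tensor (\<lambda>k. 0) = 0"
  by (auto simp: sym_tensor_def)

lemma sym_tensor_sum: "sym_tensor (\<lambda>k. \<Sum>i\<in>I. U i k) = (\<Sum>i\<in>I. sym_tensor (U i))"
  by (induction I rule: infinite_finite_induct) (simp_all add: sym_tensor_0 sym_tensor_add)

lemma decomposable_eq_sym_tensor:
  "tensor_prod d1 (tensor_power d1 a) (tensor_prod d2 (tensor_power d2 b) (tensor_power d3 c)) =
    sym_tensor (\<lambda>(\<alpha>, \<beta>, \<gamma>). (a True ^ \<alpha> * a False ^ (d1 - \<alpha>)) * (b True ^ \<beta> * b False ^ (d2 - \<beta>)) *
      (c True ^ \<gamma> * c False ^ (d3 - \<gamma>)))"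
proof
  fix xs
  show "tensor_prod d1 (tensor_power d1 a) (tensor_prod d2 (tensor_power d2 b) (tensor_power d3 c)) xs =
    sym_tensor (\<lambda>(\<alpha>, \<beta>, \<gamma>). (a True ^ \<alpha> * a False ^ (d1 - \<alpha>)) * (b True ^ \<beta> * b False ^ (d2 - \<beta>)) *
      (c True ^ \<gamma> * c False ^ (d3 - \<gamma>))) xs"
  proof (cases "length xs = d1 + d2 + d3")
    case True
    then show ?thesis
      by (simp add: tensor_prod_def tensor_power_def sym_tensor_def prod_list_trues expo_of_def
          add.commute mult.assoc)
  next
    case False
    then show ?thesis
      by (auto simp: tensor_prod_def tensor_power_def sym_tensor_def)
  qed
qed

end

section \<open>Decompositions and secant spaces\<close>

lemma sum_fun_apply: "(\<Sum>i\<in>I. f i) x = (\<Sum>i\<in>I. f i x :: 'b::comm_monoid_add)"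
  by (induction I rule: infinite_finite_induct) auto

lemma tscale_1 [simp]: "tscale 1 T = T"
  by (simp add: tscale_def)

lemma proj_point_iff: "S \<in> proj_point T \<longleftrightarrow> (\<exists>c. S = tscale c T)"
  by (auto simp: proj_point_def tensor.span_singleton)

lemma proj_point_self: "T \<in> proj_point T"
  by (simp add: proj_point_def tensor.span_base)

lemma proj_point_eqI:
  assumes "S \<in> proj_point T" "S \<noteq> 0"
  shows "proj_point S = proj_point T"
proof -
  obtain c where c: "S = tscale c T" using assms(1) proj_point_iff by blast
  have "c \<noteq> 0" using assms(2) c by (auto simp: tscale_def)
  then have "T = tscale (inverse c) S" unfolding c by (simp add: tscale_def fun_eq_iff)
  then show ?thesis unfolding proj_point_def using assms(1)[unfolded proj_point_def]
    by (intro tensor.span_eq[THEN iffD2]) (auto simp: tensor.span_singleton)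
qed

lemma span_Union_proj_point: "tensor.span (\<Union> (proj_point ` A)) = tensor.span A"
proof (rule tensor.span_eq[THEN iffD2], intro conjI)
  show "\<Union> (proj_point ` A) \<subseteq> tensor.span A"
    unfolding proj_point_def by (auto intro: tensor.span_mono[THEN subsetD, rotated])
  show "A \<subseteq> tensor.span (\<Union> (proj_point ` A))"
    by (auto intro!: tensor.span_base bexI proj_point_self)
qed

lemma span_image_eq_sum:
  assumes "finite I" "x \<in> tensor.span (f ` I)"
  shows "\<exists>c. x = (\<Sum>i\<in>I. tscale (c i) (f i))"
  using assms
proof (induction I arbitrary: x)
  case (insert i I)
  then obtain k where "x - tscale k (f i) \<in> tensor.span (f ` I)"
    by (auto simp: tensor.span_breakdown_eq)
  then obtain c where c: "x - tscale k (f i) = (\<Sum>i\<in>I. tscale (c i) (f i))" using insert.IH by blast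
  have "x = tscale k (f i) + (\<Sum>i\<in>I. tscale (c i) (f i))" unfolding c[symmetric] by simp
  also have "(\<Sum>j\<in>I. tscale (c j) (f j)) = (\<Sum>j\<in>I. tscale ((c(i := k)) j) (f j))"
    using insert.hyps by (intro sum.cong) auto
  finally show ?case using insert.hyps by (intro exI[of _ "c(i := k)"]) simp
qed simp

lemma proj_space_eq_imp_subset:
  assumes "proj_space (tensor.span A) = proj_space (tensor.span B)"
  shows "tensor.span A \<subseteq> tensor.span B"
proof
  fix x assume x: "x \<in> tensor.span A"
  show "x \<in> tensor.span B"
  proof (cases "x = 0")
    case True
    then show ?thesis by (simp add: tensor.span_zero)
  next
    case False
    then have "proj_point x \<in> proj_space (tensor.span B)"
      using assms x unfolding proj_space_def by blast
    then obtain y where "y \<in> tensor.span B" "proj_point x = proj_point y" unfolding proj_space_def by blast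
    then show ?thesis using proj_point_self[of x]
      by (auto simp: proj_point_iff intro: tensor.span_scale)
  qed
qed

text \<open>The two entries of \<open>a\<close> are homogeneous coordinates on the projective line,
  with \<open>a False = 0\<close> as the point at infinity. The scalar \<open>\<kappa>\<close> goes
  into the coefficient of the summand.\<close>

lemma chart_power_cases:
  fixes a :: "bool \<Rightarrow> 'a::field"
  assumes "a \<noteq> 0"
  shows "\<exists>\<kappa> s x. \<kappa> \<noteq> 0 \<and> (\<forall>\<alpha>\<le>d. a True ^ \<alpha> * a False ^ (d - \<alpha>) = \<kappa> * chart_power s x d \<alpha>)"
proof (cases "a False = 0")
  case True
  then have "a True \<noteq> 0" using assms by (metis (full_types) ext zero_fun_apply)
  then show ?thesis using True
    by (intro exI[of _ "a True ^ d"] exI[of _ True]) (auto simp: chart_power_def power_0_left)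
next
  case False
  have "a True ^ \<alpha> * a False ^ (d - \<alpha>) = a False ^ d * chart_power False (a True / a False) d \<alpha>"
    if "\<alpha> \<le> d" for \<alpha>
    using False that by (simp add: chart_power_def power_diff power_divide)
  then show ?thesis using False by (intro exI[of _ "a False ^ d"] exI[of _ False] exI) auto
qed

text \<open>What is known about a general tensor, stated for one tensor over any field; from here on
  the correspondence of decompositions and secant spaces is linear algebra.\<close>

locale regular_tensor =
  fixes d1 d2 d3 m \<nu> :: nat and T :: "'a::field tensor"
  assumes d: "1 \<le> d1" "1 \<le> d2" "1 \<le> d3"
    and T: "T \<in> partially_symmetric d1 d2 d3"
    and count: "card (points m ` solutions (exps d1 d2 d3) m (\<lambda>k. T (canonical d1 d2 d3 k))) = \<nu>"
    and finite_points: "\<And>\<sigma> q i l. (\<And>k. k \<in> exps d1 d2 d3 \<Longrightarrow>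
        (\<Sum>i<m. chart_term d1 d2 d3 \<sigma> q i k) = T (canonical d1 d2 d3 k)) \<Longrightarrow>
      i < m \<Longrightarrow> l \<in> {1, 2, 3} \<Longrightarrow> \<not> \<sigma> (i, l)"
    and nonzero: "\<And>q i. q \<in> solutions (exps d1 d2 d3) m (\<lambda>k. T (canonical d1 d2 d3 k)) \<Longrightarrow>
      i < m \<Longrightarrow> q (i, 0) \<noteq> 0"
    and sep: "\<And>q. q \<in> solutions (exps d1 d2 d3) m (\<lambda>k. T (canonical d1 d2 d3 k)) \<Longrightarrow>
      \<forall>j<m. separated (box d1 d2 d3) j q"
begin

abbreviation "K \<equiv> exps d1 d2 d3"
abbreviation "\<tau> \<equiv> \<lambda>k. T (canonical d1 d2 d3 k)"
abbreviation "X \<equiv> segre_veronese d1 d2 d3 :: 'a tensor set set"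
abbreviation "symt \<equiv> sym_tensor d1 d2 d3 :: (expo \<Rightarrow> 'a) \<Rightarrow> 'a tensor"

definition tens :: "'a \<times> 'a \<times> 'a \<times> 'a \<Rightarrow> 'a tensor" where
  "tens p = symt (point_term p)"

definition summand :: "(nat \<times> nat \<Rightarrow> 'a) \<Rightarrow> nat \<Rightarrow> 'a tensor" where
  "summand q i = tens (q (i, 0), q (i, 1), q (i, 2), q (i, 3))"

lemma T_eq: "T = symt \<tau>"
  by (rule partially_symmetric_eq_sym_tensor[OF T])

lemma zero_in_K: "(0, 0, 0) \<in> K" "(1, 0, 0) \<in> K" "(0, 1, 0) \<in> K" "(0, 0, 1) \<in> K"
  using d by (auto simp: box_def)

lemma tens_nonzero:
  assumes "w \<noteq> 0"
  shows "tens (w, x, y, z) \<noteq> 0"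
proof
  assume "tens (w, x, y, z) = 0"
  then have "tens (w, x, y, z) (canonical d1 d2 d3 (0, 0, 0)) = 0" by simp
  then show False using assms zero_in_K by (simp add: tens_def point_term_def)
qed

lemma proj_point_tens_in:
  assumes "w \<noteq> 0"
  shows "proj_point (tens (w, x, y, z)) \<in> X"
proof -
  let ?a = "\<lambda>x b. if b then x else (1 :: 'a)"
  let ?D = "tensor_prod d1 (tensor_power d1 (?a x)) (tensor_prod d2 (tensor_power d2 (?a y)) (tensor_power d3 (?a z)))"
  have "tens (w, x, y, z) = tscale w ?D"
    unfolding decomposable_eq_sym_tensor tens_def sym_tensor_scale[symmetric]
    by (rule sym_tensor_cong) (auto simp: point_term_def mult.assoc)
  then have "tens (w, x, y, z) \<in> proj_point ?D" unfolding proj_point_iff by blast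
  then have "proj_point (tens (w, x, y, z)) = proj_point ?D"
    using tens_nonzero[OF assms] by (rule proj_point_eqI)
  moreover have "?a x \<noteq> 0" for x by (auto simp: fun_eq_iff intro!: exI[of _ False])
  ultimately show ?thesis unfolding segre_veronese_def by blast
qed

text \<open>The vector \<open>v\<close> may be zero, as its scalar goes into \<open>r 0\<close>.
  This matters for combinations whose coefficients are not yet known to be nonzero.\<close>

lemma line_chart:
  assumes "s \<in> X" "v \<in> s"
  shows "\<exists>\<sigma> r. v = symt (\<lambda>(\<alpha>, \<beta>, \<gamma>). r (0::nat) * chart_power (\<sigma> (1::nat)) (r 1) d1 \<alpha> *
    chart_power (\<sigma> 2) (r 2) d2 \<beta> * chart_power (\<sigma> 3) (r 3) d3 \<gamma>)"
proof -
  obtain a b c where abc: "a \<noteq> 0" "b \<noteq> 0" "c \<noteq> 0" and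
    s: "s = proj_point (tensor_prod d1 (tensor_power d1 a) (tensor_prod d2 (tensor_power d2 b) (tensor_power d3 c)))"
    using assms(1) unfolding segre_veronese_def by blast
  obtain e where v: "v = tscale e (tensor_prod d1 (tensor_power d1 a) (tensor_prod d2 (tensor_power d2 b) (tensor_power d3 c)))"
    using assms(2) unfolding s proj_point_iff by blast
  obtain \<kappa>1 s1 x1 where 1: "\<forall>\<alpha>\<le>d1. a True ^ \<alpha> * a False ^ (d1 - \<alpha>) = \<kappa>1 * chart_power s1 x1 d1 \<alpha>"
    using chart_power_cases[OF abc(1)] by blast
  obtain \<kappa>2 s2 x2 where 2: "\<forall>\<alpha>\<le>d2. b True ^ \<alpha> * b False ^ (d2 - \<alpha>) = \<kappa>2 * chart_power s2 x2 d2 \<alpha>"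
    using chart_power_cases[OF abc(2)] by blast
  obtain \<kappa>3 s3 x3 where 3: "\<forall>\<alpha>\<le>d3. c True ^ \<alpha> * c False ^ (d3 - \<alpha>) = \<kappa>3 * chart_power s3 x3 d3 \<alpha>"
    using chart_power_cases[OF abc(3)] by blast
  let ?\<sigma> = "\<lambda>l::nat. if l = 1 then s1 else if l = 2 then s2 else s3"
  let ?r = "\<lambda>l::nat. if l = 0 then e * \<kappa>1 * \<kappa>2 * \<kappa>3 else if l = 1 then x1 else if l = 2 then x2 else x3"
  have "v = symt (\<lambda>(\<alpha>, \<beta>, \<gamma>). ?r 0 * chart_power (?\<sigma> 1) (?r 1) d1 \<alpha> *
    chart_power (?\<sigma> 2) (?r 2) d2 \<beta> * chart_power (?\<sigma> 3) (?r 3) d3 \<gamma>)"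
    unfolding v decomposable_eq_sym_tensor sym_tensor_scale[symmetric]
  proof (rule sym_tensor_cong)
    fix k assume "k \<in> K"
    then obtain \<alpha> \<beta> \<gamma> where k: "k = (\<alpha>, \<beta>, \<gamma>)" "\<alpha> \<le> d1" "\<beta> \<le> d2" "\<gamma> \<le> d3" by (auto simp: box_def)
    show "e * (case k of (\<alpha>, \<beta>, \<gamma>) \<Rightarrow> a True ^ \<alpha> * a False ^ (d1 - \<alpha>) * (b True ^ \<beta> * b False ^ (d2 - \<beta>)) *
        (c True ^ \<gamma> * c False ^ (d3 - \<gamma>))) = (case k of (\<alpha>, \<beta>, \<gamma>) \<Rightarrow> ?r 0 * chart_power (?\<sigma> 1) (?r 1) d1 \<alpha> *
        chart_power (?\<sigma> 2) (?r 2) d2 \<beta> * chart_power (?\<sigma> 3) (?r 3) d3 \<gamma>)"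
      unfolding k(1) prod.case 1[rule_format, OF k(2)] 2[rule_format, OF k(3)] 3[rule_format, OF k(4)]
      by (simp add: ac_simps)
  qed
  then show ?thesis by (rule exI[of _ ?r, THEN exI[of _ ?\<sigma>]])
qed

text \<open>The common source of both counts: once infinity is excluded by
  \<open>finite_points\<close>, any way of writing \<open>T\<close> by vectors on lines of
  \<open>X\<close> is a solution in affine parameters.\<close>

lemma sum_of_lines:
  assumes f: "\<And>i. i < m \<Longrightarrow> \<exists>s\<in>X. f i \<in> s" and sum: "(\<Sum>i<m. f i) = T"
  obtains q where "q \<in> solutions K m \<tau>" "\<And>i. i < m \<Longrightarrow> f i = summand q i"
proof -
  have "\<forall>i\<in>{..<m}. \<exists>z. f i = symt (\<lambda>(\<alpha>, \<beta>, \<gamma>). snd z (0::nat) * chart_power (fst z (1::nat)) (snd z 1) d1 \<alpha> *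
    chart_power (fst z 2) (snd z 2) d2 \<beta> * chart_power (fst z 3) (snd z 3) d3 \<gamma>)"
    using f line_chart by fastforce
  from bchoice[OF this] obtain z :: "nat \<Rightarrow> (nat \<Rightarrow> bool) \<times> (nat \<Rightarrow> 'a)" where
    z: "\<And>i. i < m \<Longrightarrow> f i = symt (\<lambda>(\<alpha>, \<beta>, \<gamma>).
      snd (z i) 0 * chart_power (fst (z i) 1) (snd (z i) 1) d1 \<alpha> *
      chart_power (fst (z i) 2) (snd (z i) 2) d2 \<beta> * chart_power (fst (z i) 3) (snd (z i) 3) d3 \<gamma>)" by auto
  define \<sigma> where "\<sigma> = (\<lambda>(i, l). fst (z i) l)"
  define q where "q = (\<lambda>(i, l). snd (z i) l)"
  have fi: "f i = symt (chart_term d1 d2 d3 \<sigma> q i)" if "i < m" for i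
    unfolding z[OF that] by (simp add: chart_term_def \<sigma>_def q_def)
  have "symt (\<lambda>k. \<Sum>i<m. chart_term d1 d2 d3 \<sigma> q i k) = (\<Sum>i<m. f i)"
    unfolding sym_tensor_sum by (rule sum.cong) (auto simp: fi)
  also have "\<dots> = symt \<tau>" unfolding sum by (rule T_eq)
  finally have "symt (\<lambda>k. \<Sum>i<m. chart_term d1 d2 d3 \<sigma> q i k) = symt \<tau>" .
  then have eq: "(\<Sum>i<m. chart_term d1 d2 d3 \<sigma> q i k) = \<tau> k" if "k \<in> K" for k
    using that unfolding sym_tensor_eq_iff by blast
  have \<sigma>: "\<not> \<sigma> (i, l)" if "i < m" "l \<in> {1, 2, 3}" for i l
    by (rule finite_points[OF eq that])
  have chart: "chart_term d1 d2 d3 \<sigma> q i = term_at q i" if "i < m" for i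
    using \<sigma>[OF that] by (auto simp: chart_term_def term_at_def chart_power_def)
  show ?thesis
  proof (rule that)
    show "q \<in> solutions K m \<tau>"
      using eq chart by (simp add: solutions_def terms_sum_def)
    show "f i = summand q i" if "i < m" for i
      unfolding fi[OF that] chart[OF that] summand_def tens_def
      by (rule arg_cong[where f = symt]) (auto simp: term_at_eq_point_term)
  qed
qed

lemma solution_sum:
  assumes "q \<in> solutions K m \<tau>"
  shows "(\<Sum>i<m. summand q i) = T"
proof -
  have "(\<Sum>i<m. summand q i) = symt \<tau>"
    unfolding summand_def tens_def sym_tensor_sum[symmetric]
    by (rule sym_tensor_cong) (use assms in \<open>simp add: solutions_def terms_sum_def term_at_eq_point_term\<close>)
  then show ?thesis using T_eq by simp
qed

lemma tens_points: "image_mset tens (points m q) = image_mset (summand q) (mset_set {..<m})"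
  unfolding points_def image_mset.compositionality
  by (rule image_mset_cong) (simp add: summand_def)

lemma decompositions_eq: "decompositions X m T = image_mset tens ` points m ` solutions K m \<tau>"
proof (intro equalityI subsetI)
  fix M assume "M \<in> decompositions X m T"
  then have M: "size M = m" "\<And>v. v \<in># M \<Longrightarrow> v \<noteq> 0 \<and> proj_point v \<in> X" "sum_mset M = T"
    by (auto simp: decompositions_def)
  obtain vs where vs: "mset vs = M" using ex_mset by blast
  have len: "length vs = m" using M(1) vs by (metis size_mset)
  have img: "image_mset ((!) vs) (mset_set {..<m}) = M"
    using vs len by (metis atLeast0LessThan map_nth mset_map mset_upt)
  have "\<exists>s\<in>X. vs ! i \<in> s" if "i < m" for i
  proof -
    have "vs ! i \<in># M" using vs len that nth_mem_mset by blast
    then show ?thesis using M(2) proj_point_self by blast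
  qed
  moreover have "(\<Sum>i<m. vs ! i) = T"
    using M(3) unfolding img[symmetric] by (simp add: sum_unfold_sum_mset)
  ultimately obtain q where q: "q \<in> solutions K m \<tau>" "\<And>i. i < m \<Longrightarrow> vs ! i = summand q i"
    using sum_of_lines[of "(!) vs"] by blast
  have "image_mset tens (points m q) = M"
    unfolding tens_points img[symmetric] by (rule image_mset_cong) (simp add: q(2))
  then show "M \<in> image_mset tens ` points m ` solutions K m \<tau>" using q(1) by blast
next
  fix M assume "M \<in> image_mset tens ` points m ` solutions K m \<tau>"
  then obtain q where q: "q \<in> solutions K m \<tau>" and M: "M = image_mset (summand q) (mset_set {..<m})"
    by (auto simp: tens_points)
  have "v \<noteq> 0 \<and> proj_point v \<in> X" if v: "v \<in># M" for v
  proof -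
    obtain i where i: "i < m" "v = summand q i" using v unfolding M by auto
    then show ?thesis
      using nonzero[OF q i(1)] tens_nonzero proj_point_tens_in by (simp add: summand_def)
  qed
  moreover have "sum_mset M = T"
    using solution_sum[OF q] by (simp add: M sum_unfold_sum_mset)
  ultimately show "M \<in> decompositions X m T" by (auto simp: decompositions_def M)
qed

lemma card_decompositions: "card (decompositions X m T) = \<nu>"
proof -
  let ?c = "\<lambda>v k. v (canonical d1 d2 d3 k) :: 'a"
  \<comment> \<open>A summand determines its parameters: the coefficient is the value at exponent
    zero, and the quotients by it at the three unit exponents are the affine coordinates.\<close>
  let ?g = "\<lambda>v. let w = ?c v (0, 0, 0) in (w, ?c v (1, 0, 0) / w, ?c v (0, 1, 0) / w, ?c v (0, 0, 1) / w)"
  have g: "?g (tens (w, x, y, z)) = (w, x, y, z)" if "w \<noteq> 0" for w x y z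
    using that zero_in_K by (simp add: tens_def point_term_def del: One_nat_def)
  have "image_mset ?g (image_mset tens (points m q)) = points m q" if "q \<in> solutions K m \<tau>" for q
    unfolding points_def image_mset.compositionality comp_def
    by (rule image_mset_cong) (use g nonzero[OF that] in auto)
  then have "inj_on (image_mset tens) (points m ` solutions K m \<tau>)"
    by (intro inj_on_inverseI[where g = "image_mset ?g"]) auto
  then show ?thesis unfolding decompositions_eq using count by (simp add: card_image)
qed

section \<open>Secant spaces of a regular tensor\<close>

lemma summand_coord: "k \<in> K \<Longrightarrow> summand q i (canonical d1 d2 d3 k) =
    q (i, 0) * point_term (1, q (i, 1), q (i, 2), q (i, 3)) k"
  by (simp add: summand_def tens_def point_term_def mult.assoc split: prod.split)

lemma summands_independent:
  assumes q: "q \<in> solutions K m \<tau>" and 0: "(\<Sum>i<m. tscale (u i) (summand q i)) = 0" and i: "i < m"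
  shows "u i = 0"
proof -
  have "u i * q (i, 0) = 0"
  proof (rule separated_independent[OF sep[OF q] _ i])
    fix k assume k: "k \<in> K"
    have "(\<Sum>i<m. tscale (u i) (summand q i)) (canonical d1 d2 d3 k) = 0" unfolding 0 by simp
    then show "(\<Sum>i<m. u i * q (i, 0) * point_term (1, q (i, 1), q (i, 2), q (i, 3)) k) = 0"
      using k by (simp add: sum_fun_apply tscale_def summand_coord mult.assoc)
  qed
  then show ?thesis using nonzero[OF q i] by simp
qed

lemma summand_not_proportional:
  assumes q: "q \<in> solutions K m \<tau>" and ij: "i < m" "j < m" and c: "summand q i = tscale c (summand q j)"
  shows "i = j"
proof (rule ccontr)
  assume "i \<noteq> j"
  define u where "u l = (if l = i then 1 else if l = j then - c else 0)" for l
  have "(\<Sum>l<m. tscale (u l) (summand q l)) = (\<Sum>l\<in>{i, j}. tscale (u l) (summand q l))"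
    using ij by (intro sum.mono_neutral_right) (auto simp: u_def tscale_def)
  also have "\<dots> = 0" using \<open>i \<noteq> j\<close> c by (simp add: u_def tscale_def fun_eq_iff)
  finally have "u i = 0" using summands_independent[OF q _ ij(1)] by blast
  then show False by (simp add: u_def)
qed

lemma inj_summand: "q \<in> solutions K m \<tau> \<Longrightarrow> inj_on (summand q) {..<m}"
  by (rule inj_onI) (metis lessThan_iff summand_not_proportional tscale_1)

lemma independent_summands:
  assumes q: "q \<in> solutions K m \<tau>"
  shows "tensor.independent (summand q ` {..<m})"
proof (rule tensor.independent_if_scalars_zero)
  fix f x assume 0: "(\<Sum>x\<in>summand q ` {..<m}. tscale (f x) x) = 0" and "x \<in> summand q ` {..<m}"
  then obtain i where i: "i < m" "x = summand q i" by auto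
  show "f x = 0"
    using summands_independent[OF q, of "\<lambda>i. f (summand q i)"] 0 i
    by (simp add: sum.reindex[OF inj_summand[OF q]])
qed simp

definition secant_space :: "(nat \<times> nat \<Rightarrow> 'a) \<Rightarrow> 'a tensor set set" where
  "secant_space q = proj_space (tensor.span (summand q ` {..<m}))"

text \<open>By \<open>separated_secant\<close> every point of \<open>r\<close> is a point of
  \<open>q\<close>. Since summands of \<open>r\<close> are not proportional, this assignment is a
  permutation, and only the coefficients remain to be compared.\<close>

lemma solution_eq_if_span_subset:
  assumes q: "q \<in> solutions K m \<tau>" and r: "r \<in> solutions K m \<tau>"
    and sub: "tensor.span (summand r ` {..<m}) \<subseteq> tensor.span (summand q ` {..<m})"
  shows "points m r = points m q"
proof -
  have "\<exists>j<m. r (i, 1) = q (j, 1) \<and> r (i, 2) = q (j, 2) \<and> r (i, 3) = q (j, 3)" if i: "i < m" for i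
  proof -
    have "summand r i \<in> tensor.span (summand q ` {..<m})"
      using sub i by (auto intro: tensor.span_base)
    then obtain c where c: "summand r i = (\<Sum>j<m. tscale (c j) (summand q j))"
      using span_image_eq_sum[of "{..<m}"] by blast
    show ?thesis
    proof (rule separated_secant[OF sep[OF q] nonzero[OF r i], where c = "\<lambda>j. c j * q (j, 0)"])
      fix k assume k: "k \<in> K"
      have "summand r i (canonical d1 d2 d3 k) = (\<Sum>j<m. tscale (c j) (summand q j)) (canonical d1 d2 d3 k)"
        unfolding c ..
      also have "\<dots> = (\<Sum>j<m. c j * q (j, 0) * point_term (1, q (j, 1), q (j, 2), q (j, 3)) k)"
        using k by (simp add: sum_fun_apply tscale_def summand_coord mult.assoc)
      finally show "point_term (r (i, 0), r (i, 1), r (i, 2), r (i, 3)) k =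
          (\<Sum>j<m. c j * q (j, 0) * point_term (1, q (j, 1), q (j, 2), q (j, 3)) k)"
        using k by (simp add: summand_def tens_def)
    qed
  qed
  then obtain \<pi> where \<pi>: "\<And>i. i < m \<Longrightarrow> \<pi> i < m \<and> r (i, 1) = q (\<pi> i, 1) \<and> r (i, 2) = q (\<pi> i, 2) \<and> r (i, 3) = q (\<pi> i, 3)"
    by metis
  have inj: "inj_on \<pi> {..<m}"
  proof (rule inj_onI)
    fix i j assume ij: "i \<in> {..<m}" "j \<in> {..<m}" "\<pi> i = \<pi> j"
    have "summand r i = tscale (r (i, 0) / r (j, 0)) (summand r j)"
      unfolding summand_def tens_def sym_tensor_scale[symmetric]
      using \<pi>[of i] \<pi>[of j] ij nonzero[OF r, of j]
      by (intro sym_tensor_cong) (auto simp: point_term_def)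
    then show "i = j" using summand_not_proportional[OF r] ij by blast
  qed
  have "\<pi> ` {..<m} = {..<m}" by (rule endo_inj_surj) (use inj \<pi> in auto)
  then have bij: "bij_betw \<pi> {..<m} {..<m}" using inj by (simp add: bij_betw_def)
  \<comment> \<open>Both solutions write \<open>T\<close> in the same linearly independent
    vectors.\<close>
  have w: "r (i, 0) = q (\<pi> i, 0)" if i: "i < m" for i
  proof -
    let ?\<rho> = "the_inv_into {..<m} \<pi>"
    have \<rho>: "?\<rho> (\<pi> i) = i" if "i < m" for i using the_inv_into_f_f[OF inj] that by simp
    have "r (?\<rho> (\<pi> i), 0) - q (\<pi> i, 0) = 0"
    proof (rule separated_independent[OF sep[OF q], where c = "\<lambda>j. r (?\<rho> j, 0) - q (j, 0)"])
      fix k assume k: "k \<in> K"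
      let ?e = "\<lambda>j. point_term (1, q (j, 1), q (j, 2), q (j, 3)) k"
      have "(\<Sum>j<m. r (?\<rho> j, 0) * ?e j) = (\<Sum>i<m. r (?\<rho> (\<pi> i), 0) * ?e (\<pi> i))"
        using sum.reindex_bij_betw[OF bij, of "\<lambda>j. r (?\<rho> j, 0) * ?e j"] by simp
      also have "\<dots> = (\<Sum>i<m. term_at r i k)"
        using \<rho> \<pi> by (intro sum.cong) (auto simp: term_at_def point_term_def mult.assoc split: prod.split)
      also have "\<dots> = (\<Sum>i<m. term_at q i k)"
        using q r k by (simp add: solutions_def terms_sum_def)
      also have "\<dots> = (\<Sum>j<m. q (j, 0) * ?e j)"
        by (intro sum.cong) (auto simp: term_at_def point_term_def mult.assoc split: prod.split)
      finally show "(\<Sum>j<m. (r (?\<rho> j, 0) - q (j, 0)) * ?e j) = 0"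
        by (simp add: left_diff_distrib sum_subtractf)
    qed (use \<pi> i in blast)
    then show ?thesis using \<rho>[OF i] by simp
  qed
  have "(\<lambda>i. if i < m then \<pi> i else i) permutes {..<m}"
  proof (rule bij_imp_permutes)
    show "bij_betw (\<lambda>i. if i < m then \<pi> i else i) {..<m} {..<m}"
      using bij by (rule bij_betw_cong[THEN iffD2, rotated]) simp
  qed simp
  moreover have "r (i, l) = q (\<pi> i, l)" if "i < m" "l < 4" for i l
    using w[of i] \<pi>[of i] that by (auto simp: less_Suc_eq numeral_eq_Suc)
  ultimately show ?thesis unfolding points_eq_iff
    by (intro bexI[of _ "\<lambda>i. if i < m then \<pi> i else i"]) auto
qed

lemma secant_space_eq_iff:
  assumes q: "q \<in> solutions K m \<tau>" and r: "r \<in> solutions K m \<tau>"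
  shows "secant_space q = secant_space r \<longleftrightarrow> points m q = points m r"
proof
  assume "secant_space q = secant_space r"
  then show "points m q = points m r"
    unfolding secant_space_def by (intro solution_eq_if_span_subset[OF r q] proj_space_eq_imp_subset)
next
  assume "points m q = points m r"
  then have "set_mset (image_mset tens (points m q)) = set_mset (image_mset tens (points m r))" by simp
  then show "secant_space q = secant_space r" unfolding tens_points secant_space_def by simp
qed

text \<open>A point of the span of \<open>m\<close> lines is a sum of one vector from each line,
  hence a solution. Its summands are nonzero, so they span the given lines and the secant space is
  that of the solution.\<close>

lemma secant_spaces_eq:
  assumes m: "m = k + 1" and T0: "T \<noteq> 0"
  shows "secant_spaces_through X k (proj_point T) = secant_space ` solutions K m \<tau>"
proof (intro equalityI subsetI)
  fix L assume "L \<in> secant_spaces_through X k (proj_point T)"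
  then obtain S where S: "L = proj_space (tensor.span (\<Union>S))" "S \<subseteq> X" "card S = m"
    "proj_point T \<in> proj_space (tensor.span (\<Union>S))"
    unfolding secant_spaces_through_def m by blast
  have "finite S" using S(3) m card_ge_0_finite by force
  then obtain s where s: "bij_betw s {..<m} S"
    using ex_bij_betw_nat_finite[of S] S(3) by (auto simp: atLeast0LessThan)
  have "\<forall>i\<in>{..<m}. \<exists>v. s i = proj_point v"
    using s S(2) unfolding bij_betw_def segre_veronese_def by blast
  from bchoice[OF this] obtain v where v: "\<And>i. i < m \<Longrightarrow> s i = proj_point (v i)" by auto
  have S_eq: "S = proj_point ` v ` {..<m}" using s v unfolding bij_betw_def by (auto simp: image_image)
  have span: "tensor.span (\<Union>S) = tensor.span (v ` {..<m})" unfolding S_eq span_Union_proj_point ..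
  obtain T' where "T' \<in> tensor.span (v ` {..<m})" "proj_point T = proj_point T'"
    using S(4) unfolding span proj_space_def by blast
  then have "T \<in> tensor.span (v ` {..<m})"
    using proj_point_self[of T] by (auto simp: proj_point_iff intro: tensor.span_scale)
  then obtain c where c: "T = (\<Sum>i<m. tscale (c i) (v i))" using span_image_eq_sum[of "{..<m}"] by blast
  have in_line: "tscale (c i) (v i) \<in> proj_point (v i)" for i by (auto simp: proj_point_iff)
  have "\<exists>s\<in>X. tscale (c i) (v i) \<in> s" if "i < m" for i
    using in_line[of i] S(2) that unfolding S_eq by blast
  then obtain q where q: "q \<in> solutions K m \<tau>" "\<And>i. i < m \<Longrightarrow> tscale (c i) (v i) = summand q i"
    using sum_of_lines[of "\<lambda>i. tscale (c i) (v i)"] c by metis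
  have "proj_point (summand q i) = proj_point (v i)" if "i < m" for i
    using in_line[of i] q(2)[OF that] nonzero[OF q(1) that] tens_nonzero
    by (intro proj_point_eqI) (auto simp: summand_def)
  then have "proj_point ` summand q ` {..<m} = proj_point ` v ` {..<m}" by (auto simp: image_image)
  then have "tensor.span (summand q ` {..<m}) = tensor.span (v ` {..<m})"
    using span_Union_proj_point by metis
  then have "L = secant_space q" unfolding S(1) span secant_space_def by simp
  then show "L \<in> secant_space ` solutions K m \<tau>" using q(1) by (rule image_eqI)
next
  fix L assume "L \<in> secant_space ` solutions K m \<tau>"
  then obtain q where q: "q \<in> solutions K m \<tau>" and L: "L = secant_space q" by blast
  let ?S = "proj_point ` summand q ` {..<m}"
  have span: "tensor.span (\<Union>?S) = tensor.span (summand q ` {..<m})" by (rule span_Union_proj_point)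
  have "inj_on (\<lambda>i. proj_point (summand q i)) {..<m}"
  proof (rule inj_onI)
    fix i j assume ij: "i \<in> {..<m}" "j \<in> {..<m}" "proj_point (summand q i) = proj_point (summand q j)"
    then obtain c where "summand q i = tscale c (summand q j)"
      using proj_point_self proj_point_iff by metis
    then show "i = j" using summand_not_proportional[OF q] ij by blast
  qed
  then have "card ?S = k + 1" unfolding image_image m[symmetric] by (simp add: card_image)
  moreover have "?S \<subseteq> X"
    using nonzero[OF q] proj_point_tens_in by (auto simp: summand_def)
  moreover have "tensor.dim (tensor.span (\<Union>?S)) = k + 1"
    unfolding span m[symmetric] tensor.dim_span_eq_card_independent[OF independent_summands[OF q]]
    by (simp add: card_image inj_summand[OF q])
  moreover have "proj_point T \<in> proj_space (tensor.span (\<Union>?S))"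
  proof -
    have "T \<in> tensor.span (summand q ` {..<m})"
      unfolding solution_sum[OF q, symmetric] by (intro tensor.span_sum tensor.span_base) auto
    then show ?thesis unfolding span proj_space_def using T0 by blast
  qed
  moreover have "L = proj_space (tensor.span (\<Union>?S))" unfolding span L secant_space_def ..
  ultimately show "L \<in> secant_spaces_through X k (proj_point T)"
    unfolding secant_spaces_through_def by blast
qed

lemma card_secant_spaces:
  assumes "m = k + 1" "T \<noteq> 0"
  shows "card (secant_spaces_through X k (proj_point T)) = \<nu>"
proof -
  \<comment> \<open>The choice of a solution does not matter, because equal multisets give equal
    secant spaces; the converse makes the map injective.\<close>
  let ?g = "\<lambda>N. secant_space (SOME q. q \<in> solutions K m \<tau> \<and> points m q = N)"
  have some: "?g (points m q) = secant_space q" if q: "q \<in> solutions K m \<tau>" for q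
  proof -
    have "\<exists>r. r \<in> solutions K m \<tau> \<and> points m r = points m q" using q by blast
    from someI_ex[OF this] show ?thesis using secant_space_eq_iff[OF _ q] by (elim conjE) blast
  qed
  have "?g ` points m ` solutions K m \<tau> = secant_space ` solutions K m \<tau>"
    using some by (auto simp: image_image)
  moreover have "inj_on ?g (points m ` solutions K m \<tau>)"
  proof (rule inj_onI)
    fix M N assume MN: "M \<in> points m ` solutions K m \<tau>" "N \<in> points m ` solutions K m \<tau>" "?g M = ?g N"
    then obtain q r where qr: "q \<in> solutions K m \<tau>" "M = points m q" "r \<in> solutions K m \<tau>" "N = points m r"
      by blast
    then have "secant_space q = secant_space r"
      using MN(3) unfolding qr(2,4) some[OF qr(1)] some[OF qr(3)] by simp
    then show "M = N" using qr secant_space_eq_iff by blast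
  qed
  ultimately have "card (secant_space ` solutions K m \<tau>) = card (points m ` solutions K m \<tau>)"
    using card_image[of ?g "points m ` solutions K m \<tau>"] by simp
  then show ?thesis unfolding secant_spaces_eq[OF assms] count .
qed

end

section \<open>Passage to the Zariski topology\<close>

definition regular_vector :: "nat \<Rightarrow> nat \<Rightarrow> nat \<Rightarrow> nat \<Rightarrow> nat \<Rightarrow> (expo \<Rightarrow> 'a::field) \<Rightarrow> bool" where
  "regular_vector d1 d2 d3 m \<nu> \<tau> \<longleftrightarrow> card (points m ` solutions (exps d1 d2 d3) m \<tau>) = \<nu> \<and>
    (\<forall>\<sigma> q. (\<forall>k\<in>exps d1 d2 d3. (\<Sum>i<m. chart_term d1 d2 d3 \<sigma> q i k) = \<tau> k) \<longrightarrow>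
      (\<forall>i<m. \<forall>l\<in>{1, 2, 3}. \<not> \<sigma> (i, l))) \<and>
    (\<forall>q\<in>solutions (exps d1 d2 d3) m \<tau>. (\<forall>i<m. q (i, 0) \<noteq> 0) \<and> (\<forall>j<m. separated (box d1 d2 d3) j q))"

text \<open>For a point of the open set only some multiple of a representing tensor is known to
  avoid the zeros of \<open>Q\<close>. Scaling the coefficients of the summands matches the
  solutions for proportional vectors.\<close>

lemma regular_vector_scale:
  fixes c :: "'a::field"
  assumes c: "c \<noteq> 0" and reg: "regular_vector d1 d2 d3 m \<nu> (\<lambda>k. c * \<tau> k)"
  shows "regular_vector d1 d2 d3 m \<nu> \<tau>"
proof -
  let ?K = "exps d1 d2 d3"
  define sc where "sc = (\<lambda>(b::'a) q (i::nat, l::nat). if l = 0 then b * q (i, 0) else q (i, l))"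
  have terms: "terms_sum m (sc b q) k = b * terms_sum m q k" for b q k
    by (auto simp: terms_sum_def term_at_def sc_def sum_distrib_left mult.assoc split: prod.split intro!: sum.cong)
  have charts: "(\<Sum>i<m. chart_term d1 d2 d3 \<sigma> (sc b q) i k) = b * (\<Sum>i<m. chart_term d1 d2 d3 \<sigma> q i k)" for \<sigma> b q k
    by (auto simp: chart_term_def sc_def sum_distrib_left mult.assoc split: prod.split intro!: sum.cong)
  have sc_inv: "sc b (sc (inverse b) q) = q" if "b \<noteq> 0" for b q
    using that by (auto simp: sc_def)
  have sol: "sc c q \<in> solutions ?K m (\<lambda>k. c * \<tau> k) \<longleftrightarrow> q \<in> solutions ?K m \<tau>" for q
    using c by (simp add: solutions_def terms)
  have sols: "solutions ?K m (\<lambda>k. c * \<tau> k) = sc c ` solutions ?K m \<tau>"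
  proof (intro equalityI subsetI)
    fix q assume "q \<in> solutions ?K m (\<lambda>k. c * \<tau> k)"
    then have "sc (inverse c) q \<in> solutions ?K m \<tau>" using sol[of "sc (inverse c) q"] sc_inv[OF c] by simp
    then show "q \<in> sc c ` solutions ?K m \<tau>" using sc_inv[OF c, of q] by (metis imageI)
  qed (use sol in blast)
  let ?f = "\<lambda>b (w, x, y, z). (b * w, x, y, z) :: 'a \<times> 'a \<times> 'a \<times> 'a"
  have pts: "points m (sc b q) = image_mset (?f b) (points m q)" for b q
    by (simp add: points_def image_mset.compositionality comp_def sc_def)
  have "image_mset (?f (inverse c)) (image_mset (?f c) N) = N" for N
  proof -
    have "?f (inverse c) \<circ> ?f c = id" using c by (auto simp: fun_eq_iff)
    then show ?thesis by (simp add: image_mset.compositionality)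
  qed
  then have "inj (image_mset (?f c))" by (rule inj_on_inverseI)
  then have "inj_on (image_mset (?f c)) (points m ` solutions ?K m \<tau>)" by (rule inj_on_subset) simp
  moreover have "points m ` solutions ?K m (\<lambda>k. c * \<tau> k) =
      image_mset (?f c) ` points m ` solutions ?K m \<tau>"
    unfolding sols image_image pts ..
  ultimately have count: "card (points m ` solutions ?K m (\<lambda>k. c * \<tau> k)) = card (points m ` solutions ?K m \<tau>)"
    by (simp only: card_image)
  have no_inf: "\<forall>i<m. \<forall>l\<in>{1, 2, 3}. \<not> \<sigma> (i, l)"
    if "\<forall>k\<in>?K. (\<Sum>i<m. chart_term d1 d2 d3 \<sigma> q i k) = \<tau> k" for \<sigma> q
    using reg that charts[of \<sigma> c q] unfolding regular_vector_def by metis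
  have "(\<forall>i<m. q (i, 0) \<noteq> 0) \<and> (\<forall>j<m. separated (box d1 d2 d3) j q)" if "q \<in> solutions ?K m \<tau>" for q
  proof -
    have "(\<forall>i<m. sc c q (i, 0) \<noteq> 0) \<and> (\<forall>j<m. separated (box d1 d2 d3) j (sc c q))"
      using reg that sol unfolding regular_vector_def by blast
    then show ?thesis by (simp add: sc_def separated_def)
  qed
  note good = this
  show ?thesis
    unfolding regular_vector_def
  proof (intro conjI)
    show "card (points m ` solutions ?K m \<tau>) = \<nu>" using count reg unfolding regular_vector_def by simp
  qed (use no_inf good in blast)+
qed

section \<open>Homogeneous polynomials and density\<close>

lemma homogeneous_polynomial_sum:
  "(\<And>i. i \<in> I \<Longrightarrow> homogeneous_polynomial n (f i)) \<Longrightarrow> homogeneous_polynomial n (\<lambda>T. \<Sum>i\<in>I. f i T)"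
  by (induction I rule: infinite_finite_induct) (auto intro: homogeneous_polynomial.intros)

text \<open>Collecting the powers of \<open>t\<close> after scaling the argument by \<open>t\<close>
  yields the homogeneous parts of \<open>Q\<close> as coefficients.\<close>

lemma homogeneous_parts:
  fixes Q :: "('k \<Rightarrow> 'a::field) \<Rightarrow> 'a"
  assumes "polyfun K Q"
  shows "\<exists>P. (\<forall>n. homogeneous_polynomial n (\<lambda>T. coeff (P T) n)) \<and>
    (\<forall>T t. poly (P T) t = Q (\<lambda>k. t * T (f k)))"
  using assms
proof (induction rule: polyfun.induct)
  case (const c)
  have "homogeneous_polynomial n (\<lambda>T :: 'a tensor. coeff [:c:] n)" for n
    by (cases n) (auto intro: homogeneous_polynomial.intros)
  then show ?case by (intro exI[of _ "\<lambda>_. [:c:]"]) simp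
next
  case (var i)
  have "homogeneous_polynomial n (\<lambda>T :: 'a tensor. coeff (monom (T (f i)) 1) n)" for n
    by (cases "n = 1") (auto intro: homogeneous_polynomial.intros homogeneous_polynomial.coord[simplified])
  then show ?case by (intro exI[of _ "\<lambda>T. monom (T (f i)) 1"]) (simp add: poly_monom mult.commute)
next
  case (add g h)
  then obtain P R where
    "\<forall>n. homogeneous_polynomial n (\<lambda>T. coeff (P T) n)" "\<forall>T t. poly (P T) t = g (\<lambda>k. t * T (f k))"
    "\<forall>n. homogeneous_polynomial n (\<lambda>T. coeff (R T) n)" "\<forall>T t. poly (R T) t = h (\<lambda>k. t * T (f k))" by blast
  then show ?case
    by (intro exI[of _ "\<lambda>T. P T + R T"]) (auto intro: homogeneous_polynomial.intros)
next
  case (mult g h)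
  then obtain P R where PR:
    "\<forall>n. homogeneous_polynomial n (\<lambda>T. coeff (P T) n)" "\<forall>T t. poly (P T) t = g (\<lambda>k. t * T (f k))"
    "\<forall>n. homogeneous_polynomial n (\<lambda>T. coeff (R T) n)" "\<forall>T t. poly (R T) t = h (\<lambda>k. t * T (f k))" by blast
  have "homogeneous_polynomial n (\<lambda>T. coeff (P T * R T) n)" for n
    unfolding coeff_mult
  proof (rule homogeneous_polynomial_sum)
    fix i assume "i \<in> {..n}"
    then show "homogeneous_polynomial n (\<lambda>T. coeff (P T) i * coeff (R T) (n - i))"
      using homogeneous_polynomial.mult[OF PR(1)[rule_format, of i] PR(3)[rule_format, of "n - i"]] by simp
  qed
  then show ?case using PR by (intro exI[of _ "\<lambda>T. P T * R T"]) simp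
qed

lemma polyfun_homogeneous_sym_tensor:
  "homogeneous_polynomial n g \<Longrightarrow> polyfun (exps d1 d2 d3) (\<lambda>U. g (sym_tensor d1 d2 d3 U))"
proof (induction rule: homogeneous_polynomial.induct)
  case (coord xs)
  show ?case
    by (cases "length xs = d1 + d2 + d3")
      (auto simp: sym_tensor_def expo_of_in[simplified] intro: polyfun.intros)
qed (auto intro: polyfun.intros)

lemma partially_symmetric_proj_point:
  assumes "T \<in> partially_symmetric d1 d2 d3" "S \<in> proj_point T"
  shows "S \<in> partially_symmetric d1 d2 d3"
proof -
  obtain c where "S = tscale c T" using assms(2) proj_point_iff by blast
  then have "S = sym_tensor d1 d2 d3 (\<lambda>k. c * T (canonical d1 d2 d3 k))"
    using partially_symmetric_eq_sym_tensor[OF assms(1)] sym_tensor_scale by metis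
  then show ?thesis using sym_tensor_in by metis
qed

text \<open>\<open>Q\<close> lives on the affine cone and need not be homogeneous; \<open>D\<close>
  consists of the points at which one of its homogeneous parts is nonzero. Density comes from
  multiplying \<open>Q\<close> by an equation \<open>g\<close> that is nonzero somewhere on the
  other open set.\<close>

lemma homogeneous_open_dense:
  fixes P :: "'a::field_char_0 tensor \<Rightarrow> 'a poly"
  assumes P: "\<And>n. homogeneous_polynomial n (\<lambda>T. coeff (P T) n)"
    and Q: "polyfun (exps d1 d2 d3) Q" "Q U0 \<noteq> 0"
    and PQ: "\<And>T. poly (P T) 1 = Q (\<lambda>k. T (canonical d1 d2 d3 k))"
  defines "V \<equiv> partially_symmetric d1 d2 d3"
  defines "D \<equiv> proj_space V - zero_locus V (range (\<lambda>n T. coeff (P T) n))"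
  shows "openin (zariski V) D" and "zariski V closure_of D = topspace (zariski V)"
proof -
  show "openin (zariski V) D"
    unfolding openin_zariski D_def
    by (rule exI[of _ "range (\<lambda>n T. coeff (P T) n)"]) (use P in auto)
  show "zariski V closure_of D = topspace (zariski V)"
    unfolding dense_intersects_open
  proof (intro allI impI)
    fix W assume W: "openin (zariski V) W \<and> W \<noteq> {}"
    then obtain G where G: "\<forall>g\<in>G. \<exists>n. homogeneous_polynomial n g" and WG: "W = proj_space V - zero_locus V G"
      unfolding openin_zariski by blast
    obtain p where p: "p \<in> proj_space V" "p \<notin> zero_locus V G" using W unfolding WG by blast
    then obtain g S where gS: "g \<in> G" "S \<in> p" "g S \<noteq> 0" unfolding zero_locus_def by blast
    obtain n where n: "homogeneous_polynomial n g" using G gS(1) by blast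
    have "S \<in> V" using p(1) gS(2) partially_symmetric_proj_point unfolding proj_space_def V_def by blast
    then have S: "S = sym_tensor d1 d2 d3 (\<lambda>k. S (canonical d1 d2 d3 k))"
      unfolding V_def by (rule partially_symmetric_eq_sym_tensor)
    let ?K = "exps d1 d2 d3"
    have g: "polyfun ?K (\<lambda>U. g (sym_tensor d1 d2 d3 U))" by (rule polyfun_homogeneous_sym_tensor[OF n])
    have z: "(0, 0, 0) \<in> ?K" by (simp add: box_def)
    have "g (sym_tensor d1 d2 d3 (\<lambda>k. S (canonical d1 d2 d3 k))) \<noteq> 0" using gS(3) S by metis
    then obtain U1 where U1: "Q U1 * g (sym_tensor d1 d2 d3 U1) \<noteq> 0"
      using polyfun_nonzero_mult[of ?K Q ?K "\<lambda>U. g (sym_tensor d1 d2 d3 U)", OF Q(1) g Q(2)] by blast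
    \<comment> \<open>The extra coordinate as a factor ensures that the tensor is nonzero and
      represents a projective point.\<close>
    obtain U where U: "(Q U * g (sym_tensor d1 d2 d3 U)) * U (0, 0, 0) \<noteq> 0"
      using polyfun_nonzero_mult[of ?K "\<lambda>U. Q U * g (sym_tensor d1 d2 d3 U)" ?K "\<lambda>U. U (0, 0, 0)" U1 "\<lambda>_. 1",
          OF polyfun.mult[OF Q(1) g] polyfun.var[OF z] U1] by auto
    let ?T = "sym_tensor d1 d2 d3 U"
    have "?T (canonical d1 d2 d3 (0, 0, 0)) = U (0, 0, 0)" by (rule sym_tensor_canonical[OF z])
    then have "?T (canonical d1 d2 d3 (0, 0, 0)) \<noteq> 0" using U by auto
    then have "?T \<noteq> 0" by (metis zero_fun_apply)
    then have in_V: "proj_point ?T \<in> proj_space V"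
      unfolding proj_space_def V_def using sym_tensor_in by blast
    moreover have "proj_point ?T \<notin> zero_locus V G"
      using U gS(1) proj_point_self[of ?T] unfolding zero_locus_def by auto
    moreover have "proj_point ?T \<notin> zero_locus V (range (\<lambda>n T. coeff (P T) n))"
    proof -
      have "Q (\<lambda>k. ?T (canonical d1 d2 d3 k)) = Q U" by (rule polyfun_cong[OF Q(1)]) (rule sym_tensor_canonical)
      then have "poly (P ?T) 1 \<noteq> 0" unfolding PQ using U by simp
      then have "P ?T \<noteq> 0" by auto
      then have "coeff (P ?T) (degree (P ?T)) \<noteq> 0" by simp
      then show ?thesis using proj_point_self[of ?T] unfolding zero_locus_def by fast
    qed
    ultimately show "D \<inter> W \<noteq> {}" unfolding D_def WG by blast
  qed
qed

theorem corollary2: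
  fixes d1 d2 d3 k :: nat
  assumes "d3 \<ge> d2" and "d2 \<ge> d1" and "d1 \<ge> 3" and "k \<ge> 1"
    and "(d1 + 1) * (d2 + 1) * (d3 + 1) = 4 * (k + 1)"
    and "k + 1 \<le> (d3 - 2) * (((d1 + 1) * (d2 + 1)) div 3)"
  shows "\<exists>\<nu>\<ge>2. holds_generally
    (partially_symmetric d1 d2 d3 :: 'a::{alg_closed_field, field_char_0} tensor set)
    (\<lambda>p. card (secant_spaces_through (segre_veronese d1 d2 d3) k p) = \<nu> \<and>
         (\<forall>T. T \<noteq> 0 \<and> proj_point T = p \<longrightarrow>
            card (decompositions (segre_veronese d1 d2 d3) (k + 1) T) = \<nu>))"
proof -
  let ?V = "partially_symmetric d1 d2 d3 :: 'a tensor set"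
  have d: "d1 \<ge> 3" "d2 \<ge> 3" "d3 \<ge> 3" using assms by auto
  obtain \<nu> and Q :: "(expo \<Rightarrow> 'a) \<Rightarrow> 'a" where \<nu>: "\<nu> \<ge> 2" and Q: "polyfun (exps d1 d2 d3) Q" "\<exists>U. Q U \<noteq> 0"
    and reg: "\<And>U. Q U \<noteq> 0 \<Longrightarrow> regular_vector d1 d2 d3 (k + 1) \<nu> U"
    using general_sum_of_monomial_vectors[OF d assms(5), where 'a = 'a]
    unfolding regular_vector_def by blast
  obtain U0 where U0: "Q U0 \<noteq> 0" using Q(2) by blast
  obtain P where P: "\<And>n. homogeneous_polynomial n (\<lambda>T. coeff (P T) n)"
    "\<And>T t. poly (P T) t = Q (\<lambda>k. t * T (canonical d1 d2 d3 k))"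
    using homogeneous_parts[OF Q(1), of "canonical d1 d2 d3"] by blast
  have P1: "poly (P T) 1 = Q (\<lambda>k. T (canonical d1 d2 d3 k))" for T using P(2)[of T 1] by simp
  let ?D = "proj_space ?V - zero_locus ?V (range (\<lambda>n T. coeff (P T) n))"
  have regular: "regular_tensor d1 d2 d3 (k + 1) \<nu> T"
    if p: "p \<in> ?D" and T: "T \<noteq> 0" "proj_point T = p" for p T
  proof -
    have "T \<in> ?V"
      using p T(2) proj_point_self[of T] partially_symmetric_proj_point unfolding proj_space_def by blast
    obtain n S where S: "S \<in> p" "coeff (P S) n \<noteq> 0" using p unfolding zero_locus_def by blast
    then obtain c where "S = tscale c T" using T(2) proj_point_iff by blast
    then have "coeff (P T) n \<noteq> 0" using S(2) homogeneous_polynomial_tscale[OF P(1)[of n], of c T] by auto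
    \<comment> \<open>The factor forces the value of \<open>t\<close> found next to be nonzero, so
      that scaling by it can be undone.\<close>
    then have "[:0, 1:] * P T \<noteq> 0" by (metis coeff_0 mult_eq_0_iff pCons_eq_0_iff zero_neq_one)
    then obtain t where "poly ([:0, 1:] * P T) t \<noteq> 0" using poly_all_0_iff_0 by blast
    then have t: "t \<noteq> 0" "poly (P T) t \<noteq> 0" by auto
    have "regular_vector d1 d2 d3 (k + 1) \<nu> (\<lambda>k. T (canonical d1 d2 d3 k))"
      by (rule regular_vector_scale[OF t(1) reg]) (use t(2) P(2) in simp)
    note R = this[unfolded regular_vector_def]
    show ?thesis
    proof
      show "\<not> \<sigma> (i, l)" if "\<And>k'. k' \<in> exps d1 d2 d3 \<Longrightarrow> (\<Sum>i<k + 1. chart_term d1 d2 d3 \<sigma> q i k') =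
          T (canonical d1 d2 d3 k')" "i < k + 1" "l \<in> {1, 2, 3}" for \<sigma> q i l
        using R that by blast
    qed (use d \<open>T \<in> ?V\<close> R in auto)
  qed
  have "card (secant_spaces_through (segre_veronese d1 d2 d3) k p) = \<nu>" if p: "p \<in> ?D" for p
  proof -
    obtain T where T: "T \<noteq> 0" "proj_point T = p" using p unfolding proj_space_def by blast
    show ?thesis
      using regular_tensor.card_secant_spaces[OF regular[OF p T] refl T(1)] unfolding T(2) .
  qed
  moreover have "card (decompositions (segre_veronese d1 d2 d3) (k + 1) T) = \<nu>"
    if p: "p \<in> ?D" and T: "T \<noteq> 0" "proj_point T = p" for p T
    using regular_tensor.card_decompositions[OF regular[OF p T]] .
  ultimately have "holds_generally ?V (\<lambda>p. card (secant_spaces_through (segre_veronese d1 d2 d3) k p) = \<nu> \<and>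
         (\<forall>T. T \<noteq> 0 \<and> proj_point T = p \<longrightarrow>
            card (decompositions (segre_veronese d1 d2 d3) (k + 1) T) = \<nu>))"
    unfolding holds_generally_def
    using homogeneous_open_dense[OF P(1) Q(1) U0 P1] by (intro exI[of _ ?D]) blast
  then show ?thesis using \<nu> by blast
qed

end
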